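(* Let $m,n\in\mathbb{N}$, $q\in(-1,1)\setminus\{0\}$, and let $\alpha_\pm=p_\pm q_\pm$, $\beta_\pm=p_\pm+q_\pm$ with $p_\pm,q_\pm\in(-1,1)\setminus\{0\}$. For $\kappa\in\Lambda^{(m,n)}$ let $\xi_\kappa\in\mathbb{R}^m$ be the unique global minimizer of $V_\kappa$. Then: (i) the spectrum of $H$ in $\ell^2(\Lambda^{(n,m)},\Delta)$ consists of the eigenvalues $E(\xi_\kappa)$, $\kappa\in\Lambda^{(m,n)}$, where $E(\xi)=2(1-q)\sum_{1\le j\le m}\cos(\xi_j)$; (ii) the functions $\psi_{\xi_\kappa}$, $\kappa\in\Lambda^{(m,n)}$, form a basis of $\ell^2(\Lambda^{(n,m)},\Delta)$ consisting of eigenfunctions of $H$, with $H\psi_{\xi_\kappa}=E(\xi_\kappa)\psi_{\xi_\kappa}$ for all $\kappa\in\Lambda^{(m,n)}$.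
   Context: $\Lambda^{(n,m)}=\{\mu\in\mathbb{Z}^n\mid m\ge\mu_1\ge\cdots\ge\mu_n\ge0\}$ and $\Lambda^{(m,n)}=\{\kappa\in\mathbb{Z}^m\mid n\ge\kappa_1\ge\cdots\ge\kappa_m\ge0\}$; for $\mu\in\Lambda^{(n,m)}$ set $\mu_0\equiv m$, $\mu_{n+1}\equiv0$. Let $e_i$ be the standard unit vectors of $\mathbb{Z}^n$, $\delta_i=1$ if $i=0$ and $0$ otherwise. Hamiltonian: $(H\psi)(\mu)=\bigl(\beta_+(1-q^{m-\mu_1})+\beta_-(1-q^{\mu_n})\bigr)\psi(\mu)+\sum_{1\le i\le n,\ \mu+e_i\in\Lambda^{(n,m)}}(1-\alpha_+q^{m-\mu_1-1})^{\delta_{i-1}}(1-q^{\mu_{i-1}-\mu_i})\psi(\mu+e_i)+\sum_{1\le i\le n,\ \mu-e_i\in\Lambda^{(n,m)}}(1-\alpha_-q^{\mu_n-1})^{\delta_{n-i}}(1-q^{\mu_i-\mu_{i+1}})\psi(\mu-e_i)$. Hilbert space: with $(a;q)_0=1$, $(a;q)_l=\prod_{s=0}^{l-1}(1-aq^s)$, weights $\Delta_\mu=\frac{(q;q)_m}{(\alpha_+;q)_{m-\mu_1}(\alpha_-;q)_{\mu_n}\prod_{0\le i\le n}(q;q)_{\mu_i-\mu_{i+1}}}$ and inner product $\langle\psi,\phi\rangle_\Delta=\sum_{\mu}\psi(\mu)\overline{\phi(\mu)}\Delta_\mu$ on functions $\Lambda^{(n,m)}\to\mathbb{C}$. Conjugate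 partition: for $\mu\in\Lambda^{(n,m)}$, $\mu'\in\Lambda^{(m,n)}$ is the partition in which $i$ occurs exactly $\mu_i-\mu_{i+1}$ times ($i=0,\dots,n$). Hall-Littlewood polynomials: for $\lambda\in\Lambda^{(m,n)}$, $R_\lambda(\xi)=\sum_{\sigma\in S_m}\sum_{\epsilon\in\{\pm1\}^m}C(\epsilon_1\xi_{\sigma(1)},\dots,\epsilon_m\xi_{\sigma(m)})\exp\bigl({\rm i}\sum_{j=1}^m\epsilon_j\xi_{\sigma(j)}\lambda_j\bigr)$ with $C(\xi)=\prod_{j}\frac{1-\beta_+e^{-{\rm i}\xi_j}+\alpha_+e^{-2{\rm i}\xi_j}}{1-e^{-2{\rm i}\xi_j}}\prod_{j<k}\frac{(1-qe^{-{\rm i}(\xi_j-\xi_k)})(1-qe^{-{\rm i}(\xi_j+\xi_k)})}{(1-e^{-{\rm i}(\xi_j-\xi_k)})(1-e^{-{\rm i}(\xi_j+\xi_k)})}$, defined for $\xi$ with $2\xi_j,\xi_j\pm\xi_k\notin2\pi\mathbb{Z}$ ($j\neq k$); $R_\lambda$ is a symmetric polynomial in $\cos\xi_1,\dots,\cos\xi_m$ and is extended to all $\xi\in\mathbb{R}^m$ accordingly. Wave function: $\psi_\xi(\mu)=R_{\mu'}(\xi)$ for $\mu\in\Lambda^{(n,m)}$. Morse function: with $v_a(z)=\int_0^z\frac{(1-a^2)dx}{1-2a\cos x+a^2}$ ($-1<a<1$), $V_\kappa(\xi)=\sum_{j<k}\bigl(\int_0^{\xi_j+\xi_k}v_q+\int_0^{\xi_j-\xi_k}v_q\bigr)+\sum_j\bigl(n\xi_j^2-2\pi(m+1-j+\kappa_j)\xi_j+\int_0^{\xi_j}(v_{p_+}+v_{q_+}+v_{p_-}+v_{q_-})\bigr)$;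 it is strictly convex and radially unbounded, hence has a unique global minimizer. *)

theory Defs
  imports "HOL-Analysis.Analysis"
begin

text \<open>Partitions in a box. A partition mu in Lambda^(n,m) is an int list of length n,
  weakly decreasing, with entries in [0,m]. Paper index i (1-based) corresponds to list index i-1.\<close>

definition Lam :: "nat \<Rightarrow> nat \<Rightarrow> int list set" where
  "Lam n m = {\<mu>. length \<mu> = n \<and> sorted_wrt (\<lambda>a b. a \<ge> b) \<mu> \<and> (\<forall>x\<in>set \<mu>. 0 \<le> x \<and> x \<le> int m)}"

definition part_at :: "nat \<Rightarrow> int list \<Rightarrow> nat \<Rightarrow> int" where
  "part_at m \<mu> i = (if i = 0 then int m else if i \<le> length \<mu> then \<mu> ! (i - 1) else 0)"

definition shift :: "int list \<Rightarrow> nat \<Rightarrow> int \<Rightarrow> int list" where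
  "shift \<mu> i d = \<mu>[i - 1 := \<mu> ! (i - 1) + d]"

definition Ham :: "real \<Rightarrow> real \<Rightarrow> real \<Rightarrow> real \<Rightarrow> real \<Rightarrow> nat \<Rightarrow> nat
    \<Rightarrow> (int list \<Rightarrow> complex) \<Rightarrow> int list \<Rightarrow> complex" where
  "Ham q ap bp am bm n m \<psi> \<mu> =
     complex_of_real (bp * (1 - q ^ nat (int m - part_at m \<mu> 1)) + bm * (1 - q ^ nat (part_at m \<mu> n))) * \<psi> \<mu>
   + (\<Sum>i\<in>{i\<in>{1..n}. shift \<mu> i 1 \<in> Lam n m}.
        complex_of_real ((if i = 1 then 1 - ap * q ^ nat (int m - part_at m \<mu> 1 - 1) else 1)
                         * (1 - q ^ nat (part_at m \<mu> (i - 1) - part_at m \<mu> i))) * \<psi> (shift \<mu> i 1))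
   + (\<Sum>i\<in>{i\<in>{1..n}. shift \<mu> i (-1) \<in> Lam n m}.
        complex_of_real ((if i = n then 1 - am * q ^ nat (part_at m \<mu> n - 1) else 1)
                         * (1 - q ^ nat (part_at m \<mu> i - part_at m \<mu> (Suc i)))) * \<psi> (shift \<mu> i (-1)))"

text \<open>Spectrum of H on the (finite-dimensional) space of functions Lambda^(n,m) -> C.\<close>
definition H_spectrum :: "real \<Rightarrow> real \<Rightarrow> real \<Rightarrow> real \<Rightarrow> real \<Rightarrow> nat \<Rightarrow> nat \<Rightarrow> complex set" where
  "H_spectrum q ap bp am bm n m =
     {E. \<exists>\<psi>. (\<exists>\<mu>\<in>Lam n m. \<psi> \<mu> \<noteq> 0) \<and> (\<forall>\<mu>\<in>Lam n m. Ham q ap bp am bm n m \<psi> \<mu> = E * \<psi> \<mu>)}"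

definition conj_part :: "nat \<Rightarrow> nat \<Rightarrow> int list \<Rightarrow> int list" where
  "conj_part n m \<mu> = (THE \<kappa>. \<kappa> \<in> Lam m n \<and>
      (\<forall>i\<le>n. int (count_list \<kappa> (int i)) = part_at m \<mu> i - part_at m \<mu> (Suc i)))"

text \<open>Points of R^m are functions nat => real vanishing from index m on; xi_j (1-based) is xi (j-1).\<close>
definition Rm :: "nat \<Rightarrow> (nat \<Rightarrow> real) set" where
  "Rm m = {\<xi>. \<forall>j\<ge>m. \<xi> j = 0}"

definition Cfun :: "real \<Rightarrow> real \<Rightarrow> real \<Rightarrow> nat \<Rightarrow> (nat \<Rightarrow> real) \<Rightarrow> complex" where
  "Cfun q ap bp m x =
     (\<Prod>j<m. (1 - complex_of_real bp * cis (- x j) + complex_of_real ap * cis (- 2 * x j))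
              / (1 - cis (- 2 * x j)))
   * (\<Prod>j<m. \<Prod>k\<in>{j<..<m}.
        ((1 - complex_of_real q * cis (- (x j - x k))) * (1 - complex_of_real q * cis (- (x j + x k))))
        / ((1 - cis (- (x j - x k))) * (1 - cis (- (x j + x k)))))"

definition generic :: "nat \<Rightarrow> (nat \<Rightarrow> real) set" where
  "generic m = {\<xi>. \<xi> \<in> Rm m \<and> (\<forall>j<m. \<forall>l::int. 2 * \<xi> j \<noteq> 2 * pi * l) \<and>
      (\<forall>j<m. \<forall>k<m. j \<noteq> k \<longrightarrow> (\<forall>l::int. \<xi> j + \<xi> k \<noteq> 2 * pi * l \<and> \<xi> j - \<xi> k \<noteq> 2 * pi * l))}"

definition R_gen :: "real \<Rightarrow> real \<Rightarrow> real \<Rightarrow> nat \<Rightarrow> int list \<Rightarrow> (nat \<Rightarrow> real) \<Rightarrow> complex" where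
  "R_gen q ap bp m lam \<xi> =
     (\<Sum>\<sigma>\<in>{\<sigma>. \<sigma> permutes {..<m}}. \<Sum>\<epsilon>\<in>({..<m} \<rightarrow>\<^sub>E {-1, 1::real}).
        Cfun q ap bp m (\<lambda>j. \<epsilon> j * \<xi> (\<sigma> j)) * cis (\<Sum>j<m. \<epsilon> j * \<xi> (\<sigma> j) * of_int (lam ! j)))"

text \<open>Extension to all of R^m (by continuity: R is a polynomial in the cosines).\<close>
definition HL :: "real \<Rightarrow> real \<Rightarrow> real \<Rightarrow> nat \<Rightarrow> int list \<Rightarrow> (nat \<Rightarrow> real) \<Rightarrow> complex" where
  "HL q ap bp m lam \<xi> = (if \<xi> \<in> generic m then R_gen q ap bp m lam \<xi>
                        else Lim (at \<xi> within generic m) (R_gen q ap bp m lam))"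

definition wave :: "real \<Rightarrow> real \<Rightarrow> real \<Rightarrow> nat \<Rightarrow> nat \<Rightarrow> (nat \<Rightarrow> real) \<Rightarrow> int list \<Rightarrow> complex" where
  "wave q ap bp n m \<xi> \<mu> = HL q ap bp m (conj_part n m \<mu>) \<xi>"

definition sint :: "real \<Rightarrow> real \<Rightarrow> (real \<Rightarrow> real) \<Rightarrow> real" where
  "sint a b f = (if a \<le> b then integral {a..b} f else - integral {b..a} f)"

definition vfun :: "real \<Rightarrow> real \<Rightarrow> real" where
  "vfun a z = sint 0 z (\<lambda>x. (1 - a\<^sup>2) / (1 - 2 * a * cos x + a\<^sup>2))"

text \<open>Morse function V_kappa (paper index j 1-based = list index j-1, so m+1-j becomes m-j).\<close>
definition Vmorse :: "real \<Rightarrow> real \<Rightarrow> real \<Rightarrow> real \<Rightarrow> real \<Rightarrow> nat \<Rightarrow> nat \<Rightarrow> int list \<Rightarrow> (nat \<Rightarrow> real) \<Rightarrow> real" where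
  "Vmorse q pp qp pm qm n m \<kappa> \<xi> =
     (\<Sum>j<m. \<Sum>k\<in>{j<..<m}. sint 0 (\<xi> j + \<xi> k) (vfun q) + sint 0 (\<xi> j - \<xi> k) (vfun q))
   + (\<Sum>j<m. real n * (\<xi> j)\<^sup>2 - 2 * pi * (real (m - j) + of_int (\<kappa> ! j)) * \<xi> j
        + sint 0 (\<xi> j) (\<lambda>x. vfun pp x + vfun qp x + vfun pm x + vfun qm x))"

definition xi_min :: "real \<Rightarrow> real \<Rightarrow> real \<Rightarrow> real \<Rightarrow> real \<Rightarrow> nat \<Rightarrow> nat \<Rightarrow> int list \<Rightarrow> (nat \<Rightarrow> real)" where
  "xi_min q pp qp pm qm n m \<kappa> = (THE \<xi>. \<xi> \<in> Rm m \<and>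
      (\<forall>\<eta>\<in>Rm m. Vmorse q pp qp pm qm n m \<kappa> \<xi> \<le> Vmorse q pp qp pm qm n m \<kappa> \<eta>))"

definition Efun :: "real \<Rightarrow> nat \<Rightarrow> (nat \<Rightarrow> real) \<Rightarrow> real" where
  "Efun q m \<xi> = 2 * (1 - q) * (\<Sum>j<m. cos (\<xi> j))"

definition is_basis_family :: "nat \<Rightarrow> nat \<Rightarrow> (int list \<Rightarrow> int list \<Rightarrow> complex) \<Rightarrow> bool" where
  "is_basis_family n m \<Phi> \<longleftrightarrow>
     (\<forall>c. (\<forall>\<mu>\<in>Lam n m. (\<Sum>\<kappa>\<in>Lam m n. c \<kappa> * \<Phi> \<kappa> \<mu>) = 0) \<longrightarrow> (\<forall>\<kappa>\<in>Lam m n. c \<kappa> = 0))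
   \<and> (\<forall>f. \<exists>c. \<forall>\<mu>\<in>Lam n m. f \<mu> = (\<Sum>\<kappa>\<in>Lam m n. c \<kappa> * \<Phi> \<kappa> \<mu>))"

end

theory Submission
  imports Defs
begin

text \<open>
  Extend \<open>R\<^sub>\<lambda>(\<xi>)\<close> to arbitrary \<open>\<lambda> \<in> \<int>\<^sup>m\<close> by the same sum of plane waves over the signed permutations of \<open>\<xi>\<close>.
  As a function of \<open>\<lambda>\<close> it is an eigenfunction of the free Laplacian on \<open>\<int>\<^sup>m\<close>, and the coefficients \<open>C\<close> are
  chosen so that it satisfies an exchange relation for neighbouring entries of \<open>\<lambda>\<close> and a reflection
  relation for \<open>\<lambda>\<^sub>m\<close> around \<open>0\<close>. A reflection relation for \<open>\<lambda>\<^sub>1\<close> around \<open>n\<close> holds as well when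
  \<open>\<xi>\<close> solves the Bethe equations, which are the exponentiated critical point equations of the Morse function.
  Eliminating with these relations the neighbours of a partition that leave the box turns the free
  Laplacian into \<open>H\<close>.

  For completeness, any function on \<open>\<int>\<^sup>m\<close> that satisfies the three families of relations is determined by
  its values on the partitions in the box. Hence a linear dependence between the wave functions on the box would be
  a linear dependence on \<open>\<int>\<^sup>m\<close> between the characters attached to the signed permutations of the points
  \<open>\<xi>\<^sub>\<kappa>\<close>. These characters are distinct because the minimizers lie in the open alcove
  \<open>\<pi> > \<xi>\<^sub>1 > \<dots> > \<xi>\<^sub>m > 0\<close> and the critical point equation recovers \<open>\<kappa>\<close> from \<open>\<xi>\<^sub>\<kappa>\<close>. Since conjugation makes the
  two boxes equinumerous, linear independence gives a basis.
\<close>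

section \<open>The phase functions\<close>

text \<open>The values \<open>E \<kappa>\<close> need not be distinct as far as the argument knows,
  so independence of the wave functions cannot be read off from their eigenvalues; it is read off
  from the points \<open>xi \<kappa>\<close> instead. This makes the relations serve two purposes of
  different strength. A neighbour of a partition in the box misbehaves by one step only, so for
  \<open>H\<close> the innermost cases suffice: equal values in the exchange relation and
  \<open>s = 0\<close> at the walls. The extension to all integer vectors has to straighten points
  arbitrarily far away and needs every \<open>a\<close>, \<open>b\<close> and \<open>s\<close>.
  Hence each relation pairs two mirror images: this makes the plane wave part of a summand even
  under an involution of the orbit, while the coefficient part is odd, and the sum cancels in pairs.
  The coefficients \<open>C\<close> contain only the parameters with index plus. Those with index
  minus enter through the wall at \<open>n\<close>, where the four boundary phases of the Bethe
  equation carry one pair of parameters into the other. The open alcove matters three times: its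
  points are generic, signed permutations act on them freely, and no \<open>C\<close> vanishes on
  their orbits.\<close>

lemma sint_has_real_derivative:
  fixes f :: "real \<Rightarrow> real"
  assumes "continuous_on UNIV f"
  shows "((\<lambda>z. sint 0 z f) has_real_derivative f z) (at z)"
proof -
  \<comment> \<open>With base point \<open>- N\<close>, strictly left of both \<open>0\<close> and
    \<open>z\<close>, the sign distinction in \<open>sint\<close> becomes a mere additive constant
    near \<open>z\<close>.\<close>
  define N where "N = \<bar>z\<bar> + 1"
  have int: "f integrable_on {a..b}" for a b
    using assms continuous_on_subset integrable_continuous_real by blast
  have eq: "sint 0 t f = integral {-N..t} f - integral {-N..0} f" if "t \<in> {-N<..<N}" for t
  proof (cases "0 \<le> t")
    case True
    have "integral {-N..0} f + integral {0..t} f = integral {-N..t} f"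
      by (rule Henstock_Kurzweil_Integration.integral_combine) (use True int in \<open>auto simp: N_def\<close>)
    then show ?thesis using True by (simp add: sint_def)
  next
    case False
    have "integral {-N..t} f + integral {t..0} f = integral {-N..0} f"
      by (rule Henstock_Kurzweil_Integration.integral_combine) (use False that int in auto)
    then show ?thesis using False by (simp add: sint_def)
  qed
  have "((\<lambda>t. integral {-N..t} f) has_real_derivative f z) (at z within {-N..N})"
    by (rule integral_has_real_derivative) (use assms continuous_on_subset in \<open>auto simp: N_def\<close>)
  then have "((\<lambda>t. integral {-N..t} f) has_real_derivative f z) (at z)"
    by (simp add: N_def at_within_Icc_at abs_if split: if_splits)
  then have "((\<lambda>t. integral {-N..t} f - integral {-N..0} f) has_real_derivative f z) (at z)"
    by (auto intro!: derivative_eq_intros)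
  then show ?thesis
    by (rule has_field_derivative_transform_within_open[of _ _ _ "{-N<..<N}"])
       (auto simp: eq, auto simp: N_def)
qed

lemma real_deriv_eq_imp_eq:
  fixes f g :: "real \<Rightarrow> real"
  assumes "\<And>z. (f has_real_derivative h z) (at z)" "\<And>z. (g has_real_derivative h z) (at z)"
    and "f 0 = g 0"
  shows "f z = g z"
proof -
  have "((\<lambda>z. f z - g z) has_real_derivative 0) (at x)" for x
    using DERIV_diff[OF assms(1,2)] by simp
  then have "f z - g z = f 0 - g 0"
    by (intro DERIV_isconst_all) auto
  with assms(3) show ?thesis by simp
qed

lemma sint_0 [simp]: "sint 0 0 f = 0"
  by (simp add: sint_def)

lemma one_minus_cos_pos:
  fixes a :: real assumes "\<bar>a\<bar> < 1" shows "1 - a * cos z > 0"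
proof -
  have "\<bar>a * cos z\<bar> \<le> \<bar>a\<bar> * 1" unfolding abs_mult
    by (intro mult_left_mono) auto
  with assms show ?thesis by linarith
qed

text \<open>The denominator of the Poisson kernel is the squared modulus of
  \<open>1 - a * cis x\<close>, split here into real and imaginary part.\<close>

lemma poisson_denom_pos:
  fixes a :: real assumes "\<bar>a\<bar> < 1" shows "1 - 2 * a * cos x + a\<^sup>2 > 0"
proof -
  have "1 - 2 * a * cos x + a\<^sup>2 = (1 - a * cos x)\<^sup>2 + (a * sin x)\<^sup>2"
    using sin_cos_squared_add[of x] by algebra
  moreover have "(1 - a * cos x)\<^sup>2 > 0" using one_minus_cos_pos[OF assms, of x] by simp
  ultimately show ?thesis by (simp add: add_pos_nonneg)
qed

lemma continuous_on_poisson: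
  fixes a :: real assumes "\<bar>a\<bar> < 1"
  shows "continuous_on UNIV (\<lambda>x. (1 - a\<^sup>2) / (1 - 2 * a * cos x + a\<^sup>2))"
  using poisson_denom_pos[OF assms] by (intro continuous_intros) (auto simp: less_le)

lemma vfun_has_real_derivative:
  assumes "\<bar>a\<bar> < 1"
  shows "(vfun a has_real_derivative (1 - a\<^sup>2) / (1 - 2 * a * cos z + a\<^sup>2)) (at z)"
  unfolding vfun_def using sint_has_real_derivative[OF continuous_on_poisson[OF assms]] by simp

text \<open>The correction to \<open>z\<close> is \<open>-2\<close> times the argument of
  \<open>1 - a * cis z\<close>. That number has positive real part, so a single branch of
  \<open>arctan\<close> is valid for all \<open>z\<close>; oddness, quasi-periodicity and the value
  at \<open>pi\<close> follow at once.\<close>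

lemma vfun_arctan:
  assumes "\<bar>a\<bar> < 1"
  shows "vfun a z = z + 2 * arctan (a * sin z / (1 - a * cos z))"
proof (rule real_deriv_eq_imp_eq[where f = "vfun a"])
  show "(vfun a has_real_derivative (1 - a\<^sup>2) / (1 - 2 * a * cos z + a\<^sup>2)) (at z)" for z
    by (rule vfun_has_real_derivative[OF assms])
  show "((\<lambda>z. z + 2 * arctan (a * sin z / (1 - a * cos z)))
      has_real_derivative (1 - a\<^sup>2) / (1 - 2 * a * cos z + a\<^sup>2)) (at z)" for z
  proof -
    let ?d = "1 - a * cos z"
    have d: "?d > 0" by (rule one_minus_cos_pos[OF assms])
    have p: "1 - 2 * a * cos z + a\<^sup>2 > 0" by (rule poisson_denom_pos[OF assms])
    have e1: "a * cos z * ?d - a * sin z * (a * sin z) = a * cos z - a\<^sup>2"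
      using sin_cos_squared_add[of z] by algebra
    have e2: "?d\<^sup>2 + (a * sin z)\<^sup>2 = 1 - 2 * a * cos z + a\<^sup>2"
      using sin_cos_squared_add[of z] by algebra
    have "1 + (a * sin z / ?d)\<^sup>2 = (1 - 2 * a * cos z + a\<^sup>2) / ?d\<^sup>2"
      using d by (simp add: e2[symmetric] power_divide add_divide_distrib)
    then have i: "inverse (1 + (a * sin z / ?d)\<^sup>2) = ?d\<^sup>2 / (1 - 2 * a * cos z + a\<^sup>2)" by simp
    have "((\<lambda>z. z + 2 * arctan (a * sin z / (1 - a * cos z))) has_real_derivative
       (1 + 2 * (inverse (1 + (a * sin z / ?d)\<^sup>2) *
         ((a * cos z * ?d - a * sin z * (a * sin z)) / (?d * ?d))))) (at z)"
      using d by (auto intro!: derivative_eq_intros simp: field_simps power2_eq_square)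
    moreover have "1 + 2 * (inverse (1 + (a * sin z / ?d)\<^sup>2) *
         ((a * cos z * ?d - a * sin z * (a * sin z)) / (?d * ?d)))
      = 1 + 2 * (a * cos z - a\<^sup>2) / (1 - 2 * a * cos z + a\<^sup>2)"
      unfolding i e1 using d by (simp add: power2_eq_square)
    moreover have "\<dots> = (1 - a\<^sup>2) / (1 - 2 * a * cos z + a\<^sup>2)"
      using p by (simp add: field_simps)
    ultimately show ?thesis by simp
  qed
qed (simp add: vfun_def)

lemma vfun_minus: "\<bar>a\<bar> < 1 \<Longrightarrow> vfun a (- z) = - vfun a z"
  by (simp add: vfun_arctan arctan_minus)

lemma vfun_0: "vfun a 0 = 0"
  by (simp add: vfun_def)

lemma vfun_add_2pi: "\<bar>a\<bar> < 1 \<Longrightarrow> vfun a (z + 2 * pi) = vfun a z + 2 * pi"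
  by (simp add: vfun_arctan)

lemma vfun_pi: "\<bar>a\<bar> < 1 \<Longrightarrow> vfun a pi = pi"
  by (simp add: vfun_arctan)

lemma vfun_mono:
  assumes "\<bar>a\<bar> < 1" "x \<le> y"
  shows "vfun a x \<le> vfun a y"
proof (rule DERIV_nonneg_imp_nondecreasing[OF assms(2)])
  fix t
  have "a\<^sup>2 < 1" using assms(1) by (simp add: abs_square_less_1)
  then have "(1 - a\<^sup>2) / (1 - 2 * a * cos t + a\<^sup>2) \<ge> 0"
    using poisson_denom_pos[OF assms(1), of t] by simp
  then show "\<exists>y. (vfun a has_real_derivative y) (at t) \<and> 0 \<le> y"
    using vfun_has_real_derivative[OF assms(1)] by blast
qed

lemma continuous_on_vfun: "\<bar>a\<bar> < 1 \<Longrightarrow> continuous_on A (vfun a)"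
  using vfun_has_real_derivative DERIV_isCont continuous_at_imp_continuous_on by blast

text \<open>The Cayley transform of \<open>t\<close>, with the denominator multiplied out.\<close>

lemma cis_double_arctan: "cis (2 * arctan t) * (1 - \<i> * of_real t) = 1 + \<i> * of_real t"
proof -
  define s where "s = sqrt (1 + t\<^sup>2)"
  have s: "s > 0" "s * s = 1 + t * t"
    using sum_power2_gt_zero_iff[of 1 t] by (auto simp: s_def power2_eq_square)
  have c: "cos (arctan t) = 1 / s" "sin (arctan t) = t / s"
    by (simp_all add: cos_arctan sin_arctan s_def)
  have "cos (2 * arctan t) = (1 - t * t) / (1 + t * t)"
    using s(1) by (simp add: cos_double c power2_eq_square s(2)[symmetric] diff_divide_distrib)
  moreover have "sin (2 * arctan t) = 2 * t / (1 + t * t)"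
    by (simp add: sin_double c s(2)[symmetric])
  moreover have "1 + t * t \<noteq> 0" using s by (metis mult_eq_0_iff less_irrefl)
  ultimately show ?thesis
    by (simp add: complex_eq_iff divide_simps) algebra
qed

text \<open>\<open>vfun a\<close> is a continuous phase of the Blaschke factor
  \<open>(u - a) / (1 - a * u)\<close> at \<open>u = cis z\<close>. This is the bridge from the
  integrals in the Morse function to the rational factors in \<open>C\<close>.\<close>

lemma cis_vfun:
  assumes "\<bar>a\<bar> < 1"
  shows "cis (vfun a z) * (1 - of_real a * cis z) = cis z - of_real a"
proof -
  define d where "d = 1 - a * cos z"
  define t where "t = a * sin z / d"
  have d: "d > 0" unfolding d_def by (rule one_minus_cos_pos[OF assms])
  have v: "vfun a z = z + 2 * arctan t" by (simp add: vfun_arctan[OF assms] t_def d_def)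
  have dt: "d * t = a * sin z" using d by (simp add: t_def)
  have 1: "of_real d * (1 + \<i> * of_real t) = 1 - of_real a * cis (- z)"
    using dt by (simp add: complex_eq_iff d_def)
  have 2: "of_real d * (1 - \<i> * of_real t) = 1 - of_real a * cis z"
    using dt by (simp add: complex_eq_iff d_def)
  have "cis (vfun a z) * (1 - of_real a * cis z)
      = cis z * (of_real d * (cis (2 * arctan t) * (1 - \<i> * of_real t)))"
    unfolding 2[symmetric] v by (simp add: cis_mult[symmetric] mult_ac)
  also have "\<dots> = cis z * (1 - of_real a * cis (- z))"
    unfolding cis_double_arctan 1 ..
  also have "\<dots> = cis z - of_real a" by (simp add: algebra_simps cis_mult)
  finally show ?thesis .
qed

section \<open>Critical points of the Morse function\<close>

lemma sint_nonneg:
  assumes c: "continuous_on UNIV f" and "mono f" "f 0 = 0"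
  shows "0 \<le> sint 0 z f"
proof (cases "0 \<le> z")
  case True
  have "sint 0 0 f \<le> sint 0 z f"
    using True assms sint_has_real_derivative[OF c] monoD[OF \<open>mono f\<close>, of 0]
    by (intro DERIV_nonneg_imp_nondecreasing[OF True]) (metis)
  then show ?thesis by simp
next
  case False
  then have z: "z \<le> 0" by simp
  have "sint 0 0 f \<le> sint 0 z f"
    using assms sint_has_real_derivative[OF c] monoD[OF \<open>mono f\<close>, of _ 0]
    by (intro DERIV_nonpos_imp_nonincreasing[OF z]) (metis)
  then show ?thesis by simp
qed

lemma sint_midpoint:
  assumes c: "continuous_on UNIV f" and "mono f"
  shows "sint 0 ((a + b) / 2) f \<le> (sint 0 a f + sint 0 b f) / 2"
proof -
  have "convex_on UNIV (\<lambda>z. sint 0 z f)"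
    by (rule convex_on_realI[where f' = f])
       (use sint_has_real_derivative[OF c] monoD[OF \<open>mono f\<close>] in auto)
  from convex_onD[OF this, of "1/2" a b] show ?thesis
    by (simp add: add_divide_distrib)
qed

lemma sint_chain:
  assumes "continuous_on UNIV f" "(g has_real_derivative D) (at x)"
  shows "((\<lambda>t. sint 0 (g t) f) has_real_derivative f (g x) * D) (at x)"
  by (rule DERIV_chain2[OF sint_has_real_derivative[OF assms(1)] assms(2)])

lemma continuous_on_sint:
  assumes "continuous_on UNIV f"
  shows "continuous_on A (\<lambda>z. sint 0 z f)"
  using sint_has_real_derivative[OF assms] DERIV_isCont continuous_at_imp_continuous_on by blast

lemma continuous_on_sint_compose:
  assumes "continuous_on UNIV f" "continuous_on A g"
  shows "continuous_on A (\<lambda>x. sint 0 (g x) f)"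
  by (rule continuous_on_compose2[OF continuous_on_sint[OF assms(1), of UNIV] assms(2)]) auto

text \<open>Points are functions on all of \<open>nat\<close> with the product topology, so this is
  Tychonoff's theorem, with the factor \<open>{0}\<close> at the indices from \<open>m\<close>
  on.\<close>

lemma compact_Rm_box:
  "compact {\<xi> \<in> Rm m. \<forall>j<m. \<bar>\<xi> j\<bar> \<le> B}"
proof -
  have "{\<xi> \<in> Rm m. \<forall>j<m. \<bar>\<xi> j\<bar> \<le> B} = (\<Pi>\<^sub>E j\<in>UNIV. if j < m then {-B..B} else {0})"
  proof (rule set_eqI)
    fix \<xi> :: "nat \<Rightarrow> real"
    have "\<xi> j \<in> (if j < m then {-B..B} else {0}) \<longleftrightarrow> (if j < m then \<bar>\<xi> j\<bar> \<le> B else \<xi> j = 0)" for j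
      by (auto simp: abs_le_iff)
    then show "\<xi> \<in> {\<xi> \<in> Rm m. \<forall>j<m. \<bar>\<xi> j\<bar> \<le> B} \<longleftrightarrow> \<xi> \<in> (\<Pi>\<^sub>E j\<in>UNIV. if j < m then {-B..B} else {0})"
      unfolding PiE_UNIV_domain Pi_iff Rm_def by (auto simp: not_less)
  qed
  moreover have "compactin (product_topology (\<lambda>_::nat. euclidean) UNIV)
      (\<Pi>\<^sub>E j\<in>UNIV. if j < m then {-B..B::real} else {0})"
    unfolding compactin_PiE by auto
  ultimately show ?thesis
    by (simp add: euclidean_product_topology)
qed

locale qboson =
  fixes q pp qp pm qm :: real and n m :: nat
  assumes n: "1 \<le> n" and q: "\<bar>q\<bar> < 1" and pp: "\<bar>pp\<bar> < 1" and qp: "\<bar>qp\<bar> < 1"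
    and pm: "\<bar>pm\<bar> < 1" and qm: "\<bar>qm\<bar> < 1"
begin

definition vb :: "real \<Rightarrow> real" where
  "vb x = vfun pp x + vfun qp x + vfun pm x + vfun qm x"

text \<open>The gradient of the part of \<open>V\<close> that is free of \<open>\<kappa>\<close>;
  the equations \<open>theta \<xi> j = target \<kappa> j\<close> are the Bethe equations in
  logarithmic form. It is defined for every point because it is also evaluated on signed
  permutations of the minimizers.\<close>

definition theta :: "(nat \<Rightarrow> real) \<Rightarrow> nat \<Rightarrow> real" where
  "theta \<xi> j = 2 * real n * \<xi> j
     + (\<Sum>k\<in>{..<m} - {j}. vfun q (\<xi> j + \<xi> k) + vfun q (\<xi> j - \<xi> k)) + vb (\<xi> j)"

definition target :: "int list \<Rightarrow> nat \<Rightarrow> real" where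
  "target \<kappa> j = 2 * pi * (real (m - j) + of_int (\<kappa> ! j))"

abbreviation V :: "int list \<Rightarrow> (nat \<Rightarrow> real) \<Rightarrow> real" where
  "V \<equiv> Vmorse q pp qp pm qm n m"

lemma continuous_vq: "continuous_on UNIV (vfun q)" and mono_vq: "mono (vfun q)"
  by (simp_all add: continuous_on_vfun q vfun_mono monoI)

lemma continuous_vb: "continuous_on UNIV vb" and mono_vb: "mono vb"
  unfolding vb_def
  by (auto intro!: continuous_intros continuous_on_vfun monoI add_mono vfun_mono pp qp pm qm)

lemma vb_minus: "vb (- x) = - vb x"
  by (simp add: vb_def vfun_minus pp qp pm qm)

lemma vb_0: "vb 0 = 0"
  by (simp add: vb_def vfun_0)

lemma vb_pi: "vb pi = 4 * pi"
  by (simp add: vb_def vfun_pi pp qp pm qm)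

lemma V_eq: "V \<kappa> \<xi> =
     (\<Sum>j<m. \<Sum>k\<in>{j<..<m}. sint 0 (\<xi> j + \<xi> k) (vfun q) + sint 0 (\<xi> j - \<xi> k) (vfun q))
   + (\<Sum>j<m. real n * (\<xi> j)\<^sup>2 - target \<kappa> j * \<xi> j + sint 0 (\<xi> j) vb)"
  by (simp add: Vmorse_def target_def vb_def[abs_def])

lemma V_zero: "V \<kappa> (\<lambda>_. 0) = 0"
  by (simp add: V_eq)

lemma continuous_on_V: "continuous_on A (V \<kappa>)"
proof -
  have c: "continuous_on A (\<lambda>x::nat \<Rightarrow> real. x j)" for j
    by (rule continuous_on_subset[OF continuous_on_product_coordinates[of j]]) simp
  have W1: "continuous_on A (\<lambda>x::nat \<Rightarrow> real. sint 0 (x j + x k) (vfun q))" for j k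
    by (rule continuous_on_sint_compose[OF continuous_vq continuous_on_add[OF c c]])
  have W2: "continuous_on A (\<lambda>x::nat \<Rightarrow> real. sint 0 (x j - x k) (vfun q))" for j k
    by (rule continuous_on_sint_compose[OF continuous_vq continuous_on_diff[OF c c]])
  have W3: "continuous_on A (\<lambda>x::nat \<Rightarrow> real. sint 0 (x j) vb)" for j
    by (rule continuous_on_sint_compose[OF continuous_vb c])
  have W4: "continuous_on A (\<lambda>x::nat \<Rightarrow> real. real n * (x j)\<^sup>2)" for j
    by (rule continuous_on_mult[OF continuous_on_const continuous_on_power[OF c]])
  have W5: "continuous_on A (\<lambda>x::nat \<Rightarrow> real. target \<kappa> j * x j)" for j
    by (rule continuous_on_mult[OF continuous_on_const c])
  have P: "continuous_on A (\<lambda>x::nat \<Rightarrow> real. \<Sum>j<m. \<Sum>k\<in>{j<..<m}.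
      sint 0 (x j + x k) (vfun q) + sint 0 (x j - x k) (vfun q))"
    by (rule continuous_on_sum, rule continuous_on_sum, rule continuous_on_add[OF W1 W2])
  have Q: "continuous_on A (\<lambda>x::nat \<Rightarrow> real. \<Sum>j<m. real n * (x j)\<^sup>2 - target \<kappa> j * x j + sint 0 (x j) vb)"
    by (rule continuous_on_sum, rule continuous_on_add[OF continuous_on_diff[OF W4 W5] W3])
  show ?thesis
    unfolding V_eq[abs_def] by (rule continuous_on_add[OF P Q])
qed

section \<open>Coercivity, existence and uniqueness of the minimizer\<close>

lemma V_lower: "V \<kappa> \<xi> \<ge> (\<Sum>j<m. (\<xi> j)\<^sup>2 - \<bar>target \<kappa> j\<bar> * \<bar>\<xi> j\<bar>)"
proof -
  have t: "(\<xi> j)\<^sup>2 - \<bar>target \<kappa> j\<bar> * \<bar>\<xi> j\<bar> \<le> real n * (\<xi> j)\<^sup>2 - target \<kappa> j * \<xi> j + sint 0 (\<xi> j) vb" for j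
  proof -
    have "1 * (\<xi> j)\<^sup>2 \<le> real n * (\<xi> j)\<^sup>2" by (rule mult_right_mono) (use n in auto)
    moreover have "target \<kappa> j * \<xi> j \<le> \<bar>target \<kappa> j\<bar> * \<bar>\<xi> j\<bar>" by (metis abs_ge_self abs_mult)
    moreover have "0 \<le> sint 0 (\<xi> j) vb" by (rule sint_nonneg[OF continuous_vb mono_vb vb_0])
    ultimately show ?thesis by linarith
  qed
  moreover have "0 \<le> (\<Sum>j<m. \<Sum>k\<in>{j<..<m}. sint 0 (\<xi> j + \<xi> k) (vfun q) + sint 0 (\<xi> j - \<xi> k) (vfun q))"
    by (intro sum_nonneg add_nonneg_nonneg sint_nonneg[OF continuous_vq mono_vq vfun_0])
  moreover have "(\<Sum>j<m. (\<xi> j)\<^sup>2 - \<bar>target \<kappa> j\<bar> * \<bar>\<xi> j\<bar>)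
      \<le> (\<Sum>j<m. real n * (\<xi> j)\<^sup>2 - target \<kappa> j * \<xi> j + sint 0 (\<xi> j) vb)"
    by (rule sum_mono, rule t)
  ultimately show ?thesis
    unfolding V_eq by linarith
qed

lemma V_pos_outside_box:
  obtains B where "B \<ge> 0" "\<And>\<xi> j. j < m \<Longrightarrow> B < \<bar>\<xi> j\<bar> \<Longrightarrow> V \<kappa> \<xi> > 0"
proof -
  define c where "c = (\<lambda>j. \<bar>target \<kappa> j\<bar>)"
  define S where "S = (\<Sum>j<m. (c j)\<^sup>2)"
  \<comment> \<open>Completing the square shows that the coordinates other than \<open>i\<close>
    contribute at least \<open>- S\<close> to the lower bound, and \<open>B\<close> is so large that
    a coordinate beyond it contributes more than \<open>S\<close>. Since \<open>V\<close> vanishes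
    at the origin, a minimizer over the box is a global one.\<close>
  define B where "B = (\<Sum>j<m. c j) + S + 1"
  have c0: "c j \<ge> 0" for j by (simp add: c_def)
  have S0: "S \<ge> 0" by (simp add: S_def sum_nonneg)
  show ?thesis
  proof
    show "B \<ge> 0" using S0 c0 by (simp add: B_def sum_nonneg)
    fix \<xi> :: "nat \<Rightarrow> real" and i assume i: "i < m" "B < \<bar>\<xi> i\<bar>"
    let ?f = "\<lambda>j. (\<xi> j)\<^sup>2 - c j * \<bar>\<xi> j\<bar>"
    have lo: "?f j \<ge> - (c j)\<^sup>2" for j
    proof -
      have "(c j)\<^sup>2 + (\<xi> j)\<^sup>2 - c j * \<bar>\<xi> j\<bar> = (c j - \<bar>\<xi> j\<bar>/2)\<^sup>2 + 3/4 * \<bar>\<xi> j\<bar>\<^sup>2"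
        by (simp add: power2_eq_square field_simps)
      also have "\<dots> \<ge> 0" by simp
      finally show ?thesis by simp
    qed
    have "c i \<le> (\<Sum>j<m. c j)" by (rule member_le_sum) (use i c0 in auto)
    then have "\<bar>\<xi> i\<bar> - c i > S + 1" "\<bar>\<xi> i\<bar> > 1" using i S0 c0[of i] by (auto simp: B_def)
    then have "\<bar>\<xi> i\<bar> * (\<bar>\<xi> i\<bar> - c i) > 1 * (S + 1)"
      by (intro mult_strict_mono) (use S0 in auto)
    then have fi: "?f i > S" using S0 by (simp add: algebra_simps power2_eq_square)
    have "(\<Sum>j<m. ?f j) = ?f i + (\<Sum>j\<in>{..<m} - {i}. ?f j)"
      using i by (simp add: sum.remove)
    moreover have "(\<Sum>j\<in>{..<m} - {i}. ?f j) \<ge> (\<Sum>j\<in>{..<m} - {i}. - (c j)\<^sup>2)"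
      by (intro sum_mono lo)
    moreover have "(\<Sum>j\<in>{..<m} - {i}. (c j)\<^sup>2) \<le> S"
      unfolding S_def by (rule sum_mono2) auto
    ultimately have "(\<Sum>j<m. ?f j) > 0" using fi by (simp add: sum_negf)
    then show "V \<kappa> \<xi> > 0" using V_lower[where \<kappa>=\<kappa> and \<xi>=\<xi>] by (simp add: c_def)
  qed
qed

definition is_min :: "int list \<Rightarrow> (nat \<Rightarrow> real) \<Rightarrow> bool" where
  "is_min \<kappa> \<xi> \<longleftrightarrow> \<xi> \<in> Rm m \<and> (\<forall>\<eta>\<in>Rm m. V \<kappa> \<xi> \<le> V \<kappa> \<eta>)"

lemma is_min_exists: "\<exists>\<xi>. is_min \<kappa> \<xi>"
proof -
  obtain B where B: "B \<ge> 0" "\<And>\<xi> j. j < m \<Longrightarrow> B < \<bar>\<xi> j\<bar> \<Longrightarrow> V \<kappa> \<xi> > 0"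
    using V_pos_outside_box by blast
  let ?K = "{\<xi> \<in> Rm m. \<forall>j<m. \<bar>\<xi> j\<bar> \<le> B}"
  have 0: "(\<lambda>_. 0) \<in> ?K" using B by (simp add: Rm_def)
  then have "?K \<noteq> {}" by (metis empty_iff)
  from continuous_attains_inf[OF compact_Rm_box this continuous_on_V[of _ \<kappa>]]
  obtain \<xi> where \<xi>: "\<xi> \<in> ?K" "\<And>\<eta>. \<eta> \<in> ?K \<Longrightarrow> V \<kappa> \<xi> \<le> V \<kappa> \<eta>"
    by (elim bexE) (rule that, assumption, erule bspec)
  have "V \<kappa> \<xi> \<le> V \<kappa> \<eta>" if "\<eta> \<in> Rm m" for \<eta>
  proof (cases "\<eta> \<in> ?K")
    case False
    then obtain j where "j < m" "B < \<bar>\<eta> j\<bar>" using \<open>\<eta> \<in> Rm m\<close> by (auto simp: not_le)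
    then have "V \<kappa> \<eta> > 0" by (rule B(2))
    moreover have "V \<kappa> \<xi> \<le> 0" using \<xi>(2)[OF 0] by (simp add: V_zero)
    ultimately show ?thesis by linarith
  qed (use \<xi> in auto)
  then show ?thesis using \<xi> by (auto simp: is_min_def)
qed

text \<open>Strong convexity, tested at midpoints only. The gap comes from the term
  \<open>real n * (\<xi> j)\<^sup>2\<close> with \<open>1 \<le> n\<close>; the integral terms are
  convex and the remaining ones linear. For two minimizers the gap has to be zero.\<close>

lemma V_midpoint:
  "V \<kappa> (\<lambda>j. (\<xi> j + \<eta> j) / 2) + (\<Sum>j<m. (\<xi> j - \<eta> j)\<^sup>2) / 4 \<le> (V \<kappa> \<xi> + V \<kappa> \<eta>) / 2"
proof -
  let ?z = "\<lambda>j. (\<xi> j + \<eta> j) / 2"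
  let ?P = "\<lambda>\<xi> j k. sint 0 (\<xi> j + \<xi> k) (vfun q) + sint 0 (\<xi> j - \<xi> k) (vfun q)"
  let ?Q = "\<lambda>\<xi> j. real n * (\<xi> j)\<^sup>2 - target \<kappa> j * \<xi> j + sint 0 (\<xi> j) vb"
  have z: "?z j + ?z k = ((\<xi> j + \<xi> k) + (\<eta> j + \<eta> k)) / 2"
      "?z j - ?z k = ((\<xi> j - \<xi> k) + (\<eta> j - \<eta> k)) / 2" for j k
    by (simp_all add: field_simps)
  have P: "?P ?z j k \<le> (?P \<xi> j k + ?P \<eta> j k) / 2" for j k
    using sint_midpoint[OF continuous_vq mono_vq, of "\<xi> j + \<xi> k" "\<eta> j + \<eta> k"]
      sint_midpoint[OF continuous_vq mono_vq, of "\<xi> j - \<xi> k" "\<eta> j - \<eta> k"]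
    unfolding z by argo
  have Q: "?Q ?z j + (\<xi> j - \<eta> j)\<^sup>2 / 4 \<le> (?Q \<xi> j + ?Q \<eta> j) / 2" for j
  proof -
    have "1 * (\<xi> j - \<eta> j)\<^sup>2 \<le> real n * (\<xi> j - \<eta> j)\<^sup>2"
      by (rule mult_right_mono) (use n in auto)
    moreover have "real n * (?z j)\<^sup>2 = (real n * (\<xi> j)\<^sup>2 + real n * (\<eta> j)\<^sup>2) / 2 - real n * (\<xi> j - \<eta> j)\<^sup>2 / 4"
      by (simp add: power2_eq_square field_simps)
    moreover have "target \<kappa> j * ?z j = (target \<kappa> j * \<xi> j + target \<kappa> j * \<eta> j) / 2"
      by (simp add: field_simps)
    ultimately show ?thesis
      using sint_midpoint[OF continuous_vb mono_vb, of "\<xi> j" "\<eta> j"] by argo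
  qed
  have "V \<kappa> ?z + (\<Sum>j<m. (\<xi> j - \<eta> j)\<^sup>2) / 4
      = (\<Sum>j<m. \<Sum>k\<in>{j<..<m}. ?P ?z j k) + (\<Sum>j<m. ?Q ?z j + (\<xi> j - \<eta> j)\<^sup>2 / 4)"
    unfolding V_eq by (simp add: sum.distrib sum_divide_distrib)
  also have "\<dots> \<le> (\<Sum>j<m. \<Sum>k\<in>{j<..<m}. (?P \<xi> j k + ?P \<eta> j k) / 2) + (\<Sum>j<m. (?Q \<xi> j + ?Q \<eta> j) / 2)"
    by (intro add_mono sum_mono P Q)
  also have "\<dots> = ((\<Sum>j<m. \<Sum>k\<in>{j<..<m}. ?P \<xi> j k) + (\<Sum>j<m. \<Sum>k\<in>{j<..<m}. ?P \<eta> j k)) / 2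
       + ((\<Sum>j<m. ?Q \<xi> j) + (\<Sum>j<m. ?Q \<eta> j)) / 2"
    by (simp only: sum_divide_distrib[symmetric] sum.distrib)
  also have "\<dots> = (V \<kappa> \<xi> + V \<kappa> \<eta>) / 2"
    unfolding V_eq by argo
  finally show ?thesis .
qed

lemma is_min_unique:
  assumes "is_min \<kappa> \<xi>" "is_min \<kappa> \<eta>"
  shows "\<xi> = \<eta>"
proof -
  have R: "\<xi> \<in> Rm m" "\<eta> \<in> Rm m" using assms by (auto simp: is_min_def)
  then have "(\<lambda>j. (\<xi> j + \<eta> j) / 2) \<in> Rm m" by (simp add: Rm_def)
  then have "V \<kappa> \<xi> \<le> V \<kappa> (\<lambda>j. (\<xi> j + \<eta> j) / 2)" "V \<kappa> \<eta> \<le> V \<kappa> (\<lambda>j. (\<xi> j + \<eta> j) / 2)"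
    using assms by (auto simp: is_min_def)
  with V_midpoint[of \<kappa> \<xi> \<eta>] have "(\<Sum>j<m. (\<xi> j - \<eta> j)\<^sup>2) \<le> 0" by argo
  then have "(\<Sum>j<m. (\<xi> j - \<eta> j)\<^sup>2) = 0" by (intro antisym sum_nonneg) auto
  then have "\<forall>j<m. \<xi> j = \<eta> j" by (simp add: sum_nonneg_eq_0_iff)
  moreover have "\<xi> j = \<eta> j" if "j \<ge> m" for j using R that by (simp add: Rm_def)
  ultimately show ?thesis by (meson ext not_le)
qed

section \<open>Critical point equations and location of the minimizer in the alcove\<close>

abbreviation xi :: "int list \<Rightarrow> nat \<Rightarrow> real" where
  "xi \<equiv> xi_min q pp qp pm qm n m"

lemma is_min_xi: "is_min \<kappa> (xi \<kappa>)"
proof -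
  have "\<exists>!\<xi>. is_min \<kappa> \<xi>" using is_min_exists is_min_unique by blast
  from theI'[OF this] show ?thesis by (simp add: is_min_def xi_min_def)
qed

text \<open>A global minimizer is in particular minimal along each coordinate line, so calculus in
  one variable suffices.\<close>

lemma theta_xi:
  assumes i: "i < m"
  shows "theta (xi \<kappa>) i = target \<kappa> i"
proof -
  define \<xi> where "\<xi> = xi \<kappa>"
  define g where "g = (\<lambda>t. V \<kappa> (\<xi>(i := t)))"
  define h where "h = (\<lambda>k. vfun q (\<xi> i + \<xi> k) + vfun q (\<xi> i - \<xi> k))"
  let ?W = "\<lambda>z. sint 0 z (vfun q)"
  note dW = sint_chain[OF continuous_vq]
  note dU = sint_chain[OF continuous_vb]
  have odd: "vfun q (x - y) = - vfun q (y - x)" for x y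
    using vfun_minus[OF q, of "y - x"] by simp
  have D1: "((\<lambda>t. ?W ((\<xi>(i := t)) j + (\<xi>(i := t)) k) + ?W ((\<xi>(i := t)) j - (\<xi>(i := t)) k))
     has_real_derivative ((if j = i then h k else 0) + (if k = i then h j else 0))) (at (\<xi> i))"
    if jk: "j < k" for j k
  proof -
    consider "j = i" "k \<noteq> i" | "k = i" "j \<noteq> i" | "j \<noteq> i" "k \<noteq> i" using jk by auto
    then show ?thesis
    proof cases
      case 1
      have "((\<lambda>t. ?W (t + \<xi> k) + ?W (t - \<xi> k)) has_real_derivative
          (vfun q (\<xi> i + \<xi> k) * 1 + vfun q (\<xi> i - \<xi> k) * 1)) (at (\<xi> i))"
        by (intro DERIV_add dW) (auto intro!: derivative_eq_intros)
      then show ?thesis using 1 by (simp add: h_def)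
    next
      case 2
      have "((\<lambda>t. ?W (\<xi> j + t) + ?W (\<xi> j - t)) has_real_derivative
          (vfun q (\<xi> j + \<xi> i) * 1 + vfun q (\<xi> j - \<xi> i) * (-1))) (at (\<xi> i))"
        by (intro DERIV_add dW) (auto intro!: derivative_eq_intros)
      then show ?thesis using 2 by (simp add: h_def odd[of "\<xi> j" "\<xi> i"] add.commute)
    next
      case 3
      then show ?thesis by simp
    qed
  qed
  have D2: "((\<lambda>t. real n * ((\<xi>(i := t)) j)\<^sup>2 - target \<kappa> j * (\<xi>(i := t)) j + sint 0 ((\<xi>(i := t)) j) vb)
     has_real_derivative (if j = i then 2 * real n * \<xi> i - target \<kappa> i + vb (\<xi> i) else 0)) (at (\<xi> i))" for j
  proof (cases "j = i")
    case True
    have "((\<lambda>t. (real n * t\<^sup>2 - target \<kappa> i * t) + sint 0 t vb)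
       has_real_derivative ((2 * real n * \<xi> i - target \<kappa> i) + vb (\<xi> i) * 1)) (at (\<xi> i))"
      by (intro DERIV_add dU) (auto intro!: derivative_eq_intros)
    then show ?thesis using True by simp
  qed simp
  \<comment> \<open>\<open>V\<close> sums over pairs \<open>j < k\<close> only, so \<open>i\<close>
    occurs in the first or in the second position. By oddness of \<open>vfun q\<close> both
    positions contribute the same function \<open>h\<close>, and the two index ranges join to all
    \<open>k\<close> other than \<open>i\<close>.\<close>
  have s: "(\<Sum>j<m. \<Sum>k\<in>{j<..<m}. (if j = i then h k else 0) + (if k = i then h j else 0))
      = (\<Sum>k\<in>{..<m} - {i}. h k)"
  proof -
    have "(\<Sum>j<m. \<Sum>k\<in>{j<..<m}. (if j = i then h k else 0)) = (\<Sum>j<m. if j = i then (\<Sum>k\<in>{i<..<m}. h k) else 0)"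
      by (intro sum.cong) auto
    also have "\<dots> = (\<Sum>k\<in>{i<..<m}. h k)" using i by simp
    finally have 1: "(\<Sum>j<m. \<Sum>k\<in>{j<..<m}. (if j = i then h k else 0)) = (\<Sum>k\<in>{i<..<m}. h k)" .
    have "(\<Sum>j<m. \<Sum>k\<in>{j<..<m}. (if k = i then h j else 0)) = (\<Sum>j<m. if j \<in> {..<i} then h j else 0)"
      using i by (intro sum.cong) auto
    also have "\<dots> = (\<Sum>j\<in>{..<m} \<inter> {..<i}. h j)" by (simp add: sum.inter_restrict)
    also have "{..<m} \<inter> {..<i} = {..<i}" using i by auto
    finally have 2: "(\<Sum>j<m. \<Sum>k\<in>{j<..<m}. (if k = i then h j else 0)) = (\<Sum>j<i. h j)" .
    have "{..<m} - {i} = {..<i} \<union> {i<..<m}" using i by auto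
    moreover have "sum h ({..<i} \<union> {i<..<m}) = sum h {..<i} + sum h {i<..<m}"
      by (rule sum.union_disjoint) auto
    ultimately show ?thesis unfolding sum.distrib 1 2 by (metis add.commute)
  qed
  have "(g has_real_derivative
      (\<Sum>j<m. \<Sum>k\<in>{j<..<m}. (if j = i then h k else 0) + (if k = i then h j else 0))
      + (\<Sum>j<m. if j = i then 2 * real n * \<xi> i - target \<kappa> i + vb (\<xi> i) else 0)) (at (\<xi> i))"
    unfolding g_def V_eq by (intro DERIV_add DERIV_sum D1 D2) auto
  then have "(g has_real_derivative theta \<xi> i - target \<kappa> i) (at (\<xi> i))"
    using i by (simp add: s theta_def h_def algebra_simps)
  moreover have "g (\<xi> i) \<le> g y" for y
    using is_min_xi[of \<kappa>] i by (auto simp: is_min_def g_def \<xi>_def Rm_def)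
  ultimately have "theta \<xi> i - target \<kappa> i = 0"
    by (intro DERIV_local_min[of g _ "\<xi> i" 1]) auto
  then show ?thesis by (simp add: \<xi>_def)
qed

lemma target_strict_antimono:
  assumes "\<kappa> \<in> Lam m n" "i < j" "j < m"
  shows "target \<kappa> j < target \<kappa> i"
proof -
  have "\<kappa> ! j \<le> \<kappa> ! i" using assms by (auto simp: Lam_def sorted_wrt_iff_nth_less)
  then have "real_of_int (\<kappa> ! j) \<le> of_int (\<kappa> ! i)" by simp
  with assms show ?thesis by (simp add: target_def of_nat_diff)
qed

lemma target_bounds:
  assumes "\<kappa> \<in> Lam m n" "i < m"
  shows "0 < target \<kappa> i" "target \<kappa> i \<le> 2 * pi * (m + n)"
proof -
  have "0 \<le> \<kappa> ! i" "\<kappa> ! i \<le> int n" using assms by (auto simp: Lam_def)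
  then have "0 \<le> real_of_int (\<kappa> ! i)" "real_of_int (\<kappa> ! i) \<le> n" by linarith+
  with assms show "0 < target \<kappa> i" "target \<kappa> i \<le> 2 * pi * (m + n)"
    by (auto simp: target_def of_nat_diff intro!: add_pos_nonneg)
qed

text \<open>The two sums over \<open>k\<close> omit different indices. After splitting off the
  mutual terms of \<open>i\<close> and \<open>j\<close> the rest has a common index set and compares
  termwise; of the mutual terms, one is symmetric and the other changes sign. Applied by
  contraposition: strictly decreasing targets force strictly decreasing coordinates.\<close>

lemma theta_antimono:
  assumes "\<xi> i \<le> \<xi> j" "i < m" "j < m"
  shows "theta \<xi> i \<le> theta \<xi> j"
proof (cases "i = j")
  case False
  have *: "(\<Sum>k\<in>{..<m} - {a}. vfun q (\<xi> a + \<xi> k) + vfun q (\<xi> a - \<xi> k))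
     = vfun q (\<xi> a + \<xi> b) + vfun q (\<xi> a - \<xi> b) + (\<Sum>k\<in>{..<m} - {i,j}. vfun q (\<xi> a + \<xi> k) + vfun q (\<xi> a - \<xi> k))"
    if "{a, b} = {i, j}" "a \<noteq> b" for a b
  proof -
    have "{..<m} - {a} - {b} = {..<m} - {i,j}" "b \<in> {..<m} - {a}" using that assms by auto
    then show ?thesis by (simp add: sum.remove)
  qed
  have "(\<Sum>k\<in>{..<m} - {i}. vfun q (\<xi> i + \<xi> k) + vfun q (\<xi> i - \<xi> k))
     \<le> (\<Sum>k\<in>{..<m} - {j}. vfun q (\<xi> j + \<xi> k) + vfun q (\<xi> j - \<xi> k))"
    unfolding *[of i j, OF refl False] *[of j i, OF insert_commute False[symmetric]]
  proof (rule add_mono)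
    show "vfun q (\<xi> i + \<xi> j) + vfun q (\<xi> i - \<xi> j) \<le> vfun q (\<xi> j + \<xi> i) + vfun q (\<xi> j - \<xi> i)"
      using vfun_mono[OF q, of "\<xi> i - \<xi> j" "\<xi> j - \<xi> i"] assms(1) by (simp add: add.commute)
    show "(\<Sum>k\<in>{..<m} - {i,j}. vfun q (\<xi> i + \<xi> k) + vfun q (\<xi> i - \<xi> k))
      \<le> (\<Sum>k\<in>{..<m} - {i,j}. vfun q (\<xi> j + \<xi> k) + vfun q (\<xi> j - \<xi> k))"
      by (intro sum_mono add_mono vfun_mono[OF q]) (use assms in auto)
  qed
  moreover have "vb (\<xi> i) \<le> vb (\<xi> j)" by (rule monoD[OF mono_vb assms(1)])
  moreover have "2 * real n * \<xi> i \<le> 2 * real n * \<xi> j" using assms(1) by (intro mult_left_mono) auto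
  ultimately show ?thesis unfolding theta_def by linarith
qed auto

lemma xi_strict_antimono:
  assumes "\<kappa> \<in> Lam m n" "i < j" "j < m"
  shows "xi \<kappa> j < xi \<kappa> i"
proof (rule ccontr)
  assume "\<not> ?thesis"
  then have "theta (xi \<kappa>) i \<le> theta (xi \<kappa>) j" using assms by (intro theta_antimono) auto
  with target_strict_antimono[OF assms] assms show False by (simp add: theta_xi)
qed

text \<open>If \<open>x \<le> 0\<close> then \<open>x - y \<le> - (x + y)\<close> for every
  \<open>y\<close>, so by oddness and monotonicity each pair of phases is nonpositive, whatever the
  sign of the other coordinate. All of \<open>theta\<close> would be nonpositive, against a positive
  target.\<close>

lemma xi_pos:
  assumes "\<kappa> \<in> Lam m n" "i < m"
  shows "0 < xi \<kappa> i"
proof (rule ccontr)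
  let ?x = "xi \<kappa>"
  assume "\<not> ?thesis"
  then have le: "?x i \<le> 0" by simp
  have "vfun q (?x i + ?x k) + vfun q (?x i - ?x k) \<le> 0" for k
  proof -
    have "vfun q (?x i - ?x k) \<le> vfun q (- (?x i + ?x k))"
      by (rule vfun_mono[OF q]) (use le in auto)
    then show ?thesis unfolding vfun_minus[OF q] by linarith
  qed
  then have "(\<Sum>k\<in>{..<m} - {i}. vfun q (?x i + ?x k) + vfun q (?x i - ?x k)) \<le> 0"
    by (intro sum_nonpos)
  moreover have "vb (?x i) \<le> 0" using monoD[OF mono_vb le] vb_0 by simp
  moreover have "2 * real n * ?x i \<le> 0" using le by (simp add: mult_nonneg_nonpos)
  ultimately have "theta ?x i \<le> 0" unfolding theta_def by linarith
  with target_bounds[OF assms] assms show False by (simp add: theta_xi)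
qed

text \<open>The mirror image at \<open>pi\<close> of the argument for positivity. A coordinate of at
  least \<open>pi\<close> would give \<open>2 * pi\<close> for each of the \<open>m - 1\<close>
  pairs, \<open>4 * pi\<close> from the four boundary phases and \<open>2 * pi * n\<close> from the
  linear term, in total \<open>2 * pi * (m + n + 1)\<close>, one period more than any
  target.\<close>

lemma xi_less_pi:
  assumes "\<kappa> \<in> Lam m n" "i < m"
  shows "xi \<kappa> i < pi"
proof (rule ccontr)
  let ?x = "xi \<kappa>"
  assume "\<not> ?thesis"
  then have le: "pi \<le> ?x i" by simp
  have "2 * pi \<le> vfun q (?x i + ?x k) + vfun q (?x i - ?x k)" for k
  proof -
    have "vfun q (- (?x i - ?x k) + 2 * pi) \<le> vfun q (?x i + ?x k)"
      by (rule vfun_mono[OF q]) (use le in auto)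
    then show ?thesis unfolding vfun_add_2pi[OF q] vfun_minus[OF q] by linarith
  qed
  then have "(\<Sum>k\<in>{..<m} - {i}. 2 * pi) \<le> (\<Sum>k\<in>{..<m} - {i}. vfun q (?x i + ?x k) + vfun q (?x i - ?x k))"
    by (intro sum_mono)
  moreover have "(\<Sum>k\<in>{..<m} - {i}. 2 * pi) = 2 * pi * (real m - 1)"
    using assms by (simp add: of_nat_diff)
  moreover have "4 * pi \<le> vb (?x i)" using monoD[OF mono_vb le] vb_pi by simp
  moreover have "2 * real n * pi \<le> 2 * real n * ?x i" using le by (intro mult_left_mono) auto
  ultimately have "2 * pi * (real m - 1) + 4 * pi + 2 * real n * pi \<le> theta ?x i" unfolding theta_def by linarith
  with target_bounds[OF assms] assms have "2 * pi * (real m - 1) + 4 * pi + 2 * real n * pi \<le> 2 * pi * (m + n)"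
    by (simp add: theta_xi)
  moreover have "2 * pi * (m + n) = 2 * pi * (real m - 1) + 2 * pi + 2 * real n * pi"
    by (simp add: algebra_simps)
  ultimately show False using pi_gt_zero by linarith
qed

lemma xi_inj:
  assumes "\<kappa> \<in> Lam m n" "\<kappa>' \<in> Lam m n" "xi \<kappa> = xi \<kappa>'"
  shows "\<kappa> = \<kappa>'"
proof (rule nth_equalityI)
  show "length \<kappa> = length \<kappa>'" using assms by (simp add: Lam_def)
  fix i assume "i < length \<kappa>"
  then have i: "i < m" using assms by (simp add: Lam_def)
  have "target \<kappa> i = target \<kappa>' i" using theta_xi[OF i] assms(3) by metis
  then show "\<kappa> ! i = \<kappa>' ! i" by (simp add: target_def)
qed

lemma xi_Rm: "xi \<kappa> \<in> Rm m"
  using is_min_xi[of \<kappa>] unfolding is_min_def by blast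

end

section \<open>Exchange and reflection relations for plane waves\<close>

definition boundary_factor :: "real \<Rightarrow> real \<Rightarrow> real \<Rightarrow> complex" where
  "boundary_factor ap bp x = (1 - of_real bp * cis (- x) + of_real ap * cis (- 2 * x)) / (1 - cis (- 2 * x))"

definition pair_factor :: "real \<Rightarrow> real \<Rightarrow> real \<Rightarrow> complex" where
  "pair_factor q x y = ((1 - of_real q * cis (- (x - y))) * (1 - of_real q * cis (- (x + y))))
     / ((1 - cis (- (x - y))) * (1 - cis (- (x + y))))"

definition plane_wave :: "real \<Rightarrow> real \<Rightarrow> real \<Rightarrow> nat \<Rightarrow> (nat \<Rightarrow> real) \<Rightarrow> (nat \<Rightarrow> int) \<Rightarrow> complex" where
  "plane_wave q ap bp m x l = Cfun q ap bp m x * cis (\<Sum>j<m. x j * of_int (l j))"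

lemma cis_add: "cis (a + b) = cis a * cis b" and cis_diff: "cis (a - b) = cis a * cis (- b)"
  by (simp_all add: cis_mult)

lemma Cfun_eq: "Cfun q ap bp m x = (\<Prod>j<m. boundary_factor ap bp (x j)) * (\<Prod>j<m. \<Prod>k\<in>{j<..<m}. pair_factor q (x j) (x k))"
  by (simp add: Cfun_def boundary_factor_def pair_factor_def)

lemma prod_cis: "finite A \<Longrightarrow> (\<Prod>k\<in>A. cis (f k)) = cis (\<Sum>k\<in>A. f k)"
  by (induction A rule: finite_induct) (auto simp: cis_mult)

lemma boundary_factor_eq: "boundary_factor ap bp x = (cis x - of_real bp + of_real ap * cis (- x)) / (cis x - cis (- x))"
proof -
  have "boundary_factor ap bp x = (cis x * (1 - of_real bp * cis (- x) + of_real ap * cis (- 2 * x))) / (cis x * (1 - cis (- 2 * x)))"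
    by (simp add: boundary_factor_def)
  also have "cis x * (1 - of_real bp * cis (- x) + of_real ap * cis (- 2 * x)) = cis x - of_real bp + of_real ap * cis (- x)"
  proof -
    have "cis x * cis (- x) = 1" "cis x * cis (- 2 * x) = cis (- x)" by (simp_all add: cis_mult)
    then show ?thesis by algebra
  qed
  also have "cis x * (1 - cis (- 2 * x)) = cis x - cis (- x)"
    by (simp add: algebra_simps cis_mult)
  finally show ?thesis .
qed

lemma pair_factor_eq: "pair_factor q x y = ((cis x - of_real q * cis y) * (cis x * cis y - of_real q))
     / ((cis x - cis y) * (cis x * cis y - 1))"
proof -
  have "pair_factor q x y = (cis x * (1 - of_real q * cis (- (x - y))) * (cis (x + y) * (1 - of_real q * cis (- (x + y)))))
     / (cis x * (1 - cis (- (x - y))) * (cis (x + y) * (1 - cis (- (x + y)))))"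
    by (simp add: pair_factor_def)
  also have "cis x * (1 - of_real q * cis (- (x - y))) = cis x - of_real q * cis y"
    by (simp add: algebra_simps cis_mult)
  also have "cis (x + y) * (1 - of_real q * cis (- (x + y))) = cis x * cis y - of_real q"
    by (simp add: algebra_simps cis_mult)
  also have "cis x * (1 - cis (- (x - y))) = cis x - cis y"
    by (simp add: algebra_simps cis_mult)
  also have "cis (x + y) * (1 - cis (- (x + y))) = cis x * cis y - 1"
    by (simp add: algebra_simps cis_mult)
  finally show ?thesis .
qed

lemma pair_factor_minus_right: "pair_factor q x (- y) = pair_factor q x y"
  by (simp add: pair_factor_def mult.commute)

text \<open>Exchanging \<open>x\<close> and \<open>y\<close> negates the denominator and keeps the
  numerator factor that contains the product of the two exponentials. As the denominators agree up
  to sign, the identity persists where they vanish.\<close>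

lemma pair_factor_swap: "pair_factor q x y * (cis y - of_real q * cis x) = - (pair_factor q y x * (cis x - of_real q * cis y))"
proof -
  have "(cis y - cis x) * (cis y * cis x - 1) = - ((cis x - cis y) * (cis x * cis y - 1))"
    by (simp add: algebra_simps)
  then show ?thesis
    by (simp add: pair_factor_eq mult_ac)
qed

text \<open>Up to monomials, each numerator factor at \<open>x\<close> is a numerator factor at
  \<open>- x\<close> times a Blaschke phase. These phases are the ones that \<open>theta\<close>
  collects.\<close>

lemma pair_factor_flip:
  assumes "\<bar>q\<bar> < 1"
  shows "pair_factor q x y = cis (vfun q (x + y) + vfun q (x - y)) * pair_factor q (- x) y"
proof -
  define u v where "u = cis x" and "v = cis y"
  define w z where "w = cis (- x)" and "z = cis (- y)"
  have uw: "u * w = 1" "v * z = 1" by (simp_all add: u_def v_def w_def z_def cis_mult)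
  then have nz: "u \<noteq> 0" "w \<noteq> 0" "v \<noteq> 0" by auto
  have e1: "cis (vfun q (x + y)) * (1 - of_real q * (u * v)) = u * v - of_real q"
    using cis_vfun[OF assms, of "x + y"] by (simp add: u_def v_def cis_mult)
  have e2: "cis (vfun q (x - y)) * (1 - of_real q * (u * z)) = u * z - of_real q"
    using cis_vfun[OF assms, of "x - y"] by (simp add: u_def z_def cis_mult)
  have 1: "u - of_real q * v = v * (u * z - of_real q)" "w - of_real q * v = w * (1 - of_real q * (u * v))"
    "w * v - of_real q = w * v * (1 - of_real q * (u * z))"
    using uw by algebra+
  have 2: "(w - v) * (w * v - 1) = w * w * ((u - v) * (u * v - 1))"
    using uw by algebra
  have "pair_factor q x y = (v * (u * z - of_real q) * (u * v - of_real q)) / ((u - v) * (u * v - 1))"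
    by (simp add: pair_factor_eq u_def[symmetric] v_def[symmetric] 1)
  also have "\<dots> = cis (vfun q (x + y) + vfun q (x - y)) *
     (v * (1 - of_real q * (u * z)) * (1 - of_real q * (u * v)) / ((u - v) * (u * v - 1)))"
    by (simp add: e1[symmetric] e2[symmetric] cis_mult[symmetric] mult_ac)
  also have "v * (1 - of_real q * (u * z)) * (1 - of_real q * (u * v)) / ((u - v) * (u * v - 1))
     = (w * w * (v * (1 - of_real q * (u * z)) * (1 - of_real q * (u * v)))) / (w * w * ((u - v) * (u * v - 1)))"
    using nz by simp
  also have "\<dots> = pair_factor q (- x) y"
    unfolding pair_factor_eq w_def[symmetric] v_def[symmetric] 1 2 by (simp add: mult_ac)
  finally show ?thesis .
qed

lemma prod_pairs:
  fixes f :: "nat \<Rightarrow> nat \<Rightarrow> complex"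
  shows "(\<Prod>j<m. \<Prod>k\<in>{j<..<m}. f j k) = (\<Prod>(j,k)\<in>{(j,k). j < k \<and> k < m}. f j k)"
proof -
  have "(SIGMA j:{..<m}. {j<..<m}) = {(j,k). j < k \<and> k < m}" by auto
  then show ?thesis by (simp add: prod.Sigma)
qed

text \<open>An adjacent transposition preserves the order within every pair of indices except
  \<open>(i, Suc i)\<close>, so it permutes the other pair factors among themselves.
  \<open>K\<close> collects all common factors.\<close>

lemma Cfun_swap:
  assumes "Suc i < m"
  obtains K where "Cfun q ap bp m x = K * pair_factor q (x i) (x (Suc i))"
    and "Cfun q ap bp m (x \<circ> Transposition.transpose i (Suc i)) = K * pair_factor q (x (Suc i)) (x i)"
proof
  let ?t = "Transposition.transpose i (Suc i)"
  define P where "P = {(j,k). j < k \<and> k < m}"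
  define K where "K = (\<Prod>j<m. boundary_factor ap bp (x j)) * (\<Prod>(j,k)\<in>P - {(i, Suc i)}. pair_factor q (x j) (x k))"
  have "finite P" by (rule finite_subset[of _ "{..<m} \<times> {..<m}"]) (auto simp: P_def)
  moreover have "(i, Suc i) \<in> P" using assms by (simp add: P_def)
  ultimately have split: "(\<Prod>(j,k)\<in>P. pair_factor q (y j) (y k))
      = pair_factor q (y i) (y (Suc i)) * (\<Prod>(j,k)\<in>P - {(i, Suc i)}. pair_factor q (y j) (y k))" for y
    by (subst prod.remove[of P "(i, Suc i)"]) auto
  show "Cfun q ap bp m x = K * pair_factor q (x i) (x (Suc i))"
    unfolding Cfun_eq prod_pairs P_def[symmetric] split by (simp add: K_def)
  have "bij_betw ?t {..<m} {..<m}"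
    by (rule bij_betw_byWitness[where f' = ?t]) (use assms in \<open>auto simp: Transposition.transpose_def\<close>)
  from prod.reindex_bij_betw[OF this, of "\<lambda>j. boundary_factor ap bp (x j)"]
  have 1: "(\<Prod>j<m. boundary_factor ap bp ((x \<circ> ?t) j)) = (\<Prod>j<m. boundary_factor ap bp (x j))" by simp
  have "bij_betw (map_prod ?t ?t) (P - {(i, Suc i)}) (P - {(i, Suc i)})"
    by (rule bij_betw_byWitness[where f' = "map_prod ?t ?t"])
       (use assms in \<open>auto simp: Transposition.transpose_def P_def split: if_splits\<close>)
  from prod.reindex_bij_betw[OF this, of "\<lambda>(j,k). pair_factor q (x j) (x k)"]
  have 2: "(\<Prod>(j,k)\<in>P - {(i, Suc i)}. pair_factor q ((x \<circ> ?t) j) ((x \<circ> ?t) k)) = (\<Prod>(j,k)\<in>P - {(i, Suc i)}. pair_factor q (x j) (x k))"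
    by (simp add: case_prod_beta)
  show "Cfun q ap bp m (x \<circ> ?t) = K * pair_factor q (x (Suc i)) (x i)"
    unfolding Cfun_eq prod_pairs P_def[symmetric] split 1 2 by (simp add: K_def)
qed

text \<open>The last index always stands in the second place of a pair, where
  \<open>pair_factor\<close> ignores the sign; only its own boundary factor changes.\<close>

lemma Cfun_flip_last:
  obtains K where "Cfun q ap bp (Suc m) x = K * boundary_factor ap bp (x m)"
    and "Cfun q ap bp (Suc m) (x(m := - x m)) = K * boundary_factor ap bp (- x m)"
proof
  let ?K = "(\<Prod>j<m. boundary_factor ap bp (x j)) * (\<Prod>j<Suc m. \<Prod>k\<in>{j<..<Suc m}. pair_factor q (x j) (x k))"
  show "Cfun q ap bp (Suc m) x = ?K * boundary_factor ap bp (x m)"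
    by (simp add: Cfun_eq del: prod.lessThan_Suc) (simp add: mult_ac)
  have "(\<Prod>j<Suc m. \<Prod>k\<in>{j<..<Suc m}. pair_factor q ((x(m := - x m)) j) ((x(m := - x m)) k))
     = (\<Prod>j<Suc m. \<Prod>k\<in>{j<..<Suc m}. pair_factor q (x j) (x k))"
    by (intro prod.cong) (auto simp: pair_factor_minus_right)
  moreover have "(\<Prod>j<m. boundary_factor ap bp ((x(m := - x m)) j)) = (\<Prod>j<m. boundary_factor ap bp (x j))"
    by (intro prod.cong) auto
  ultimately show "Cfun q ap bp (Suc m) (x(m := - x m)) = ?K * boundary_factor ap bp (- x m)"
    unfolding Cfun_eq prod.lessThan_Suc[of "\<lambda>j. boundary_factor ap bp (_ j)"] by simp
qed

text \<open>Index \<open>0\<close> always stands in the first place of a pair, where the sign does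
  matter. Its pair factors are therefore kept outside \<open>K\<close>; their change is what the
  Bethe equation has to compensate.\<close>

lemma Cfun_flip_first:
  obtains K where "Cfun q ap bp (Suc m) x = K * (boundary_factor ap bp (x 0) * (\<Prod>k<m. pair_factor q (x 0) (x (Suc k))))"
    and "Cfun q ap bp (Suc m) (x(0 := - x 0)) = K * (boundary_factor ap bp (- x 0) * (\<Prod>k<m. pair_factor q (- x 0) (x (Suc k))))"
proof
  let ?K = "(\<Prod>j<m. boundary_factor ap bp (x (Suc j))) * (\<Prod>j<m. \<Prod>k\<in>{Suc j<..<Suc m}. pair_factor q (x (Suc j)) (x k))"
  have "{0<..<Suc m} = Suc ` {..<m}"
    by (auto simp: image_iff) (metis Suc_less_SucD gr0_implies_Suc lessThan_iff)
  then have r: "(\<Prod>k\<in>{0<..<Suc m}. g k) = (\<Prod>k<m. g (Suc k))" for g :: "nat \<Rightarrow> complex"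
    by (simp add: prod.reindex)
  have C: "Cfun q ap bp (Suc m) y = (\<Prod>j<m. boundary_factor ap bp (y (Suc j))) * (\<Prod>j<m. \<Prod>k\<in>{Suc j<..<Suc m}. pair_factor q (y (Suc j)) (y k))
      * (boundary_factor ap bp (y 0) * (\<Prod>k<m. pair_factor q (y 0) (y (Suc k))))" for y
    unfolding Cfun_eq prod.lessThan_Suc_shift r by (simp add: mult_ac)
  show "Cfun q ap bp (Suc m) x = ?K * (boundary_factor ap bp (x 0) * (\<Prod>k<m. pair_factor q (x 0) (x (Suc k))))"
    by (rule C)
  show "Cfun q ap bp (Suc m) (x(0 := - x 0)) = ?K * (boundary_factor ap bp (- x 0) * (\<Prod>k<m. pair_factor q (- x 0) (x (Suc k))))"
    unfolding C by simp
qed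

lemma sum_antisym_zero:
  fixes g :: "'a \<Rightarrow> complex"
  assumes "\<And>x. x \<in> S \<Longrightarrow> t x \<in> S" "\<And>x. x \<in> S \<Longrightarrow> t (t x) = x" "\<And>x. x \<in> S \<Longrightarrow> g (t x) = - g x"
  shows "sum g S = 0"
proof -
  have "bij_betw t S S" by (rule bij_betw_byWitness[where f' = t]) (use assms in auto)
  then have "sum g S = (\<Sum>x\<in>S. g (t x))" by (rule sum.reindex_bij_betw[symmetric])
  also have "\<dots> = - sum g S" using assms(3) by (simp add: sum_negf)
  finally show ?thesis by simp
qed

lemma sum_upd2:
  fixes x :: "nat \<Rightarrow> real" and l :: "nat \<Rightarrow> int"
  assumes "i < m" "j < m" "i \<noteq> j"
  shows "(\<Sum>k<m. x k * of_int ((l(i := a, j := b)) k))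
    = (\<Sum>k\<in>{..<m} - {i,j}. x k * of_int (l k)) + (x i * of_int a + x j * of_int b)"
proof -
  have "{..<m} - {i} - {j} = {..<m} - {i,j}" by auto
  moreover have "(\<Sum>k\<in>{..<m} - {i,j}. x k * of_int ((l(i := a, j := b)) k)) = (\<Sum>k\<in>{..<m} - {i,j}. x k * of_int (l k))"
    by (rule sum.cong) auto
  ultimately show ?thesis
    using assms by (subst sum.remove[of _ i], simp, simp, subst sum.remove[of _ j]) auto
qed

lemma sum_upd1:
  fixes x :: "nat \<Rightarrow> real" and l :: "nat \<Rightarrow> int"
  assumes "i < m"
  shows "(\<Sum>k<m. x k * of_int ((l(i := a)) k)) = (\<Sum>k\<in>{..<m} - {i}. x k * of_int (l k)) + x i * of_int a"
proof -
  have "(\<Sum>k\<in>{..<m} - {i}. x k * of_int ((l(i := a)) k)) = (\<Sum>k\<in>{..<m} - {i}. x k * of_int (l k))"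
    by (rule sum.cong) auto
  then show ?thesis using assms by (subst sum.remove[of _ i]) auto
qed

text \<open>With \<open>a\<close> and \<open>b\<close> in both orders, the exponentials of the two
  coordinates add up to something symmetric under their exchange. What remains is \<open>C\<close>
  times \<open>cis (x (Suc i)) - q * cis (x i)\<close>, which is antisymmetric by
  \<open>pair_factor_swap\<close>.\<close>

lemma plane_wave_swap_relation:
  assumes i: "Suc i < m"
    and S: "\<And>x. x \<in> S \<Longrightarrow> x \<circ> Transposition.transpose i (Suc i) \<in> S"
  shows "(\<Sum>x\<in>S. plane_wave q ap bp m x (l(i := a, Suc i := b + 1)) - of_real q * plane_wave q ap bp m x (l(i := a + 1, Suc i := b))
     + (plane_wave q ap bp m x (l(i := b, Suc i := a + 1)) - of_real q * plane_wave q ap bp m x (l(i := b + 1, Suc i := a)))) = 0"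
    (is "sum ?g S = 0")
proof (rule sum_antisym_zero[where t = "\<lambda>x. x \<circ> Transposition.transpose i (Suc i)"])
  fix x :: "nat \<Rightarrow> real"
  let ?y = "x \<circ> Transposition.transpose i (Suc i)"
  obtain K where K: "Cfun q ap bp m x = K * pair_factor q (x i) (x (Suc i))"
    "Cfun q ap bp m ?y = K * pair_factor q (x (Suc i)) (x i)"
    using Cfun_swap[OF i] .
  let ?E = "\<lambda>x::nat \<Rightarrow> real. cis (\<Sum>k\<in>{..<m} - {i, Suc i}. x k * of_int (l k))"
  have E: "?E ?y = ?E x" by (rule arg_cong[where f = cis], rule sum.cong) (auto simp: Transposition.transpose_def)
  have m: "i < m" "Suc i < m" "i \<noteq> Suc i" using i by auto
  have g: "?g x = Cfun q ap bp m x * ?E x * (cis (x (Suc i)) - of_real q * cis (x i))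
     * (cis (x i * of_int a + x (Suc i) * of_int b) + cis (x i * of_int b + x (Suc i) * of_int a))" for x :: "nat \<Rightarrow> real"
    unfolding plane_wave_def sum_upd2[OF m] 
    by (simp only: of_int_add of_int_diff of_int_minus of_int_1 of_int_of_nat_eq distrib_left right_diff_distrib
        mult_minus_right mult_1_right cis_add cis_diff) (simp add: algebra_simps)
  have "?g ?y = K * ?E x * (pair_factor q (x (Suc i)) (x i) * (cis (x i) - of_real q * cis (x (Suc i))))
     * (cis (x (Suc i) * of_int a + x i * of_int b) + cis (x (Suc i) * of_int b + x i * of_int a))"
    unfolding g K E by (simp add: mult_ac)
  also have "\<dots> = - ?g x"
    unfolding g K pair_factor_swap[of q "x (Suc i)" "x i"] by (simp add: mult_ac add_ac)
  finally show "?g ?y = - ?g x" .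
qed (auto simp: S fun_eq_iff)

text \<open>Here \<open>s\<close> and \<open>- s\<close> add up to an even function of
  \<open>x m\<close>. The three-term combination is the numerator of the boundary factor at
  \<open>- x m\<close>; its product with the numerator at \<open>x m\<close> is even, and the
  denominator \<open>cis x - cis (- x)\<close> is odd.\<close>

lemma plane_wave_last_relation:
  assumes S: "\<And>x. x \<in> S \<Longrightarrow> x(m := - x m) \<in> S"
  shows "(\<Sum>x\<in>S. plane_wave q ap bp (Suc m) x (l(m := s - 1)) - of_real bp * plane_wave q ap bp (Suc m) x (l(m := s)) + of_real ap * plane_wave q ap bp (Suc m) x (l(m := s + 1))
     + (plane_wave q ap bp (Suc m) x (l(m := - s - 1)) - of_real bp * plane_wave q ap bp (Suc m) x (l(m := - s)) + of_real ap * plane_wave q ap bp (Suc m) x (l(m := - s + 1)))) = 0"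
    (is "sum ?g S = 0")
proof (rule sum_antisym_zero[where t = "\<lambda>x. x(m := - x m)"])
  fix x :: "nat \<Rightarrow> real"
  let ?y = "x(m := - x m)"
  obtain K where K: "Cfun q ap bp (Suc m) x = K * boundary_factor ap bp (x m)"
    "Cfun q ap bp (Suc m) ?y = K * boundary_factor ap bp (- x m)"
    using Cfun_flip_last .
  let ?E = "\<lambda>x::nat \<Rightarrow> real. cis (\<Sum>k\<in>{..<Suc m} - {m}. x k * of_int (l k))"
  have E: "?E ?y = ?E x" by (rule arg_cong[where f = cis], rule sum.cong) auto
  have g: "?g x = Cfun q ap bp (Suc m) x * ?E x * (cis (- x m) - of_real bp + of_real ap * cis (x m))
     * (cis (x m * of_int s) + cis (- (x m * of_int s)))" for x :: "nat \<Rightarrow> real"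
    unfolding plane_wave_def sum_upd1[OF lessI] 
    by (simp only: of_int_add of_int_diff of_int_minus of_int_1 of_int_of_nat_eq distrib_left right_diff_distrib
        mult_minus_right mult_1_right cis_add cis_diff) (simp add: algebra_simps)
  have a: "boundary_factor ap bp (- x m) * (cis (x m) - of_real bp + of_real ap * cis (- x m))
     = - (boundary_factor ap bp (x m) * (cis (- x m) - of_real bp + of_real ap * cis (x m)))"
  proof -
    have "cis (- x m) - cis (x m) = - (cis (x m) - cis (- x m))" by simp
    then show ?thesis unfolding boundary_factor_eq by (simp only: minus_minus divide_minus_right) (simp add: mult_ac)
  qed
  have "?g ?y = K * ?E x * (boundary_factor ap bp (- x m) * (cis (x m) - of_real bp + of_real ap * cis (- x m)))
     * (cis (- (x m * of_int s)) + cis (x m * of_int s))"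
    unfolding g K E by (simp add: mult_ac)
  also have "\<dots> = - ?g x"
    unfolding g K a by (simp add: mult_ac add_ac)
  finally show "?g ?y = - ?g x" .
qed (auto simp: S fun_eq_iff)

context qboson begin

text \<open>Both quadratics split, with roots given by the \<open>p\<close> and \<open>q\<close>
  parameters, and each of the four linear factors is turned into its mirror image by one Blaschke
  phase. The sign stems from the odd denominator.\<close>

lemma boundary_factor_flip:
  "boundary_factor (pp * qp) (pp + qp) x * (cis x - of_real (pm + qm) + of_real (pm * qm) * cis (- x))
   = - (cis (vb x) * (boundary_factor (pp * qp) (pp + qp) (- x) * (cis (- x) - of_real (pm + qm) + of_real (pm * qm) * cis x)))"
proof -
  define u w where "u = cis x" and "w = cis (- x)"
  define e where "e = (\<lambda>a. cis (vfun a x))"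
  have uw: "u * w = 1" by (simp add: u_def w_def cis_mult)
  have e: "e a * (1 - of_real a * u) = u - of_real a" if "\<bar>a\<bar> < 1" for a
    using cis_vfun[OF that, of x] by (simp add: u_def e_def)
  have vb: "cis (vb x) = e pp * e qp * e pm * e qm"
    by (simp add: vb_def e_def cis_mult)
  have 1: "u - of_real (a + b) + of_real (a * b) * w = w * (u - of_real a) * (u - of_real b)" for a b
    using uw by simp algebra
  have 2: "w - of_real (a + b) + of_real (a * b) * u = w * (1 - of_real a * u) * (1 - of_real b * u)" for a b
    using uw by simp algebra
  have "boundary_factor (pp * qp) (pp + qp) x * (u - of_real (pm + qm) + of_real (pm * qm) * w)
     = cis (vb x) * (w * (1 - of_real pp * u) * (1 - of_real qp * u) * (w * (1 - of_real pm * u) * (1 - of_real qm * u)) / (u - w))"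
    unfolding boundary_factor_eq u_def[symmetric] w_def[symmetric] 1 vb
    by (simp add: e[OF pp, symmetric] e[OF qp, symmetric] e[OF pm, symmetric] e[OF qm, symmetric] mult_ac)
  also have "\<dots> = cis (vb x) * (- (w * (1 - of_real pp * u) * (1 - of_real qp * u)) / (w - u) * (w * (1 - of_real pm * u) * (1 - of_real qm * u)))"
  proof -
    have "w - u = - (u - w)" by simp
    then show ?thesis by (simp only: divide_minus_right) simp
  qed
  also have "\<dots> = - (cis (vb x) * (boundary_factor (pp * qp) (pp + qp) (- x) * (w - of_real (pm + qm) + of_real (pm * qm) * u)))"
    unfolding boundary_factor_eq minus_minus u_def[symmetric] w_def[symmetric] 2 by simp
  finally show ?thesis by (simp add: u_def w_def)
qed

text \<open>The Bethe equation \<open>cis (theta x 0) = 1\<close> is what makes the summand antisymmetric under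
  \<open>x 0 \<mapsto> - x 0\<close>.\<close>

lemma plane_wave_first_relation:
  assumes m: "m = Suc m'"
    and S: "\<And>x. x \<in> S \<Longrightarrow> x(0 := - x 0) \<in> S" and B: "\<And>x. x \<in> S \<Longrightarrow> cis (theta x 0) = 1"
  defines "W \<equiv> plane_wave q (pp * qp) (pp + qp) m"
  shows "(\<Sum>x\<in>S. W x (l(0 := int n + s + 1)) - of_real (pm + qm) * W x (l(0 := int n + s)) + of_real (pm * qm) * W x (l(0 := int n + s - 1))
     + (W x (l(0 := int n - s + 1)) - of_real (pm + qm) * W x (l(0 := int n - s)) + of_real (pm * qm) * W x (l(0 := int n - s - 1)))) = 0"
    (is "sum ?g S = 0")
proof (rule sum_antisym_zero[where t = "\<lambda>x. x(0 := - x 0)"])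
  fix x :: "nat \<Rightarrow> real" assume x: "x \<in> S"
  let ?y = "x(0 := - x 0)"
  let ?D = "\<lambda>t. cis t - of_real (pm + qm) + of_real (pm * qm) * cis (- t)"
  let ?c = "boundary_factor (pp * qp) (pp + qp)"
  obtain K where K: "Cfun q (pp * qp) (pp + qp) m x = K * (?c (x 0) * (\<Prod>k<m'. pair_factor q (x 0) (x (Suc k))))"
    "Cfun q (pp * qp) (pp + qp) m ?y = K * (?c (- x 0) * (\<Prod>k<m'. pair_factor q (- x 0) (x (Suc k))))"
    unfolding m using Cfun_flip_first .
  let ?E = "\<lambda>x::nat \<Rightarrow> real. cis (\<Sum>k\<in>{..<m} - {0}. x k * of_int (l k))"
  have E: "?E ?y = ?E x" by (rule arg_cong[where f = cis], rule sum.cong) auto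
  have m0: "0 < m" using m by simp
  have g: "?g x = Cfun q (pp * qp) (pp + qp) m x * ?E x * (cis (n * x 0) * ?D (x 0))
     * (cis (x 0 * of_int s) + cis (- (x 0 * of_int s)))" for x :: "nat \<Rightarrow> real"
    unfolding W_def plane_wave_def sum_upd1[OF m0] 
    by (simp only: of_int_add of_int_diff of_int_minus of_int_1 of_int_of_nat_eq distrib_left right_diff_distrib
        mult_minus_right mult_1_right cis_add cis_diff) (simp add: algebra_simps)
  have "{..<m} - {0} = Suc ` {..<m'}"
    unfolding m lessThan_Suc_eq_insert_0 by auto
  then have "(\<Sum>k\<in>{..<m} - {0}. h k) = (\<Sum>k<m'. h (Suc k))" for h :: "nat \<Rightarrow> real"
    by (simp only: sum.reindex[OF inj_Suc] o_def)
  then have th: "theta x 0 = 2 * n * x 0 + (\<Sum>k<m'. vfun q (x 0 + x (Suc k)) + vfun q (x 0 - x (Suc k))) + vb (x 0)"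
    by (simp only: theta_def)
  let ?S = "cis (\<Sum>k<m'. vfun q (x 0 + x (Suc k)) + vfun q (x 0 - x (Suc k)))"
  let ?P = "\<Prod>k<m'. pair_factor q (- x 0) (x (Suc k))"
  have P: "(\<Prod>k<m'. pair_factor q (x 0) (x (Suc k))) = ?S * ?P"
    unfolding pair_factor_flip[OF q, of "x 0"] prod.distrib prod_cis[OF finite_lessThan] ..
  \<comment> \<open>Reflecting a wave centred at the wall \<open>n\<close> replaces
    \<open>cis (n * x 0)\<close> by its inverse. The quotient supplies the term
    \<open>2 * n * x 0\<close> of \<open>theta\<close>.\<close>
  have N: "cis (n * x 0) = cis (2 * n * x 0) * cis (- (n * x 0))"
    by (simp add: cis_mult)
  have T: "cis (theta x 0) = cis (2 * n * x 0) * ?S * cis (vb (x 0))"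
    unfolding th by (simp only: cis_add)
  have "cis (n * x 0) * (?c (x 0) * ?D (x 0)) * (\<Prod>k<m'. pair_factor q (x 0) (x (Suc k)))
     = - (cis (theta x 0) * (cis (- (n * x 0)) * (?c (- x 0) * ?D (- x 0)) * ?P))"
    unfolding boundary_factor_flip P N T minus_minus by algebra
  then have A: "cis (n * x 0) * (?c (x 0) * ?D (x 0)) * (\<Prod>k<m'. pair_factor q (x 0) (x (Suc k)))
     = - (cis (- (n * x 0)) * (?c (- x 0) * ?D (- x 0)) * (\<Prod>k<m'. pair_factor q (- x 0) (x (Suc k))))"
    by (simp add: B[OF x])
  have "?g ?y = K * ?E x * (cis (- (n * x 0)) * (?c (- x 0) * ?D (- x 0)) * (\<Prod>k<m'. pair_factor q (- x 0) (x (Suc k))))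
     * (cis (- (x 0 * of_int s)) + cis (x 0 * of_int s))"
    unfolding g K E by (simp add: mult_ac)
  also have "\<dots> = - (K * ?E x * (cis (n * x 0) * (?c (x 0) * ?D (x 0)) * (\<Prod>k<m'. pair_factor q (x 0) (x (Suc k))))
     * (cis (x 0 * of_int s) + cis (- (x 0 * of_int s))))"
    unfolding A by (simp add: add.commute)
  also have "\<dots> = - ?g x"
    unfolding g K by (simp add: mult_ac)
  finally show "?g ?y = - ?g x" .
qed (auto simp: S fun_eq_iff)

end

section \<open>Signed permutation orbits\<close>

text \<open>A set of points rather than a family indexed by signed permutations, so that the
  involutions behind the relations act directly on the summands. \<open>HL_alcove\<close> confirms
  that over the alcove no multiplicity is lost.\<close>

definition signed_orbit :: "nat \<Rightarrow> (nat \<Rightarrow> real) \<Rightarrow> (nat \<Rightarrow> real) set" where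
  "signed_orbit m \<xi> = (\<lambda>(\<sigma>, \<epsilon>) j. \<epsilon> j * \<xi> (\<sigma> j)) ` ({\<sigma>. \<sigma> permutes {..<m}} \<times> ({..<m} \<rightarrow>\<^sub>E {-1, 1}))"

definition alcove :: "nat \<Rightarrow> (nat \<Rightarrow> real) set" where
  "alcove m = {\<xi> \<in> Rm m. (\<forall>j<m. 0 < \<xi> j \<and> \<xi> j < pi) \<and> (\<forall>i j. i < j \<and> j < m \<longrightarrow> \<xi> j < \<xi> i)}"

lemma finite_signed_orbit: "finite (signed_orbit m \<xi>)"
  unfolding signed_orbit_def by (intro finite_imageI finite_cartesian_product finite_permutations finite_PiE) auto

text \<open>Extensional sign functions are \<open>undefined\<close> from \<open>m\<close> on; this
  is harmless because \<open>\<sigma>\<close> fixes these indices and \<open>\<xi>\<close> vanishes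
  there.\<close>

lemma orbI:
  assumes "\<xi> \<in> Rm m" "\<sigma> permutes {..<m}" "\<And>j. j < m \<Longrightarrow> \<epsilon> j \<in> {-1, 1}"
    and "\<And>j. j < m \<Longrightarrow> x j = \<epsilon> j * \<xi> (\<sigma> j)" "\<And>j. m \<le> j \<Longrightarrow> x j = 0"
  shows "x \<in> signed_orbit m \<xi>"
proof -
  have "x = (\<lambda>j. (restrict \<epsilon> {..<m}) j * \<xi> (\<sigma> j))"
  proof
    fix j show "x j = (restrict \<epsilon> {..<m}) j * \<xi> (\<sigma> j)"
      using assms(1,4,5) permutes_not_in[OF assms(2), of j] by (cases "j < m") (auto simp: Rm_def)
  qed
  moreover have "restrict \<epsilon> {..<m} \<in> {..<m} \<rightarrow>\<^sub>E {-1, 1}" using assms(3) by auto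
  ultimately show ?thesis
    unfolding signed_orbit_def by (intro image_eqI[where x = "(\<sigma>, restrict \<epsilon> {..<m})"]) (use assms(2) in simp_all)
qed

lemma orbE:
  assumes "x \<in> signed_orbit m \<xi>" "\<xi> \<in> Rm m"
  obtains \<sigma> \<epsilon> where "\<sigma> permutes {..<m}" "\<And>j. j < m \<Longrightarrow> \<epsilon> j \<in> {-1, 1}"
    "\<And>j. j < m \<Longrightarrow> x j = \<epsilon> j * \<xi> (\<sigma> j)" "\<And>j. m \<le> j \<Longrightarrow> x j = 0"
proof -
  from assms(1) obtain \<sigma> \<epsilon> where *: "\<sigma> permutes {..<m}" "\<epsilon> \<in> {..<m} \<rightarrow>\<^sub>E {-1, 1}" "x = (\<lambda>j. \<epsilon> j * \<xi> (\<sigma> j))"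
    by (auto simp: signed_orbit_def)
  show ?thesis
  proof (rule that[of \<sigma> \<epsilon>])
    show "\<epsilon> j \<in> {-1, 1}" if "j < m" for j using PiE_mem[OF *(2), of j] that by simp
    show "x j = 0" if "m \<le> j" for j using * that assms(2) permutes_not_in[OF *(1), of j] by (simp add: Rm_def)
  qed (use * in auto)
qed

lemma signed_orbit_swap:
  assumes "x \<in> signed_orbit m \<xi>" "\<xi> \<in> Rm m" "Suc i < m"
  shows "x \<circ> Transposition.transpose i (Suc i) \<in> signed_orbit m \<xi>"
proof -
  let ?t = "Transposition.transpose i (Suc i)"
  obtain \<sigma> \<epsilon> where *: "\<sigma> permutes {..<m}" "\<And>j. j < m \<Longrightarrow> \<epsilon> j \<in> {-1, 1}"
    "\<And>j. j < m \<Longrightarrow> x j = \<epsilon> j * \<xi> (\<sigma> j)" "\<And>j. m \<le> j \<Longrightarrow> x j = 0"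
    using orbE[OF assms(1,2)] by metis
  have t: "?t j < m" if "j < m" for j using that assms(3) by (auto simp: Transposition.transpose_def)
  have t': "?t j = j" if "m \<le> j" for j using that assms(3) by (auto simp: Transposition.transpose_def)
  have "?t permutes {..<m}" by (rule permutes_swap_id) (use assms(3) in auto)
  show ?thesis
    by (rule orbI[where \<sigma> = "\<sigma> \<circ> ?t" and \<epsilon> = "\<epsilon> \<circ> ?t"])
       (use assms(2) * t t' permutes_compose[OF \<open>?t permutes _\<close> *(1)] in \<open>simp_all\<close>)
qed

lemma signed_orbit_flip:
  assumes "x \<in> signed_orbit m \<xi>" "\<xi> \<in> Rm m" "i < m"
  shows "x(i := - x i) \<in> signed_orbit m \<xi>"
proof -
  obtain \<sigma> \<epsilon> where *: "\<sigma> permutes {..<m}" "\<And>j. j < m \<Longrightarrow> \<epsilon> j \<in> {-1, 1}"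
    "\<And>j. j < m \<Longrightarrow> x j = \<epsilon> j * \<xi> (\<sigma> j)" "\<And>j. m \<le> j \<Longrightarrow> x j = 0"
    using orbE[OF assms(1,2)] by metis
  show ?thesis
    by (rule orbI[where \<sigma> = \<sigma> and \<epsilon> = "\<epsilon>(i := - \<epsilon> i)"]) (use assms(2,3) * in auto)
qed

lemma signed_orbit_Rm: "x \<in> signed_orbit m \<xi> \<Longrightarrow> \<xi> \<in> Rm m \<Longrightarrow> x \<in> Rm m"
  by (erule orbE) (auto simp: Rm_def)

lemma alcove_Rm: "\<xi> \<in> alcove m \<Longrightarrow> \<xi> \<in> Rm m"
  by (simp add: alcove_def)

lemma alcove_inj: "\<xi> \<in> alcove m \<Longrightarrow> i < m \<Longrightarrow> j < m \<Longrightarrow> \<xi> i = \<xi> j \<Longrightarrow> i = j"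
  unfolding alcove_def by (metis (mono_tags, lifting) less_irrefl linorder_neqE_nat mem_Collect_eq)

lemma signed_orbit_alcove:
  assumes "x \<in> signed_orbit m \<xi>" "\<xi> \<in> alcove m"
  shows "\<And>j. j < m \<Longrightarrow> 0 < \<bar>x j\<bar> \<and> \<bar>x j\<bar> < pi"
    and "\<And>i j. i < m \<Longrightarrow> j < m \<Longrightarrow> \<bar>x i\<bar> = \<bar>x j\<bar> \<Longrightarrow> i = j"
    and "(\<lambda>j. \<bar>x j\<bar>) ` {..<m} = \<xi> ` {..<m}"
proof -
  obtain \<sigma> \<epsilon> where *: "\<sigma> permutes {..<m}" "\<And>j. j < m \<Longrightarrow> \<epsilon> j \<in> {-1, 1}"
    "\<And>j. j < m \<Longrightarrow> x j = \<epsilon> j * \<xi> (\<sigma> j)"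
    using orbE[OF assms(1) alcove_Rm[OF assms(2)]] by metis
  have \<sigma>: "\<sigma> j < m" if "j < m" for j using permutes_in_image[OF *(1), of j] that by simp
  have abs: "\<bar>x j\<bar> = \<xi> (\<sigma> j)" "0 < \<xi> (\<sigma> j)" "\<xi> (\<sigma> j) < pi" if "j < m" for j
    using *(2,3)[OF that] \<sigma>[OF that] assms(2) by (auto simp: alcove_def)
  show "0 < \<bar>x j\<bar> \<and> \<bar>x j\<bar> < pi" if "j < m" for j using abs[OF that] by simp
  show "i = j" if "i < m" "j < m" "\<bar>x i\<bar> = \<bar>x j\<bar>" for i j
    using alcove_inj[OF assms(2) \<sigma>[OF that(1)] \<sigma>[OF that(2)]] abs(1) that permutes_inj[OF *(1)]
    by (auto dest: injD)
  have "(\<lambda>j. \<bar>x j\<bar>) ` {..<m} = \<xi> ` (\<sigma> ` {..<m})"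
    unfolding image_image by (rule image_cong) (auto simp: abs(1))
  then show "(\<lambda>j. \<bar>x j\<bar>) ` {..<m} = \<xi> ` {..<m}" using permutes_image[OF *(1)] by simp
qed

text \<open>A point of the alcove is the decreasing enumeration of its set of coordinates.\<close>

lemma alcove_eqI:
  assumes "\<xi> \<in> alcove m" "\<eta> \<in> alcove m" "\<xi> ` {..<m} = \<eta> ` {..<m}"
  shows "\<xi> = \<eta>"
proof -
  have s: "sorted (rev (map f [0..<m])) \<and> distinct (rev (map f [0..<m]))" if "f \<in> alcove m" for f
  proof -
    have "sorted (rev (map f [0..<m]))"
      unfolding sorted_rev_iff_nth_mono using that by (auto simp: alcove_def le_less)
    moreover have "inj_on f {0..<m}" using alcove_inj[OF that] by (auto intro: inj_onI)
    ultimately show ?thesis by (simp add: distinct_map)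
  qed
  have "rev (map \<xi> [0..<m]) = rev (map \<eta> [0..<m])"
    by (rule sorted_distinct_set_unique) (use s assms in \<open>auto simp: lessThan_atLeast0\<close>)
  then have "\<forall>j<m. \<xi> j = \<eta> j" by simp
  moreover have "\<xi> j = \<eta> j" if "j \<ge> m" for j using assms that by (simp add: Rm_def alcove_def)
  ultimately show ?thesis by (meson ext not_le)
qed

lemma signed_orbit_disjoint:
  assumes "x \<in> signed_orbit m \<xi>" "x \<in> signed_orbit m \<eta>" "\<xi> \<in> alcove m" "\<eta> \<in> alcove m"
  shows "\<xi> = \<eta>"
  using alcove_eqI[OF assms(3,4)] signed_orbit_alcove(3)[OF assms(1,3)] signed_orbit_alcove(3)[OF assms(2,4)] by simp

lemma not_2pi_multiple:
  assumes "0 < \<bar>t\<bar>" "\<bar>t\<bar> < 2 * pi"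
  shows "t \<noteq> 2 * pi * of_int l"
proof
  assume t: "t = 2 * pi * of_int l"
  then have "\<bar>t\<bar> = 2 * pi * \<bar>of_int l\<bar>" by (simp add: abs_mult)
  with assms have "0 < \<bar>real_of_int l\<bar>" "\<bar>real_of_int l\<bar> < 1" by (auto simp: zero_less_mult_iff)
  then have "l \<noteq> 0" "\<bar>l\<bar> < 1" by (auto simp flip: of_int_abs)
  then show False by linarith
qed

lemma alcove_generic:
  assumes "\<xi> \<in> alcove m"
  shows "\<xi> \<in> generic m"
proof -
  have p: "0 < \<xi> j" "\<xi> j < pi" if "j < m" for j using assms that by (auto simp: alcove_def)
  have "2 * \<xi> j \<noteq> 2 * pi * of_int l" if "j < m" for j l
    by (rule not_2pi_multiple) (use p[OF that] in auto)
  moreover have "\<xi> j + \<xi> k \<noteq> 2 * pi * of_int l" if "j < m" "k < m" for j k l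
    by (rule not_2pi_multiple) (use p[OF that(1)] p[OF that(2)] in auto)
  moreover have "\<xi> j - \<xi> k \<noteq> 2 * pi * of_int l" if "j < m" "k < m" "j \<noteq> k" for j k l
    by (rule not_2pi_multiple) (use p[OF that(1)] p[OF that(2)] alcove_inj[OF assms that(1,2)] that(3) in auto)
  ultimately show ?thesis using alcove_Rm[OF assms] by (auto simp: generic_def)
qed

text \<open>Points of the alcove are generic, so the branch of \<open>HL\<close> that takes a limit
  never enters. Signs and indices are recovered from a point because its coordinates have positive,
  pairwise distinct absolute values.\<close>

lemma HL_alcove:
  assumes "\<xi> \<in> alcove m"
  shows "HL q ap bp m lam \<xi> = (\<Sum>x\<in>signed_orbit m \<xi>. plane_wave q ap bp m x (\<lambda>j. lam ! j))"
proof -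
  let ?P = "{\<sigma>. \<sigma> permutes {..<m}}" and ?E = "{..<m} \<rightarrow>\<^sub>E {-1, 1::real}"
  let ?f = "\<lambda>(\<sigma>, \<epsilon>) j. \<epsilon> j * \<xi> (\<sigma> j)"
  have "inj_on ?f (?P \<times> ?E)"
  proof (rule inj_onI, clarify)
    fix \<sigma> \<epsilon> \<sigma>' \<epsilon>'
    assume h: "\<sigma> permutes {..<m}" "\<epsilon> \<in> ?E" "\<sigma>' permutes {..<m}" "\<epsilon>' \<in> ?E"
      "(\<lambda>j. \<epsilon> j * \<xi> (\<sigma> j)) = (\<lambda>j. \<epsilon>' j * \<xi> (\<sigma>' j))"
    have *: "\<sigma> j = \<sigma>' j \<and> \<epsilon> j = \<epsilon>' j" if "j < m" for j
    proof -
      have m: "\<sigma> j < m" "\<sigma>' j < m"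
        using permutes_in_image[OF h(1), of j] permutes_in_image[OF h(3), of j] that by simp_all
      have e: "\<epsilon> j \<in> {-1,1}" "\<epsilon>' j \<in> {-1,1}" using PiE_mem h(2,4) that by auto
      have eq: "\<epsilon> j * \<xi> (\<sigma> j) = \<epsilon>' j * \<xi> (\<sigma>' j)" using fun_cong[OF h(5)] .
      have p: "0 < \<xi> (\<sigma> j)" "0 < \<xi> (\<sigma>' j)" using m assms by (auto simp: alcove_def)
      have "\<xi> (\<sigma> j) = \<xi> (\<sigma>' j)" using e eq p by auto
      then have "\<sigma> j = \<sigma>' j" using alcove_inj[OF assms m] by simp
      with eq p show ?thesis by simp
    qed
    have "\<sigma> = \<sigma>'"
      using * permutes_not_in[OF h(1)] permutes_not_in[OF h(3)] by (metis ext lessThan_iff)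
    moreover have "\<epsilon> = \<epsilon>'" by (rule PiE_ext[OF h(2,4)]) (use * in auto)
    ultimately show "\<sigma> = \<sigma>' \<and> \<epsilon> = \<epsilon>'" by simp
  qed
  then have "(\<Sum>x\<in>signed_orbit m \<xi>. plane_wave q ap bp m x (\<lambda>j. lam ! j))
      = (\<Sum>(\<sigma>,\<epsilon>)\<in>?P \<times> ?E. plane_wave q ap bp m (\<lambda>j. \<epsilon> j * \<xi> (\<sigma> j)) (\<lambda>j. lam ! j))"
    unfolding signed_orbit_def by (subst sum.reindex) (auto simp: o_def case_prod_beta)
  also have "\<dots> = R_gen q ap bp m lam \<xi>"
    unfolding R_gen_def plane_wave_def by (simp add: sum.cartesian_product)
  finally show ?thesis using alcove_generic[OF assms] by (simp add: HL_def)
qed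

section \<open>Nonvanishing coefficients and independence of characters\<close>

lemma cis_eq_iff_abs_less_pi:
  assumes "\<bar>a\<bar> < pi" "\<bar>b\<bar> < pi"
  shows "cis a = cis b \<longleftrightarrow> a = b"
proof
  assume "cis a = cis b"
  then have "cis (a - b) = 1" by (simp flip: cis_divide)
  then have "cos (a - b) = 1" by (metis cis.sel(1) one_complex.sel(1))
  then obtain l :: int where "a - b = 2 * pi * of_int l" by (auto simp: cos_one_2pi_int)
  moreover have "\<bar>a - b\<bar> < 2 * pi" using assms by linarith
  ultimately have "\<not> 0 < \<bar>a - b\<bar>" using not_2pi_multiple by blast
  then show "a = b" by simp
qed simp

text \<open>A zero of a numerator would equate numbers of modulus \<open>1\<close> and of modulus
  less than \<open>1\<close>. The denominators need care too, as a quotient by zero would itself be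
  zero; they are excluded by the distinct absolute values in the open interval from \<open>0\<close>
  to \<open>pi\<close>.\<close>

lemma Cfun_nonzero:
  assumes x: "x \<in> signed_orbit m \<xi>" "\<xi> \<in> alcove m"
    and p: "\<bar>p\<bar> < 1" "\<bar>p'\<bar> < 1" and q: "\<bar>q\<bar> < 1"
  shows "Cfun q (p * p') (p + p') m x \<noteq> 0"
proof -
  note a = signed_orbit_alcove[OF x]
  have nz: "cis t \<noteq> of_real r" if "\<bar>r\<bar> < 1" for t r
    using that by (metis less_irrefl norm_cis norm_of_real)
  have "boundary_factor (p * p') (p + p') (x j) \<noteq> 0" if "j < m" for j
  proof -
    have "cis (x j) \<noteq> cis (- x j)" using a(1)[OF that] by (subst cis_eq_iff_abs_less_pi) auto
    moreover have "cis (x j) - of_real (p + p') + of_real (p * p') * cis (- x j)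
        = cis (- x j) * (cis (x j) - of_real p) * (cis (x j) - of_real p')"
    proof -
      have "cis (x j) * cis (- x j) = 1" by (simp add: cis_mult)
      then show ?thesis by simp algebra
    qed
    ultimately show ?thesis using nz p by (simp add: boundary_factor_eq)
  qed
  moreover have "pair_factor q (x j) (x k) \<noteq> 0" if "j < m" "k < m" "j \<noteq> k" for j k
  proof -
    have ne: "\<bar>x j\<bar> \<noteq> \<bar>x k\<bar>" using a(2) that by blast
    have "cis (x j) \<noteq> cis (x k)" using a(1)[OF that(1)] a(1)[OF that(2)] ne
      by (subst cis_eq_iff_abs_less_pi) auto
    moreover have "cis (x j) * cis (x k) \<noteq> 1"
    proof
      assume "cis (x j) * cis (x k) = 1"
      then have "cis (x j) * cis (x k) * cis (- x k) = cis (- x k)" by simp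
      then have "cis (x j) = cis (- x k)" by (simp add: cis_mult)
      then show False using a(1)[OF that(1)] a(1)[OF that(2)] ne by (subst (asm) cis_eq_iff_abs_less_pi) auto
    qed
    moreover have "cis (x j) \<noteq> of_real q * cis (x k)"
    proof
      assume "cis (x j) = of_real q * cis (x k)"
      then have "norm (cis (x j)) = norm (of_real q * cis (x k))" by simp
      then show False using q by (simp add: norm_mult)
    qed
    moreover have "cis (x j) * cis (x k) \<noteq> of_real q" using nz[OF q] by (simp add: cis_mult)
    ultimately show ?thesis by (simp add: pair_factor_eq)
  qed
  ultimately show ?thesis unfolding Cfun_eq by auto
qed

text \<open>The argument of Dedekind and Artin. Raising \<open>l j\<close> by one multiplies the
  term of \<open>i\<close> by \<open>cis (X i j)\<close>; subtracting \<open>cis (X a j)\<close>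
  times the original relation removes the term of \<open>a\<close>. The coordinate \<open>j\<close>
  is chosen to separate \<open>X i\<close> from \<open>X a\<close>, and the bound by
  \<open>pi\<close> makes \<open>cis\<close> injective on the coordinates.\<close>

lemma char_independent:
  fixes X :: "'i \<Rightarrow> nat \<Rightarrow> real" and b :: "'i \<Rightarrow> complex"
  assumes "finite I" "inj_on X I" "\<And>i. i \<in> I \<Longrightarrow> X i \<in> Rm m"
    and "\<And>i j. i \<in> I \<Longrightarrow> j < m \<Longrightarrow> \<bar>X i j\<bar> < pi"
    and "\<And>l. (\<Sum>i\<in>I. b i * cis (\<Sum>j<m. X i j * of_int (l j))) = 0"
  shows "\<forall>i\<in>I. b i = 0"
  using assms
proof (induction I arbitrary: b rule: finite_induct)
  case (insert a I)
  let ?e = "\<lambda>i l. cis (\<Sum>j<m. X i j * of_int (l j))"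
  have shift: "?e i (l(j := l j + 1)) = ?e i l * cis (X i j)" if "j < m" for i j l
    using sum_upd1[OF that, of "X i" l "l j + 1"] sum_upd1[OF that, of "X i" l "l j"]
    by (simp add: cis_mult algebra_simps)
  have I: "b i = 0" if i: "i \<in> I" for i
  proof -
    have "X i \<noteq> X a" using insert.prems(1) insert.hyps(2) i by (auto simp: inj_on_def)
    moreover have "X i j = X a j" if "j \<ge> m" for j using insert.prems(2)[of i] insert.prems(2)[of a] i that
      by (simp add: Rm_def)
    ultimately obtain j where j: "j < m" "X i j \<noteq> X a j" by (meson ext not_le)
    have "\<forall>i\<in>I. b i * (cis (X i j) - cis (X a j)) = 0"
    proof (rule insert.IH)
      fix l
      have "(\<Sum>i\<in>I. b i * (cis (X i j) - cis (X a j)) * ?e i l)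
          = (\<Sum>i\<in>insert a I. b i * (cis (X i j) - cis (X a j)) * ?e i l)"
        using insert.hyps by simp
      also have "\<dots> = (\<Sum>i\<in>insert a I. b i * ?e i (l(j := l j + 1))) - cis (X a j) * (\<Sum>i\<in>insert a I. b i * ?e i l)"
        unfolding shift[OF j(1)] sum_distrib_left sum_subtractf[symmetric]
        by (rule sum.cong) (auto simp: algebra_simps)
      also have "\<dots> = 0" unfolding insert.prems(4) by simp
      finally show "(\<Sum>i\<in>I. b i * (cis (X i j) - cis (X a j)) * ?e i l) = 0" .
    qed (use insert.prems in auto)
    then have "b i * (cis (X i j) - cis (X a j)) = 0" using i by blast
    moreover have "cis (X i j) \<noteq> cis (X a j)"
      using cis_eq_iff_abs_less_pi[of "X i j" "X a j"] insert.prems(3) i j by auto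
    ultimately show ?thesis by simp
  qed
  then have "b a * ?e a (\<lambda>_. 0) = 0" using insert.prems(4)[of "\<lambda>_. 0"] insert.hyps by simp
  then show ?case using I by simp
qed simp

context qboson begin

lemma xi_alcove: "\<kappa> \<in> Lam m n \<Longrightarrow> xi \<kappa> \<in> alcove m"
  by (simp add: alcove_def xi_Rm xi_pos xi_less_pi xi_strict_antimono)

text \<open>\<open>theta\<close> is equivariant under signed permutations, its phases being odd.
  This is needed since coordinate \<open>0\<close> of an orbit point can be any coordinate of
  \<open>\<xi>\<close> up to sign; the sign does not affect the condition
  \<open>cis (theta x j) = 1\<close>.\<close>

lemma theta_orb:
  assumes "x \<in> signed_orbit m \<xi>" "\<xi> \<in> Rm m" "j < m"
  obtains k where "k < m" "theta x j = theta \<xi> k \<or> theta x j = - theta \<xi> k"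
proof -
  obtain \<sigma> \<epsilon> where *: "\<sigma> permutes {..<m}" "\<And>j. j < m \<Longrightarrow> \<epsilon> j \<in> {-1, 1}"
    "\<And>j. j < m \<Longrightarrow> x j = \<epsilon> j * \<xi> (\<sigma> j)"
    using orbE[OF assms(1,2)] by metis
  have odd: "vfun q (- y - z) = - vfun q (y + z)" "vfun q (- y + z) = - vfun q (y - z)" for y z
    using vfun_minus[OF q, of "y + z"] vfun_minus[OF q, of "y - z"] by simp_all
  have 1: "vfun q (x j + x k) + vfun q (x j - x k) = \<epsilon> j * (vfun q (\<xi> (\<sigma> j) + \<xi> (\<sigma> k)) + vfun q (\<xi> (\<sigma> j) - \<xi> (\<sigma> k)))"
    if "k < m" for k
    using *(2)[OF assms(3)] *(2)[OF that] vfun_minus[OF q, of "\<xi> (\<sigma> j) - \<xi> (\<sigma> k)"]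
    by (auto simp: *(3) assms(3) that odd)
  have 2: "vb (x j) = \<epsilon> j * vb (\<xi> (\<sigma> j))"
    using *(2)[OF assms(3)] by (auto simp: *(3) assms(3) vb_minus)
  have "bij_betw \<sigma> ({..<m} - {j}) ({..<m} - {\<sigma> j})"
    by (rule bij_betw_DiffI) (use permutes_imp_bij[OF *(1)] assms(3) in \<open>auto simp: bij_betw_def\<close>)
  from sum.reindex_bij_betw[OF this, of "\<lambda>k. vfun q (\<xi> (\<sigma> j) + \<xi> k) + vfun q (\<xi> (\<sigma> j) - \<xi> k)"]
  have 3: "(\<Sum>k\<in>{..<m} - {j}. vfun q (\<xi> (\<sigma> j) + \<xi> (\<sigma> k)) + vfun q (\<xi> (\<sigma> j) - \<xi> (\<sigma> k)))
     = (\<Sum>k\<in>{..<m} - {\<sigma> j}. vfun q (\<xi> (\<sigma> j) + \<xi> k) + vfun q (\<xi> (\<sigma> j) - \<xi> k))" .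
  have "(\<Sum>k\<in>{..<m} - {j}. vfun q (x j + x k) + vfun q (x j - x k))
     = \<epsilon> j * (\<Sum>k\<in>{..<m} - {\<sigma> j}. vfun q (\<xi> (\<sigma> j) + \<xi> k) + vfun q (\<xi> (\<sigma> j) - \<xi> k))"
    unfolding 3[symmetric] sum_distrib_left by (rule sum.cong) (auto simp: 1)
  then have "theta x j = \<epsilon> j * theta \<xi> (\<sigma> j)"
    unfolding theta_def 2 using assms(3) by (simp add: *(3) algebra_simps)
  moreover have "\<sigma> j < m" using permutes_in_image[OF *(1), of j] assms(3) by simp
  ultimately show ?thesis using that[of "\<sigma> j"] *(2)[OF assms(3)] by auto
qed

lemma cis_theta_orb:
  assumes "\<kappa> \<in> Lam m n" "x \<in> signed_orbit m (xi \<kappa>)" "j < m"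
  shows "cis (theta x j) = 1"
proof -
  obtain k where k: "k < m" "theta x j = theta (xi \<kappa>) k \<or> theta x j = - theta (xi \<kappa>) k"
    using theta_orb[OF assms(2) xi_Rm assms(3)] .
  have t: "theta (xi \<kappa>) k = 2 * pi * of_int (int (m - k) + \<kappa> ! k)"
    using theta_xi[OF k(1)] by (simp add: target_def)
  have "cis (2 * pi * of_int i) = 1" for i by (rule cis_multiple_2pi) simp
  then have "cis (theta (xi \<kappa>) k) = 1" unfolding t .
  then show ?thesis using k(2) by (auto simp: cis_cnj[symmetric])
qed

definition psi :: "int list \<Rightarrow> (nat \<Rightarrow> int) \<Rightarrow> complex" where
  "psi \<kappa> l = (\<Sum>x\<in>signed_orbit m (xi \<kappa>). plane_wave q (pp * qp) (pp + qp) m x l)"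

text \<open>In terms of characters, the coefficient at an orbit point of \<open>xi \<kappa>\<close>
  is \<open>c \<kappa>\<close> times the value of \<open>C\<close> there. One point of each orbit,
  with its nonzero \<open>C\<close>, is enough to conclude.\<close>

lemma psi_independent:
  assumes "\<And>l. (\<Sum>\<kappa>\<in>Lam m n. c \<kappa> * psi \<kappa> l) = 0" and "finite (Lam m n)" "\<kappa> \<in> Lam m n"
  shows "c \<kappa> = 0"
proof -
  let ?C = "Cfun q (pp * qp) (pp + qp) m"
  let ?I = "SIGMA \<kappa>:Lam m n. signed_orbit m (xi \<kappa>)"
  have I: "\<forall>i\<in>?I. c (fst i) * ?C (snd i) = 0"
  proof (rule char_independent)
    show "finite ?I" using assms(2) by (intro finite_SigmaI finite_signed_orbit)
    show "inj_on snd ?I"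
      by (rule inj_onI) (use signed_orbit_disjoint xi_alcove xi_inj in \<open>fastforce\<close>)
    show "snd i \<in> Rm m" if "i \<in> ?I" for i using that signed_orbit_Rm xi_Rm by auto
    show "\<bar>snd i j\<bar> < pi" if "i \<in> ?I" "j < m" for i j
      using that signed_orbit_alcove(1) xi_alcove by fastforce
    fix l
    show "(\<Sum>i\<in>?I. c (fst i) * ?C (snd i) * cis (\<Sum>j<m. snd i j * of_int (l j))) = 0"
      using assms(1)[of l] assms(2)
      by (simp add: psi_def plane_wave_def sum_distrib_left sum.Sigma finite_signed_orbit case_prod_beta mult.assoc)
  qed
  obtain x where x: "x \<in> signed_orbit m (xi \<kappa>)"
    using orbI[OF xi_Rm permutes_id, of "\<lambda>_. 1" "xi \<kappa>" \<kappa>] xi_Rm[of \<kappa>] by (auto simp: Rm_def)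
  then have "c \<kappa> * ?C x = 0" using I assms(3) by force
  then show ?thesis using Cfun_nonzero[OF x xi_alcove[OF assms(3)] pp qp q] by simp
qed

lemma wave_eq:
  "\<kappa> \<in> Lam m n \<Longrightarrow> wave q (pp * qp) (pp + qp) n m (xi \<kappa>) \<mu> = psi \<kappa> (\<lambda>j. conj_part n m \<mu> ! j)"
  by (simp add: wave_def psi_def HL_alcove xi_alcove)

end

section \<open>Functions satisfying exchange and reflection relations\<close>

text \<open>The relations are isolated from plane waves because they are linear in \<open>L\<close>:
  they are applied both to a single \<open>psi \<kappa>\<close> and to a linear combination that is
  to be shown zero.\<close>

locale boundary_relations =
  fixes L :: "(nat \<Rightarrow> int) \<Rightarrow> complex" and m n :: nat and q ap bp am bm :: complex
  assumes n: "1 \<le> n"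
    and swap: "\<And>l i a b. Suc i < m \<Longrightarrow> L (l(i := a, Suc i := b + 1)) - q * L (l(i := a + 1, Suc i := b))
       + (L (l(i := b, Suc i := a + 1)) - q * L (l(i := b + 1, Suc i := a))) = 0"
    and last: "\<And>l k s. m = Suc k \<Longrightarrow> L (l(k := s - 1)) - bp * L (l(k := s)) + ap * L (l(k := s + 1))
       + (L (l(k := - s - 1)) - bp * L (l(k := - s)) + ap * L (l(k := - s + 1))) = 0"
    and first: "\<And>l s. 0 < m \<Longrightarrow> L (l(0 := int n + s + 1)) - bm * L (l(0 := int n + s)) + am * L (l(0 := int n + s - 1))
       + (L (l(0 := int n - s + 1)) - bm * L (l(0 := int n - s)) + am * L (l(0 := int n - s - 1))) = 0"
begin

text \<open>At \<open>s = 0\<close> the two mirror images coincide, so the relation can be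
  halved.\<close>

lemma first0: "0 < m \<Longrightarrow> L (l(0 := int n + 1)) = bm * L (l(0 := int n)) - am * L (l(0 := int n - 1))"
proof -
  let ?X = "L (l(0 := int n + 1)) - bm * L (l(0 := int n)) + am * L (l(0 := int n - 1))"
  assume "0 < m"
  then have "?X + ?X = 0" using first[of l 0] by (simp only: add_0_right diff_zero)
  then have "?X = 0" by (metis mult_2 mult_eq_0_iff zero_neq_numeral)
  then show ?thesis by (simp add: algebra_simps)
qed

lemma last0: "m = Suc k \<Longrightarrow> L (l(k := - 1)) = bp * L (l(k := 0)) - ap * L (l(k := 1))"
proof -
  let ?X = "L (l(k := - 1)) - bp * L (l(k := 0)) + ap * L (l(k := 1))"
  assume "m = Suc k"
  then have "?X + ?X = 0" using last[of k l 0] by (simp only: add_0 diff_0 minus_zero)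
  then have "?X = 0" by (metis mult_2 mult_eq_0_iff zero_neq_numeral)
  then show ?thesis by (simp add: algebra_simps)
qed

text \<open>The weight \<open>height\<close> is a quadratic form, slightly perturbed by a linear one so that straightening
  steps that merely sort entries also decrease it.\<close>

definition entry_height :: "nat \<Rightarrow> int \<Rightarrow> int" where
  "entry_height j a = int m * (2 * a - int n)\<^sup>2 + int j * a"

definition height :: "(nat \<Rightarrow> int) \<Rightarrow> int" where
  "height l = (\<Sum>j<m. entry_height j (l j))"

text \<open>The only danger is the linear part at negative \<open>a\<close>. There
  \<open>- a\<close> is at most the square, and the factor \<open>m\<close> in front of the square
  exceeds \<open>j\<close>.\<close>

lemma entry_height_nonneg:
  assumes "j < m" shows "0 \<le> entry_height j a"
proof (cases "0 \<le> a")
  case False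
  have "- a \<le> (2 * a - int n)\<^sup>2"
  proof -
    have "\<bar>2 * a - int n\<bar> * 1 \<le> \<bar>2 * a - int n\<bar> * \<bar>2 * a - int n\<bar>"
      by (rule mult_left_mono) (use False in auto)
    then have "\<bar>2 * a - int n\<bar> \<le> (2 * a - int n)\<^sup>2" by (simp add: power2_eq_square flip: abs_mult)
    then show ?thesis using False by linarith
  qed
  then have "int m * (- a) \<le> int m * (2 * a - int n)\<^sup>2" by (intro mult_left_mono) auto
  moreover have "int j * (- a) \<le> int m * (- a)" using assms False by (intro mult_right_mono) auto
  ultimately show ?thesis by (simp add: entry_height_def)
qed (simp add: entry_height_def)

lemma height_nonneg: "0 \<le> height l"
  unfolding height_def by (intro sum_nonneg entry_height_nonneg) auto

lemma height_upd: "i < m \<Longrightarrow> height (l(i := a)) = height l - entry_height i (l i) + entry_height i a"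
proof -
  assume i: "i < m"
  have "(\<Sum>j\<in>{..<m} - {i}. entry_height j ((l(i := a)) j)) = (\<Sum>j\<in>{..<m} - {i}. entry_height j (l j))"
    by (rule sum.cong) auto
  with i show ?thesis
    by (simp add: height_def sum.remove[of "{..<m}" i])
qed

lemma height_upd2: "Suc i < m \<Longrightarrow>
  height (l(i := a, Suc i := b)) = height l - entry_height i (l i) - entry_height (Suc i) (l (Suc i)) + entry_height i a + entry_height (Suc i) b"
  by (simp add: height_upd)

lemma height_nat_less: "height l' < height l \<Longrightarrow> nat (height l') < nat (height l)"
  using height_nonneg[of l'] by linarith

text \<open>\<open>2 * s + 2 + int n\<close> is the common value of
  \<open>\<bar>2 * a - int n\<bar>\<close> at the outermost points \<open>int n + s + 1\<close> and
  \<open>- s - 1\<close> of the two reflection relations.\<close>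

lemma square_diff: "(2 * s + 2 + int n)\<^sup>2 - (2 * a - int n)\<^sup>2 = 4 * ((s + 1 + int n - a) * (s + 1 + a))"
  by (simp add: power2_eq_square algebra_simps)

text \<open>Outside the box or off the decreasing vectors, some relation contains \<open>l\<close>
  with coefficient \<open>1\<close>, and every other point in it either has smaller height or is
  \<open>l\<close> again.\<close>

lemma vanishing:
  assumes dom: "\<And>l. (\<And>j. j < m \<Longrightarrow> 0 \<le> l j \<and> l j \<le> int n) \<Longrightarrow> (\<And>j. Suc j < m \<Longrightarrow> l (Suc j) \<le> l j) \<Longrightarrow> L l = 0"
  shows "L l = 0"
proof (induction "nat (height l)" arbitrary: l rule: less_induct)
  case less
  have IH: "L l' = 0" if "height l' < height l" for l'
    using less that height_nat_less by blast
  show ?case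
  proof (cases "\<exists>i. Suc i < m \<and> l i < l (Suc i)")
    case True
    then obtain i where i: "Suc i < m" "l i < l (Suc i)" by blast
    define a b where "a = l i" and "b = l (Suc i) - 1"
    have ab: "a \<le> b" "l i = a" "l (Suc i) = b + 1" using i by (auto simp: a_def b_def)
    have l: "l(i := a, Suc i := b + 1) = l" using ab by (auto simp: fun_eq_iff)
    have h: "height (l(i := c, Suc i := d)) - height l
       = int m * ((2 * c - int n)\<^sup>2 + (2 * d - int n)\<^sup>2 - (2 * a - int n)\<^sup>2 - (2 * (b + 1) - int n)\<^sup>2)
         + (int i * (c + d - a - b - 1) + (d - b - 1))" for c d
      by (simp add: height_upd2[OF i(1)] ab entry_height_def algebra_simps)
    have 1: "height (l(i := a + 1, Suc i := b)) - height l = - (8 * (int m * (b - a)) + 1)"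
      unfolding h by (simp add: power2_eq_square algebra_simps)
    have 2: "height (l(i := b, Suc i := a + 1)) - height l = - (8 * (int m * (b - a)) + (b - a))"
      unfolding h by (simp add: power2_eq_square algebra_simps)
    \<comment> \<open>Here the two entries are merely sorted. The squares do not notice, and the
      drop comes from the linear part alone, as the larger value moves to the smaller index.\<close>
    have 3: "height (l(i := b + 1, Suc i := a)) - height l = - (b - a + 1)"
      unfolding h by (simp add: power2_eq_square algebra_simps)
    have nn: "0 \<le> int m * (b - a)" using ab by simp
    have L1: "L (l(i := a + 1, Suc i := b)) = 0" by (rule IH) (use 1 nn in linarith)
    have L3: "L (l(i := b + 1, Suc i := a)) = 0" by (rule IH) (use 3 ab in linarith)
    have rel: "L l + L (l(i := b, Suc i := a + 1)) = 0"
      using swap[OF i(1), of l a b] L1 L3 l by simp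
    show ?thesis
    \<comment> \<open>For neighbouring values the remaining point is \<open>l\<close> itself, where
      induction would be circular; the relation then says that twice \<open>L l\<close> is
      zero.\<close>
    proof (cases "a = b")
      case True
      then show ?thesis using rel l by simp
    next
      case False
      have "L (l(i := b, Suc i := a + 1)) = 0" by (rule IH) (use 2 nn ab False in linarith)
      then show ?thesis using rel by simp
    qed
  next
    case False
    then have dec: "l (Suc j) \<le> l j" if "Suc j < m" for j using that by (meson not_le)
    have anti: "l j \<le> l i" if "i \<le> j" "j < m" for i j
      using that by (induction j rule: dec_induct) (auto intro: order_trans[OF dec])
    \<comment> \<open>For a decreasing vector it suffices to look at the first entry for the upper
      wall and at the last one for the lower wall.\<close>
    consider "0 < m" "l 0 > int n" | k where "m = Suc k" "l k < 0" | "\<forall>j<m. 0 \<le> l j \<and> l j \<le> int n"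
    proof (cases m)
      case (Suc k)
      have "l k \<le> l j \<and> l j \<le> l 0" if "j < m" for j using anti[of j k] anti[of 0 j] that Suc by auto
      then show ?thesis using that Suc by force
    qed (use that in auto)
    then show ?thesis
    proof cases
      case 1
      define s where "s = l 0 - int n - 1"
      have s: "0 \<le> s" "l 0 = int n + s + 1" using 1 by (auto simp: s_def)
      have l: "l(0 := int n + s + 1) = l" using s by (auto simp: fun_eq_iff)
      have Z: "L (l(0 := a)) = 0" if "int n - s - 1 \<le> a" "a \<le> int n + s" for a
      proof (rule IH)
        \<comment> \<open>At index \<open>0\<close> the height has no linear part, so the squares
          decide. At the far end \<open>a = int n - s - 1\<close> the second factor is
          \<open>int n\<close>, which is where \<open>1 \<le> n\<close> enters.\<close>
        have "0 < (s + 1 + int n - a) * (s + 1 + a)" using that s n by (intro mult_pos_pos) auto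
        then have "(2 * a - int n)\<^sup>2 < (2 * s + 2 + int n)\<^sup>2" using square_diff[of s a] by linarith
        then have "int m * (2 * a - int n)\<^sup>2 < int m * (2 * s + 2 + int n)\<^sup>2" using 1 by simp
        moreover have e: "2 * l 0 - int n = 2 * s + 2 + int n" using s by simp
        have "entry_height 0 (l 0) = int m * (2 * s + 2 + int n)\<^sup>2" unfolding entry_height_def e by simp
        moreover have "entry_height 0 a = int m * (2 * a - int n)\<^sup>2" unfolding entry_height_def by simp
        ultimately show "height (l(0 := a)) < height l"
          unfolding height_upd[OF 1(1)] by linarith
      qed
      show ?thesis
      \<comment> \<open>For \<open>s = 0\<close> the point \<open>l\<close> occurs twice in the
        relation, hence the halved form.\<close>
      proof (cases "s = 0")
        case True
        have "L (l(0 := int n)) = 0" "L (l(0 := int n - 1)) = 0" by (intro Z; use True in simp)+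
        moreover have "L l = L (l(0 := int n + 1))" using l True by simp
        ultimately show ?thesis unfolding first0[OF 1(1)] by simp
      next
        case False
        then have "L (l(0 := int n + s)) = 0" "L (l(0 := int n + s - 1)) = 0" "L (l(0 := int n - s + 1)) = 0"
          "L (l(0 := int n - s)) = 0" "L (l(0 := int n - s - 1)) = 0"
          using s(1) by (intro Z; simp)+
        then show ?thesis using first[OF 1(1), of l s] unfolding l by simp
      qed
    next
      case (2 k)
      define s where "s = - l k - 1"
      have s: "0 \<le> s" "l k = - s - 1" using 2 by (auto simp: s_def)
      have l: "l(k := - s - 1) = l" using s by (auto simp: fun_eq_iff)
      have Z: "L (l(k := a)) = 0" if "- s \<le> a" "a \<le> s + 1" for a
      proof (rule IH)
        let ?t = "s + 1 + a"
        have t: "0 < ?t" using that by simp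
        have "1 * ?t \<le> (s + 1 + int n - a) * ?t" by (rule mult_right_mono) (use that n t in auto)
        then have "4 * ?t \<le> (2 * s + 2 + int n)\<^sup>2 - (2 * a - int n)\<^sup>2" unfolding square_diff by simp
        then have "int m * (4 * ?t) \<le> int m * ((2 * s + 2 + int n)\<^sup>2 - (2 * a - int n)\<^sup>2)"
          by (intro mult_left_mono) auto
        \<comment> \<open>At the last index the linear part works in the wrong direction: raising
          the entry from \<open>- s - 1\<close> to \<open>a\<close> adds \<open>int k * ?t\<close>.
          The coefficient \<open>m > k\<close> of the square outweighs it.\<close>
        moreover have "int k * ?t < int m * (4 * ?t)"
        proof -
          have "int k * ?t < int m * ?t" using 2 t by (intro mult_strict_right_mono) auto
          also have "int m * ?t \<le> int m * (4 * ?t)" using t by (intro mult_left_mono) auto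
          finally show ?thesis .
        qed
        ultimately have lt: "int k * ?t < int m * ((2 * s + 2 + int n)\<^sup>2 - (2 * a - int n)\<^sup>2)"
          by (rule less_le_trans[rotated])
        have e: "2 * l k - int n = - (2 * s + 2 + int n)" using s by simp
        have "entry_height k (l k) = int m * (2 * s + 2 + int n)\<^sup>2 - int k * (s + 1)"
          unfolding entry_height_def e power2_minus unfolding s(2) by (simp add: algebra_simps)
        then have gg: "entry_height k a - entry_height k (l k) = int k * ?t - int m * ((2 * s + 2 + int n)\<^sup>2 - (2 * a - int n)\<^sup>2)"
          unfolding entry_height_def by (simp add: algebra_simps)
        have "entry_height k a - entry_height k (l k) < 0" unfolding gg using lt by simp
        then show "height (l(k := a)) < height l"
          using height_upd[of k l a] 2 by simp
      qed
      show ?thesis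
      proof (cases "s = 0")
        case True
        have "L (l(k := 0)) = 0" "L (l(k := 1)) = 0" by (intro Z; use True in simp)+
        moreover have "L l = L (l(k := - 1))" using l True by simp
        ultimately show ?thesis unfolding last0[OF 2(1)] by simp
      next
        case False
        then have "L (l(k := s - 1)) = 0" "L (l(k := s)) = 0" "L (l(k := s + 1)) = 0"
          "L (l(k := - s)) = 0" "L (l(k := - s + 1)) = 0"
          using s(1) by (intro Z; simp)+
        then show ?thesis using last[OF 2(1), of l s] unfolding l by simp
      qed
    next
      case 3
      then show ?thesis using dom dec by blast
    qed
  qed
qed

section \<open>Reduction of the free Laplacian at a partition in the box\<close>

lemma swap_up:
  assumes "Suc j < m" "l j = i" "l (Suc j) = i"
  shows "L (l(Suc j := i + 1)) = q * L (l(j := i + 1))"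
proof -
  have "l(j := i, Suc j := i + 1) = l(Suc j := i + 1)" "l(j := i + 1, Suc j := i) = l(j := i + 1)"
    using assms by (auto simp: fun_eq_iff)
  with swap[OF assms(1), of l i i] show ?thesis by simp
qed

lemma swap_down:
  assumes "Suc j < m" "l j = i" "l (Suc j) = i"
  shows "L (l(j := i - 1)) = q * L (l(Suc j := i - 1))"
proof -
  have "l(j := i - 1, Suc j := i) = l(j := i - 1)" "l(j := i, Suc j := i - 1) = l(Suc j := i - 1)"
    using assms by (auto simp: fun_eq_iff)
  with swap[OF assms(1), of l "i - 1" "i - 1"] show ?thesis by simp
qed

text \<open>Within a run of equal entries only raising the first one keeps the vector decreasing.
  Each exchange step towards the front costs a factor \<open>q\<close>, and summed over the run
  these powers form the coefficient \<open>1 - q ^ (r - p)\<close> of the Hamiltonian.\<close>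

lemma block_up:
  assumes "\<And>j. p \<le> j \<Longrightarrow> j < r \<Longrightarrow> l j = i" "r \<le> m" "p \<le> j" "j < r"
  shows "L (l(j := i + 1)) = q ^ (j - p) * L (l(p := i + 1))"
  using assms(3,4)
proof (induction j rule: dec_induct)
  case (step k)
  have "L (l(Suc k := i + 1)) = q * L (l(k := i + 1))"
    by (rule swap_up) (use assms(1)[of k] assms(1)[of "Suc k"] assms(2) step in auto)
  also have "L (l(k := i + 1)) = q ^ (k - p) * L (l(p := i + 1))"
    by (rule step.IH) (use step in auto)
  also have "q * (q ^ (k - p) * L (l(p := i + 1))) = q ^ (Suc k - p) * L (l(p := i + 1))"
    unfolding Suc_diff_le[OF step.hyps(1)] by (simp only: power_Suc mult.assoc)
  finally show ?case .
qed simp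

lemma block_down:
  assumes "\<And>j. p \<le> j \<Longrightarrow> j \<le> r \<Longrightarrow> l j = i" "r < m" "p \<le> j" "j \<le> r"
  shows "L (l(j := i - 1)) = q ^ (r - j) * L (l(r := i - 1))"
  using assms(4,3)
proof (induction j rule: inc_induct)
  case (step k)
  have "L (l(k := i - 1)) = q * L (l(Suc k := i - 1))"
    by (rule swap_down) (use assms(1)[of k] assms(1)[of "Suc k"] assms(2) step in auto)
  also have "L (l(Suc k := i - 1)) = q ^ (r - Suc k) * L (l(r := i - 1))"
    by (rule step.IH) (use step in auto)
  also have "q * (q ^ (r - Suc k) * L (l(r := i - 1))) = q ^ (r - k) * L (l(r := i - 1))"
    unfolding Suc_diff_Suc[OF step.hyps(2), symmetric] by (simp only: power_Suc mult.assoc)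
  finally show ?case .
qed simp

lemma geometric: "(1 - q) * (\<Sum>j\<in>{p..<r}. q ^ (j - p)) = 1 - q ^ (r - p)"
proof -
  have "(\<Sum>j\<in>{p..<r}. q ^ (j - p)) = (\<Sum>j<r - p. q ^ j)"
    by (rule sum.reindex_bij_witness[where i = "\<lambda>j. j + p" and j = "\<lambda>j. j - p"]) auto
  then show ?thesis by (simp add: one_diff_power_eq)
qed

lemma geometric_rev: "(1 - q) * (\<Sum>j\<in>{p..<r}. q ^ (r - 1 - j)) = 1 - q ^ (r - p)"
proof -
  have "(\<Sum>j\<in>{p..<r}. q ^ (r - 1 - j)) = (\<Sum>j<r - p. q ^ j)"
    by (rule sum.reindex_bij_witness[where i = "\<lambda>j. r - 1 - j" and j = "\<lambda>j. r - 1 - j"]) auto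
  then show ?thesis by (simp add: one_diff_power_eq)
qed

lemma block_up_sum:
  assumes "\<And>j. p \<le> j \<Longrightarrow> j < r \<Longrightarrow> l j = i" "r \<le> m"
  shows "(1 - q) * (\<Sum>j\<in>{p..<r}. L (l(j := l j + 1))) = (1 - q ^ (r - p)) * L (l(p := i + 1))"
proof -
  have "(\<Sum>j\<in>{p..<r}. L (l(j := l j + 1))) = (\<Sum>j\<in>{p..<r}. q ^ (j - p) * L (l(p := i + 1)))"
  proof (rule sum.cong)
    fix j assume j: "j \<in> {p..<r}"
    have "l j = i" using j by (intro assms(1)) auto
    moreover have "L (l(j := i + 1)) = q ^ (j - p) * L (l(p := i + 1))"
      by (rule block_up[OF assms]) (use j in auto)
    ultimately show "L (l(j := l j + 1)) = q ^ (j - p) * L (l(p := i + 1))" by simp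
  qed simp
  then show ?thesis
    by (simp only: sum_distrib_right[symmetric] mult.assoc[symmetric] geometric)
qed

lemma block_down_sum:
  assumes "\<And>j. p \<le> j \<Longrightarrow> j < r \<Longrightarrow> l j = i" "r \<le> m"
  shows "(1 - q) * (\<Sum>j\<in>{p..<r}. L (l(j := l j - 1))) = (1 - q ^ (r - p)) * L (l(r - 1 := i - 1))"
proof -
  have "(\<Sum>j\<in>{p..<r}. L (l(j := l j - 1))) = (\<Sum>j\<in>{p..<r}. q ^ (r - 1 - j) * L (l(r - 1 := i - 1)))"
  proof (rule sum.cong)
    fix j assume j: "j \<in> {p..<r}"
    have "l j = i" using j by (intro assms(1)) auto
    moreover have "L (l(j := i - 1)) = q ^ (r - 1 - j) * L (l(r - 1 := i - 1))"
      by (rule block_down[where p = p]) (use j assms(2) in \<open>auto intro: assms(1)\<close>)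
    ultimately show "L (l(j := l j - 1)) = q ^ (r - 1 - j) * L (l(r - 1 := i - 1))" by simp
  qed simp
  then show ?thesis
    by (simp only: sum_distrib_right[symmetric] mult.assoc[symmetric] geometric_rev)
qed

lemma sum_blocks:
  fixes f :: "nat \<Rightarrow> complex" and M :: "nat \<Rightarrow> nat"
  assumes "\<And>i. i < N \<Longrightarrow> M (Suc i) \<le> M i"
  shows "(\<Sum>j<M 0. f j) = (\<Sum>i<N. \<Sum>j\<in>{M (Suc i)..<M i}. f j) + (\<Sum>j<M N. f j)"
  using assms
proof (induction N)
  case (Suc N)
  have "{..<M N} = {..<M (Suc N)} \<union> {M (Suc N)..<M N}" using Suc.prems[of N] by auto
  then have "(\<Sum>j<M N. f j) = (\<Sum>j<M (Suc N). f j) + (\<Sum>j\<in>{M (Suc N)..<M N}. f j)"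
    by (simp add: sum.union_disjoint ivl_disj_int)
  with Suc show ?case by simp
qed simp

text \<open>\<open>M i\<close> stands for the \<open>i\<close>-th part of the conjugate partition:
  the positions with value \<open>i\<close> form the interval from \<open>M (Suc i)\<close> to
  \<open>M i\<close>. Each run yields one upward and one downward neighbour. Only raising a value
  \<open>n\<close> and lowering a value \<open>0\<close> leave the box, and the wall relations
  convert these two moves into the diagonal term and the corrections with \<open>am\<close> and
  \<open>ap\<close>.\<close>

lemma laplacian_eq:
  fixes M :: "nat \<Rightarrow> nat"
  assumes M: "M 0 = m" "M (Suc n) = 0" "\<And>i. i \<le> n \<Longrightarrow> M (Suc i) \<le> M i"
    and l: "\<And>i j. i \<le> n \<Longrightarrow> M (Suc i) \<le> j \<Longrightarrow> j < M i \<Longrightarrow> l j = int i"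
  shows "(1 - q) * (\<Sum>j<m. L (l(j := l j + 1)) + L (l(j := l j - 1)))
    = (bp * (1 - q ^ (m - M 1)) + bm * (1 - q ^ M n)) * L l
    + (\<Sum>i\<in>{1..n}. (if i = 1 then 1 - ap * q ^ (m - M 1 - 1) else 1) * (1 - q ^ (M (i - 1) - M i)) * L (l(M i := int i)))
    + (\<Sum>i\<in>{1..n}. (if i = n then 1 - am * q ^ (M n - 1) else 1) * (1 - q ^ (M i - M (Suc i))) * L (l(M i - 1 := int i - 1)))"
proof -
  have le: "M i \<le> m" if "i \<le> Suc n" for i
    using that M(1) by (induction i) (auto intro: order_trans[OF M(3)])
  have blocks: "(\<Sum>j<m. f j) = (\<Sum>i\<le>n. \<Sum>j\<in>{M (Suc i)..<M i}. f j)" for f :: "nat \<Rightarrow> complex"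
    using sum_blocks[of "Suc n" M f] M by (simp add: lessThan_Suc_atMost)
  define U where "U = (\<lambda>i. (1 - q ^ (M i - M (Suc i))) * L (l(M (Suc i) := int i + 1)))"
  define D where "D = (\<lambda>i. (1 - q ^ (M i - M (Suc i))) * L (l(M i - 1 := int i - 1)))"
  have up: "(1 - q) * (\<Sum>j<m. L (l(j := l j + 1))) = (\<Sum>i\<le>n. U i)"
    unfolding blocks U_def
    by (rule trans[OF sum_distrib_left sum.cong[OF refl]], rule block_up_sum) (use l le in auto)
  have down: "(1 - q) * (\<Sum>j<m. L (l(j := l j - 1))) = (\<Sum>i\<le>n. D i)"
    unfolding blocks D_def
    by (rule trans[OF sum_distrib_left sum.cong[OF refl]], rule block_down_sum) (use l le in auto)
  \<comment> \<open>The wall relation trades raising the first entry for lowering it. Moving that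
    lowering to the end of the run costs \<open>q ^ (M n - 1)\<close> and gives a multiple of
    \<open>D n\<close>. An empty run is harmless, its coefficient being zero.\<close>
  have Un: "U n = bm * (1 - q ^ M n) * L l - am * q ^ (M n - 1) * D n"
  proof (cases "M n = 0")
    case False
    then have 0: "0 < m" using le[of n] by simp
    have ln: "l j = int n" if "j < M n" for j using l[of n j] that M by simp
    have "l(0 := int n) = l" using ln[of 0] False by (simp add: fun_eq_iff)
    then have "L (l(0 := int n + 1)) = bm * L l - am * L (l(0 := int n - 1))"
      using first0[OF 0, of l] by simp
    also have "L (l(0 := int n - 1)) = q ^ (M n - 1) * L (l(M n - 1 := int n - 1))"
      using block_down[of 0 "M n - 1" l "int n" 0] ln le[of n] False by simp
    finally have X: "L (l(0 := int n + 1)) = bm * L l - am * (q ^ (M n - 1) * L (l(M n - 1 := int n - 1)))" .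
    show ?thesis unfolding U_def D_def M diff_zero X by (simp add: algebra_simps)
  qed (simp add: U_def D_def M)
  have D0: "D 0 = bp * (1 - q ^ (m - M 1)) * L l - ap * q ^ (m - M 1 - 1) * U 0"
  proof (cases "M 1 < m")
    case True
    then obtain k where k: "m = Suc k" by (cases m) auto
    with True have "M 1 \<le> k" by simp
    have ln: "l j = 0" if "M 1 \<le> j" "j < m" for j using l[of 0 j] that M by simp
    have "l(k := 0) = l" using ln[of k] k \<open>M 1 \<le> k\<close> by (simp add: fun_eq_iff)
    then have "L (l(k := - 1)) = bp * L l - ap * L (l(k := 1))"
      using last0[OF k, of l] by simp
    also have "L (l(k := 1)) = q ^ (k - M 1) * L (l(M 1 := 1))"
      using block_up[of "M 1" m l 0 k] ln k \<open>M 1 \<le> k\<close> by simp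
    finally have X: "L (l(k := - 1)) = bp * L l - ap * (q ^ (k - M 1) * L (l(M 1 := 1)))" .
    have e: "m - 1 = k" "m - M 1 - 1 = k - M 1" "int 0 - 1 = - 1" "int 0 + 1 = 1" using k by auto
    show ?thesis unfolding U_def D_def One_nat_def[symmetric] M e X by (simp add: algebra_simps)
  qed (use le[of 1] M in \<open>simp add: U_def D_def\<close>)
  obtain n' where n': "n = Suc n'" using n by (cases n) auto
  \<comment> \<open>Raising a value \<open>i\<close> to \<open>i + 1\<close> adds a box to part
    \<open>i + 1\<close> of the conjugate, hence the index shift between \<open>U\<close> and the
    Hamiltonian.\<close>
  have U: "(\<Sum>i\<in>{1..n}. (if i = 1 then 1 - ap * q ^ (m - M 1 - 1) else 1) * (1 - q ^ (M (i - 1) - M i)) * L (l(M i := int i)))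
      = (\<Sum>i<n. U i) - ap * q ^ (m - M 1 - 1) * U 0"
  proof -
    have "(\<Sum>i\<in>{1..n}. (if i = 1 then 1 - ap * q ^ (m - M 1 - 1) else 1) * (1 - q ^ (M (i - 1) - M i)) * L (l(M i := int i)))
      = (\<Sum>i<n. (if i = 0 then 1 - ap * q ^ (m - M 1 - 1) else 1) * U i)"
      by (rule sum.reindex_bij_witness[where i = Suc and j = "\<lambda>i. i - 1"])
         (auto simp: U_def of_nat_diff algebra_simps)
    also have "\<dots> = (\<Sum>i<n. U i) - ap * q ^ (m - M 1 - 1) * U 0"
      unfolding n' sum.lessThan_Suc_shift by (simp add: algebra_simps)
    finally show ?thesis .
  qed
  have Dn: "(\<Sum>i\<in>{1..n}. (if i = n then 1 - am * q ^ (M n - 1) else 1) * (1 - q ^ (M i - M (Suc i))) * L (l(M i - 1 := int i - 1)))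
      = (\<Sum>i\<in>{1..n}. D i) - am * q ^ (M n - 1) * D n"
  proof -
    have "(\<Sum>i\<in>{1..n}. (if i = n then 1 - am * q ^ (M n - 1) else 1) * (1 - q ^ (M i - M (Suc i))) * L (l(M i - 1 := int i - 1)))
      = (\<Sum>i\<in>{1..n}. (if i = n then 1 - am * q ^ (M n - 1) else 1) * D i)"
      by (rule sum.cong) (auto simp: D_def)
    also have "\<dots> = (\<Sum>i\<in>{1..n}. D i) - am * q ^ (M n - 1) * D n"
      unfolding n' sum.atLeast1_atMost_eq sum.lessThan_Suc by (simp add: algebra_simps)
    finally show ?thesis .
  qed
  have SU: "(\<Sum>i\<le>n. U i) = (\<Sum>i<n. U i) + U n" by (simp add: lessThan_Suc_atMost[symmetric])
  have SD: "(\<Sum>i\<le>n. D i) = D 0 + (\<Sum>i\<in>{1..n}. D i)"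
    by (simp add: sum.atMost_shift sum.atLeast1_atMost_eq)
  show ?thesis
    unfolding U Dn sum.distrib distrib_left up down SU SD Un D0 by (simp add: algebra_simps)
qed

end

section \<open>Conjugate partitions\<close>

lemma part_at_0 [simp]: "part_at m \<mu> 0 = int m"
  and part_at_Suc: "i < length \<mu> \<Longrightarrow> part_at m \<mu> (Suc i) = \<mu> ! i"
  and part_at_beyond: "length \<mu> < i \<Longrightarrow> part_at m \<mu> i = 0"
  by (simp_all add: part_at_def)

text \<open>With the conventions for the parts \<open>0\<close> and \<open>n + 1\<close>, the
  ordering and both bounds merge into one chain of inequalities, which removes all boundary cases
  later on.\<close>

lemma Lam_iff:
  "\<mu> \<in> Lam n m \<longleftrightarrow> length \<mu> = n \<and> (\<forall>i\<le>n. part_at m \<mu> (Suc i) \<le> part_at m \<mu> i)"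
proof
  assume \<mu>: "\<mu> \<in> Lam n m"
  then have len: "length \<mu> = n" and dec: "\<And>i j. i < j \<Longrightarrow> j < n \<Longrightarrow> \<mu> ! j \<le> \<mu> ! i"
    and bd: "\<And>i. i < n \<Longrightarrow> 0 \<le> \<mu> ! i \<and> \<mu> ! i \<le> int m"
    by (auto simp: Lam_def sorted_wrt_iff_nth_less)
  have "part_at m \<mu> (Suc i) \<le> part_at m \<mu> i" if "i \<le> n" for i
  proof (cases i)
    case 0
    then show ?thesis using bd[of 0] by (cases "n = 0") (auto simp: part_at_def len)
  next
    case (Suc k)
    then show ?thesis using that dec[of k "Suc k"] bd[of k] by (auto simp: part_at_def len)
  qed
  with len show "length \<mu> = n \<and> (\<forall>i\<le>n. part_at m \<mu> (Suc i) \<le> part_at m \<mu> i)" by blast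
next
  assume h: "length \<mu> = n \<and> (\<forall>i\<le>n. part_at m \<mu> (Suc i) \<le> part_at m \<mu> i)"
  then have len: "length \<mu> = n" by blast
  have anti: "part_at m \<mu> j \<le> part_at m \<mu> i" if "i \<le> j" "j \<le> Suc n" for i j
    using that by (induction j rule: dec_induct) (use h in \<open>auto intro: order_trans\<close>)
  have "\<mu> ! j \<le> \<mu> ! i" if "i < j" "j < n" for i j
    using anti[of "Suc i" "Suc j"] that by (simp add: part_at_Suc len)
  moreover have "0 \<le> \<mu> ! i \<and> \<mu> ! i \<le> int m" if "i < n" for i
    using anti[of "Suc i" "Suc n"] anti[of 0 "Suc i"] that by (simp add: part_at_Suc part_at_beyond len)
  ultimately show "\<mu> \<in> Lam n m"
    using len by (auto simp: Lam_def sorted_wrt_iff_nth_less in_set_conv_nth)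
qed

lemma part_at_antimono:
  assumes "\<mu> \<in> Lam n m" "i \<le> j"
  shows "part_at m \<mu> j \<le> part_at m \<mu> i"
  using assms(2)
proof (induction j rule: dec_induct)
  case (step k)
  have "part_at m \<mu> (Suc k) \<le> part_at m \<mu> k"
    using assms(1) by (cases "k \<le> n") (auto simp: Lam_iff part_at_beyond)
  with step show ?case by simp
qed simp

lemma part_at_bounds:
  assumes "\<mu> \<in> Lam n m"
  shows "0 \<le> part_at m \<mu> i" "part_at m \<mu> i \<le> int m"
  using part_at_antimono[OF assms, of i "i + Suc n"] part_at_antimono[OF assms, of 0 i] assms
  by (auto simp: Lam_iff part_at_beyond)

lemma finite_Lam: "finite (Lam n m)"
proof (rule finite_subset)
  show "Lam n m \<subseteq> {xs. set xs \<subseteq> {0..int m} \<and> length xs = n}" by (auto simp: Lam_def)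
qed (rule finite_lists_length_eq, simp)

text \<open>Column lengths of the Young diagram, columns counted from \<open>0\<close>: an explicit
  description to replace the \<open>THE\<close> in \<open>conj_part\<close>.\<close>

definition conj_list :: "nat \<Rightarrow> nat \<Rightarrow> int list \<Rightarrow> int list" where
  "conj_list n m \<mu> = map (\<lambda>j. int (card {i \<in> {1..n}. int j < part_at m \<mu> i})) [0..<m]"

lemma length_conj_list [simp]: "length (conj_list n m \<mu>) = m"
  by (simp add: conj_list_def)

text \<open>Both sides say that the box in row \<open>i\<close> and column \<open>j\<close> belongs
  to the diagram. The range of \<open>i\<close> includes the conventional rows \<open>0\<close> and
  \<open>n + 1\<close>, so that the criterion can be used at \<open>i\<close> and
  \<open>Suc i\<close> together to locate the entries equal to \<open>i\<close>.\<close>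

lemma conj_list_ge_iff:
  assumes \<mu>: "\<mu> \<in> Lam n m" and j: "j < m" and i: "i \<le> Suc n"
  shows "int i \<le> conj_list n m \<mu> ! j \<longleftrightarrow> int j < part_at m \<mu> i"
proof -
  let ?S = "{i \<in> {1..n}. int j < part_at m \<mu> i}"
  have nth: "conj_list n m \<mu> ! j = int (card ?S)" using j by (simp add: conj_list_def)
  show ?thesis
  proof (cases "int j < part_at m \<mu> i")
    case True
    then have "i \<noteq> Suc n" using \<mu> by (auto simp: part_at_beyond Lam_def)
    have "{1..i} \<subseteq> ?S"
    proof
      fix k assume "k \<in> {1..i}"
      then show "k \<in> ?S" using part_at_antimono[OF \<mu>, of k i] True i \<open>i \<noteq> Suc n\<close> by auto
    qed
    then have "card {1..i} \<le> card ?S" by (intro card_mono) auto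
    with True nth show ?thesis by simp
  next
    case False
    have "?S \<subseteq> {1..<i}"
    proof
      fix k assume k: "k \<in> ?S"
      then have "\<not> i \<le> k" using part_at_antimono[OF \<mu>, of i k] False by auto
      with k show "k \<in> {1..<i}" by auto
    qed
    then have "card ?S \<le> card {1..<i}" by (intro card_mono) auto
    moreover have "i \<noteq> 0" using False j by (intro notI) simp
    ultimately show ?thesis using False nth by simp
  qed
qed

lemma conj_list_nth_bounds:
  assumes "j < m"
  shows "0 \<le> conj_list n m \<mu> ! j" "conj_list n m \<mu> ! j \<le> int n"
proof -
  have "card {i \<in> {1..n}. int j < part_at m \<mu> i} \<le> card {1..n}" by (intro card_mono) auto
  then show "0 \<le> conj_list n m \<mu> ! j" "conj_list n m \<mu> ! j \<le> int n" using assms by (simp_all add: conj_list_def)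
qed

lemma conj_list_nth_eqI:
  assumes "\<mu> \<in> Lam n m" "j < m" "0 \<le> v" "v \<le> int n"
    and "\<And>i. 1 \<le> i \<Longrightarrow> i \<le> n \<Longrightarrow> int i \<le> v \<longleftrightarrow> int j < part_at m \<mu> i"
  shows "conj_list n m \<mu> ! j = v"
proof (rule antisym)
  have *: "int i \<le> conj_list n m \<mu> ! j \<longleftrightarrow> int i \<le> v" if "1 \<le> i" "i \<le> n" for i
    using conj_list_ge_iff[OF assms(1,2), of i] assms(5)[of i] that by simp
  show "v \<le> conj_list n m \<mu> ! j"
    using *[of "nat v"] assms(3,4) conj_list_nth_bounds(1)[OF assms(2), of n \<mu>] by (cases "v = 0") auto
  show "conj_list n m \<mu> ! j \<le> v"
    using *[of "nat (conj_list n m \<mu> ! j)"] assms(3,4) conj_list_nth_bounds[OF assms(2), of n \<mu>]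
    by (cases "conj_list n m \<mu> ! j = 0") auto
qed

lemma conj_list_in_Lam:
  assumes "\<mu> \<in> Lam n m" shows "conj_list n m \<mu> \<in> Lam m n"
proof -
  have "conj_list n m \<mu> ! j \<le> conj_list n m \<mu> ! i" if "i < j" "j < m" for i j
  proof -
    have "card {k \<in> {1..n}. int j < part_at m \<mu> k} \<le> card {k \<in> {1..n}. int i < part_at m \<mu> k}"
      using that by (intro card_mono) auto
    then show ?thesis using that by (simp add: conj_list_def)
  qed
  then show ?thesis
    using conj_list_nth_bounds[of _ m n \<mu>] by (auto simp: Lam_def sorted_wrt_iff_nth_less in_set_conv_nth)
qed

lemma conj_list_involution:
  assumes "\<mu> \<in> Lam n m" shows "conj_list m n (conj_list n m \<mu>) = \<mu>"
proof (rule nth_equalityI)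
  show "length (conj_list m n (conj_list n m \<mu>)) = length \<mu>" using assms by (simp add: Lam_def)
  fix i assume "i < length (conj_list m n (conj_list n m \<mu>))"
  then have i: "i < n" by simp
  have len: "length \<mu> = n" using assms by (simp add: Lam_def)
  have b: "0 \<le> \<mu> ! i" "\<mu> ! i \<le> int m"
    using part_at_bounds[OF assms, of "Suc i"] i by (simp_all add: part_at_Suc len)
  show "conj_list m n (conj_list n m \<mu>) ! i = \<mu> ! i"
  proof (rule conj_list_nth_eqI[OF conj_list_in_Lam[OF assms] i b])
    fix k assume k: "1 \<le> k" "k \<le> m"
    then obtain j where j: "k = Suc j" "j < m" by (cases k) auto
    have "int (Suc i) \<le> conj_list n m \<mu> ! j \<longleftrightarrow> int j < part_at m \<mu> (Suc i)"
      by (rule conj_list_ge_iff[OF assms j(2)]) (use i in simp)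
    then show "int k \<le> \<mu> ! i \<longleftrightarrow> int i < part_at n (conj_list n m \<mu>) k"
      using i j by (simp add: part_at_Suc len) linarith
  qed
qed

lemma count_list_conj_list:
  assumes "\<mu> \<in> Lam n m" "i \<le> n"
  shows "int (count_list (conj_list n m \<mu>) (int i)) = part_at m \<mu> i - part_at m \<mu> (Suc i)"
proof -
  have "count_list (conj_list n m \<mu>) (int i) = card {j. j < m \<and> conj_list n m \<mu> ! j = int i}"
    by (simp add: count_list_eq_length_filter length_filter_conv_card eq_commute)
  also have "{j. j < m \<and> conj_list n m \<mu> ! j = int i} = {nat (part_at m \<mu> (Suc i))..<nat (part_at m \<mu> i)}"
  proof (intro set_eqI iffI; clarify?)
    fix j assume j: "j < m" "conj_list n m \<mu> ! j = int i"
    then show "j \<in> {nat (part_at m \<mu> (Suc i))..<nat (part_at m \<mu> i)}"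
      using conj_list_ge_iff[OF assms(1) j(1), of i] conj_list_ge_iff[OF assms(1) j(1), of "Suc i"] assms(2) by auto
  next
    fix j assume j: "j \<in> {nat (part_at m \<mu> (Suc i))..<nat (part_at m \<mu> i)}"
    then have "int j < int m" using part_at_bounds(2)[OF assms(1), of i] by auto
    then have jm: "j < m" by simp
    show "j < m \<and> conj_list n m \<mu> ! j = int i"
      using conj_list_ge_iff[OF assms(1) jm, of i] conj_list_ge_iff[OF assms(1) jm, of "Suc i"] assms(2) j jm
        part_at_bounds(1)[OF assms(1), of "Suc i"] by auto
  qed
  finally show ?thesis
    using part_at_bounds(1)[OF assms(1), of "Suc i"] part_at_antimono[OF assms(1), of i "Suc i"] by simp
qed

text \<open>Equal multiplicities mean equal multisets, and a decreasing list is determined by its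
  multiset. This is the uniqueness behind the \<open>THE\<close> in
  \<open>conj_part\<close>.\<close>

lemma Lam_eqI_count:
  assumes "\<kappa> \<in> Lam m n" "\<kappa>' \<in> Lam m n"
    and "\<And>i. i \<le> n \<Longrightarrow> count_list \<kappa> (int i) = count_list \<kappa>' (int i)"
  shows "\<kappa> = \<kappa>'"
proof -
  have "count_list \<kappa> x = count_list \<kappa>' x" for x
  proof (cases "0 \<le> x \<and> x \<le> int n")
    case True
    then show ?thesis using assms(3)[of "nat x"] by auto
  next
    case False
    then have "x \<notin> set \<kappa>" "x \<notin> set \<kappa>'" using assms(1,2) by (auto simp: Lam_def)
    then show ?thesis by (simp add: count_list_0_iff)
  qed
  then have "mset \<kappa> = mset \<kappa>'"
    by (intro multiset_eqI) (simp add: count_mset)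
  then have "mset (rev \<kappa>) = mset (rev \<kappa>')" by simp
  moreover have "sorted (rev \<kappa>)" "sorted (rev \<kappa>')"
    using assms(1,2) by (simp_all add: Lam_def sorted_wrt_rev)
  ultimately have "rev \<kappa> = rev \<kappa>'" by (metis properties_for_sort)
  then show ?thesis by simp
qed

lemma conj_part_eq_conj_list:
  assumes "\<mu> \<in> Lam n m"
  shows "conj_part n m \<mu> = conj_list n m \<mu>"
  unfolding conj_part_def
proof (rule the_equality)
  show "conj_list n m \<mu> \<in> Lam m n \<and> (\<forall>i\<le>n. int (count_list (conj_list n m \<mu>) (int i)) = part_at m \<mu> i - part_at m \<mu> (Suc i))"
    using conj_list_in_Lam[OF assms] count_list_conj_list[OF assms] by blast
  fix \<kappa> assume \<kappa>: "\<kappa> \<in> Lam m n \<and> (\<forall>i\<le>n. int (count_list \<kappa> (int i)) = part_at m \<mu> i - part_at m \<mu> (Suc i))"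
  have "count_list \<kappa> (int i) = count_list (conj_list n m \<mu>) (int i)" if "i \<le> n" for i
    using \<kappa> count_list_conj_list[OF assms that] that by (metis of_nat_eq_iff)
  then show "\<kappa> = conj_list n m \<mu>"
    using Lam_eqI_count \<kappa> conj_list_in_Lam[OF assms] by blast
qed

lemma bij_betw_conj_list: "bij_betw (conj_list n m) (Lam n m) (Lam m n)"
  by (rule bij_betw_byWitness[where f' = "conj_list m n"]) (auto simp: conj_list_involution conj_list_in_Lam)

section \<open>Adding and removing a box under conjugation\<close>

lemma part_at_shift:
  assumes "\<mu> \<in> Lam n m" "1 \<le> i" "i \<le> n"
  shows "part_at m (shift \<mu> i d) k = part_at m \<mu> k + (if k = i then d else 0)"
proof -
  have "length \<mu> = n" using assms(1) by (simp add: Lam_def)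
  then show ?thesis using assms(2,3) by (auto simp: part_at_def shift_def nth_list_update)
qed

lemma length_shift [simp]: "length (shift \<mu> i d) = length \<mu>"
  by (simp add: shift_def)

lemma shift_up_in_Lam:
  assumes "\<mu> \<in> Lam n m" "1 \<le> i" "i \<le> n"
  shows "shift \<mu> i 1 \<in> Lam n m \<longleftrightarrow> part_at m \<mu> i < part_at m \<mu> (i - 1)"
proof -
  have len: "length \<mu> = n" and dec: "\<And>k. k \<le> n \<Longrightarrow> part_at m \<mu> (Suc k) \<le> part_at m \<mu> k"
    using assms(1) by (auto simp: Lam_iff)
  show ?thesis
  proof
    assume "shift \<mu> i 1 \<in> Lam n m"
    then have "part_at m (shift \<mu> i 1) (Suc (i - 1)) \<le> part_at m (shift \<mu> i 1) (i - 1)"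
      using assms(2,3) by (simp only: Lam_iff)
    then show "part_at m \<mu> i < part_at m \<mu> (i - 1)"
      using assms(2) by (simp add: part_at_shift[OF assms] split: if_splits)
  next
    assume h: "part_at m \<mu> i < part_at m \<mu> (i - 1)"
    have "part_at m (shift \<mu> i 1) (Suc k) \<le> part_at m (shift \<mu> i 1) k" if "k \<le> n" for k
      using dec[OF that] h by (auto simp: part_at_shift[OF assms])
    then show "shift \<mu> i 1 \<in> Lam n m" by (simp add: Lam_iff len)
  qed
qed

lemma shift_down_in_Lam:
  assumes "\<mu> \<in> Lam n m" "1 \<le> i" "i \<le> n"
  shows "shift \<mu> i (- 1) \<in> Lam n m \<longleftrightarrow> part_at m \<mu> (Suc i) < part_at m \<mu> i"
proof -
  have len: "length \<mu> = n" and dec: "\<And>k. k \<le> n \<Longrightarrow> part_at m \<mu> (Suc k) \<le> part_at m \<mu> k"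
    using assms(1) by (auto simp: Lam_iff)
  show ?thesis
  proof
    assume "shift \<mu> i (- 1) \<in> Lam n m"
    then have "part_at m (shift \<mu> i (- 1)) (Suc i) \<le> part_at m (shift \<mu> i (- 1)) i"
      using assms(2,3) by (simp only: Lam_iff)
    then show "part_at m \<mu> (Suc i) < part_at m \<mu> i"
      by (simp add: part_at_shift[OF assms])
  next
    assume h: "part_at m \<mu> (Suc i) < part_at m \<mu> i"
    have "part_at m (shift \<mu> i (- 1)) (Suc k) \<le> part_at m (shift \<mu> i (- 1)) k" if "k \<le> n" for k
      using dec[OF that] h by (auto simp: part_at_shift[OF assms])
    then show "shift \<mu> i (- 1) \<in> Lam n m" by (simp add: Lam_iff len)
  qed
qed

text \<open>The new box of row \<open>i\<close> lies in column \<open>part_at m \<mu> i\<close>,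
  counted from \<open>0\<close>, whose length grows from \<open>i - 1\<close> to
  \<open>i\<close>.\<close>

lemma conj_list_shift_up:
  assumes \<mu>: "\<mu> \<in> Lam n m" "1 \<le> i" "i \<le> n" and s: "shift \<mu> i 1 \<in> Lam n m" and j: "j < m"
  shows "conj_list n m (shift \<mu> i 1) ! j = (if j = nat (part_at m \<mu> i) then int i else conj_list n m \<mu> ! j)"
proof (rule conj_list_nth_eqI[OF s j])
  fix k assume k: "1 \<le> k" "k \<le> n"
  have lt: "part_at m \<mu> i < part_at m \<mu> (i - 1)" using s shift_up_in_Lam[OF \<mu>] by blast
  have p: "0 \<le> part_at m \<mu> i" by (rule part_at_bounds(1)[OF \<mu>(1)])
  have 1: "part_at m \<mu> i < part_at m \<mu> k" if "k < i"
    by (rule less_le_trans[OF lt part_at_antimono[OF \<mu>(1)]]) (use that in simp)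
  have 2: "i \<le> k \<Longrightarrow> part_at m \<mu> k \<le> part_at m \<mu> i" using part_at_antimono[OF \<mu>(1)] by simp
  show "int k \<le> (if j = nat (part_at m \<mu> i) then int i else conj_list n m \<mu> ! j)
      \<longleftrightarrow> int j < part_at m (shift \<mu> i 1) k"
    using conj_list_ge_iff[OF \<mu>(1) j, of k] k p 1 2 by (cases k i rule: linorder_cases) (auto simp: part_at_shift[OF \<mu>])
qed (use assms(3) conj_list_nth_bounds[OF j] in auto)

lemma conj_list_shift_down:
  assumes \<mu>: "\<mu> \<in> Lam n m" "1 \<le> i" "i \<le> n" and s: "shift \<mu> i (- 1) \<in> Lam n m" and j: "j < m"
  shows "conj_list n m (shift \<mu> i (- 1)) ! j = (if j = nat (part_at m \<mu> i) - 1 then int i - 1 else conj_list n m \<mu> ! j)"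
proof (rule conj_list_nth_eqI[OF s j])
  fix k assume k: "1 \<le> k" "k \<le> n"
  have lt: "part_at m \<mu> (Suc i) < part_at m \<mu> i" using s shift_down_in_Lam[OF \<mu>] by blast
  \<comment> \<open>Together with \<open>lt\<close> this makes part \<open>i\<close> at least
    \<open>1\<close>, so the subtraction giving the column of the removed box does not
    truncate.\<close>
  have p: "0 \<le> part_at m \<mu> (Suc i)" by (rule part_at_bounds(1)[OF \<mu>(1)])
  have 1: "k \<le> i \<Longrightarrow> part_at m \<mu> i \<le> part_at m \<mu> k"
    using part_at_antimono[OF \<mu>(1), of k i] by simp
  have 2: "i < k \<Longrightarrow> part_at m \<mu> k < part_at m \<mu> i"
    using part_at_antimono[OF \<mu>(1), of "Suc i" k] lt by simp
  show "int k \<le> (if j = nat (part_at m \<mu> i) - 1 then int i - 1 else conj_list n m \<mu> ! j)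
      \<longleftrightarrow> int j < part_at m (shift \<mu> i (- 1)) k"
    using conj_list_ge_iff[OF \<mu>(1) j, of k] k p lt 1 2 by (cases k i rule: linorder_cases) (auto simp: part_at_shift[OF \<mu>])
qed (use assms(2,3) conj_list_nth_bounds[OF j] in auto)

section \<open>Eigenfunctions and completeness\<close>

text \<open>Gaussian elimination on the equations: an equation with a nonzero coefficient is solved
  for a pivot unknown \<open>z\<close>, which leaves one equation and one unknown fewer.\<close>

lemma underdetermined:
  fixes M :: "'a \<Rightarrow> 'b \<Rightarrow> 'c :: field"
  assumes "finite B" "finite A" "card B < card A"
  shows "\<exists>d. (\<exists>a\<in>A. d a \<noteq> 0) \<and> (\<forall>b\<in>B. (\<Sum>a\<in>A. d a * M a b) = 0)"
  using assms
proof (induction B arbitrary: A M rule: finite_induct)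
  case empty
  then obtain a where "a \<in> A" by fastforce
  then show ?case by (intro exI[of _ "\<lambda>_. 1"]) auto
next
  case (insert b B)
  show ?case
  proof (cases "\<forall>a\<in>A. M a b = 0")
    case True
    have "card B < card A" using insert.prems insert.hyps by simp
    then obtain d where "\<exists>a\<in>A. d a \<noteq> 0" "\<forall>b\<in>B. (\<Sum>a\<in>A. d a * M a b) = 0"
      using insert.IH[OF insert.prems(1)] by blast
    with True show ?thesis by (intro exI[of _ d]) auto
  next
    case False
    then obtain z where z: "z \<in> A" "M z b \<noteq> 0" by blast
    define M' where "M' = (\<lambda>a c. M a c - M a b / M z b * M z c)"
    have "card B < card (A - {z})" using insert.prems insert.hyps z by simp
    then obtain d where d: "\<exists>a\<in>A - {z}. d a \<noteq> 0" "\<forall>c\<in>B. (\<Sum>a\<in>A - {z}. d a * M' a c) = 0"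
      using insert.IH[of "A - {z}" M'] insert.prems by blast
    \<comment> \<open>The value at \<open>z\<close> is the one forced by equation \<open>b\<close>;
      substituting it turns \<open>M\<close> into the reduced matrix \<open>M'\<close> in all other
      equations.\<close>
    define e where "e = d(z := - (\<Sum>a\<in>A - {z}. d a * M a b) / M z b)"
    have e: "(\<Sum>a\<in>A. e a * M a c) = (\<Sum>a\<in>A - {z}. d a * M' a c)" for c
    proof -
      have "(\<Sum>a\<in>A. e a * M a c) = e z * M z c + (\<Sum>a\<in>A - {z}. e a * M a c)"
        by (rule sum.remove) (use insert.prems z in auto)
      also have "(\<Sum>a\<in>A - {z}. e a * M a c) = (\<Sum>a\<in>A - {z}. d a * M a c)"
        by (rule sum.cong) (auto simp: e_def)
      also have "e z * M z c = - (\<Sum>a\<in>A - {z}. d a * (M a b / M z b * M z c))"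
      proof -
        have "(\<Sum>a\<in>A - {z}. d a * (M a b / M z b * M z c)) = (\<Sum>a\<in>A - {z}. d a * M a b) * (M z c / M z b)"
          unfolding sum_distrib_right by (rule sum.cong) auto
        then show ?thesis by (simp add: e_def)
      qed
      also have "- (\<Sum>a\<in>A - {z}. d a * (M a b / M z b * M z c)) + (\<Sum>a\<in>A - {z}. d a * M a c)
          = (\<Sum>a\<in>A - {z}. d a * M' a c)"
        by (simp add: M'_def right_diff_distrib sum_subtractf)
      finally show ?thesis .
    qed
    have "(\<Sum>a\<in>A - {z}. d a * M' a b) = 0" using z by (simp add: M'_def)
    then have "\<forall>c\<in>insert b B. (\<Sum>a\<in>A. e a * M a c) = 0" unfolding e using d(2) by simp
    moreover have "\<exists>a\<in>A. e a \<noteq> 0" using d(1) by (auto simp: e_def)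
    ultimately show ?thesis by blast
  qed
qed

text \<open>The target \<open>f\<close> is adjoined to the family under the index
  \<open>None\<close>. The enlarged family is too big to be independent, and in a dependence the
  coefficient of \<open>f\<close> cannot vanish.\<close>

lemma independent_imp_spanning:
  fixes M :: "'a \<Rightarrow> 'b \<Rightarrow> 'c :: field"
  assumes "finite A" "finite B" "card B \<le> card A"
    and ind: "\<And>c. \<forall>b\<in>B. (\<Sum>a\<in>A. c a * M a b) = 0 \<Longrightarrow> \<forall>a\<in>A. c a = 0"
  shows "\<exists>c. \<forall>b\<in>B. f b = (\<Sum>a\<in>A. c a * M a b)"
proof -
  define M' where "M' = (\<lambda>x b. case x of None \<Rightarrow> f b | Some a \<Rightarrow> M a b)"
  have "card B < card (insert None (Some ` A))"
    using assms(1,3) by (simp add: card_image)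
  then obtain d where d: "\<exists>x\<in>insert None (Some ` A). d x \<noteq> 0"
      "\<forall>b\<in>B. (\<Sum>x\<in>insert None (Some ` A). d x * M' x b) = 0"
    using underdetermined[OF assms(2), of "insert None (Some ` A)" M'] assms(1) by blast
  have s: "(\<Sum>x\<in>insert None (Some ` A). d x * M' x b) = d None * f b + (\<Sum>a\<in>A. d (Some a) * M a b)" for b
    using assms(1) by (simp add: M'_def sum.reindex)
  have "d None \<noteq> 0"
  proof
    assume "d None = 0"
    then have "\<forall>a\<in>A. d (Some a) = 0" using ind[of "\<lambda>a. d (Some a)"] d(2) by (simp add: s)
    with \<open>d None = 0\<close> d(1) show False by auto
  qed
  have "f b = (\<Sum>a\<in>A. (- d (Some a) / d None) * M a b)" if "b \<in> B" for b
  proof -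
    have "d None * f b = - (\<Sum>a\<in>A. d (Some a) * M a b)"
      using d(2) that by (simp add: s eq_neg_iff_add_eq_0)
    then have "f b = - (\<Sum>a\<in>A. d (Some a) * M a b) / d None"
      using \<open>d None \<noteq> 0\<close> by (simp add: field_simps)
    then show ?thesis by (simp add: sum_divide_distrib sum_negf)
  qed
  then show ?thesis by (intro exI[of _ "\<lambda>a. - d (Some a) / d None"] ballI)
qed

lemma boundary_relations_sum:
  assumes "1 \<le> n" "\<And>k. k \<in> K \<Longrightarrow> boundary_relations (L k) m n q ap bp am bm"
  shows "boundary_relations (\<lambda>l. \<Sum>k\<in>K. c k * L k l) m n q ap bp am bm"
proof
  fix l i a b assume i: "Suc i < m"
  show "(\<Sum>k\<in>K. c k * L k (l(i := a, Suc i := b + 1))) - q * (\<Sum>k\<in>K. c k * L k (l(i := a + 1, Suc i := b)))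
     + ((\<Sum>k\<in>K. c k * L k (l(i := b, Suc i := a + 1))) - q * (\<Sum>k\<in>K. c k * L k (l(i := b + 1, Suc i := a)))) = 0"
    (is "?lhs = 0")
  proof -
    have "?lhs = (\<Sum>k\<in>K. c k * (L k (l(i := a, Suc i := b + 1)) - q * L k (l(i := a + 1, Suc i := b))
       + (L k (l(i := b, Suc i := a + 1)) - q * L k (l(i := b + 1, Suc i := a)))))"
      unfolding sum_distrib_left sum.distrib[symmetric] sum_subtractf[symmetric]
      by (rule sum.cong) (auto simp: algebra_simps)
    also have "\<dots> = 0"
      by (rule sum.neutral) (use boundary_relations.swap[OF assms(2) i] in simp)
    finally show ?thesis .
  qed
next
  fix l k' s assume i: "m = Suc k'"
  show "(\<Sum>k\<in>K. c k * L k (l(k' := s - 1))) - bp * (\<Sum>k\<in>K. c k * L k (l(k' := s))) + ap * (\<Sum>k\<in>K. c k * L k (l(k' := s + 1)))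
     + ((\<Sum>k\<in>K. c k * L k (l(k' := - s - 1))) - bp * (\<Sum>k\<in>K. c k * L k (l(k' := - s))) + ap * (\<Sum>k\<in>K. c k * L k (l(k' := - s + 1)))) = 0"
    (is "?lhs = 0")
  proof -
    have "?lhs = (\<Sum>k\<in>K. c k * (L k (l(k' := s - 1)) - bp * L k (l(k' := s)) + ap * L k (l(k' := s + 1))
       + (L k (l(k' := - s - 1)) - bp * L k (l(k' := - s)) + ap * L k (l(k' := - s + 1)))))"
      unfolding sum_distrib_left sum.distrib[symmetric] sum_subtractf[symmetric]
      by (rule sum.cong) (auto simp: algebra_simps)
    also have "\<dots> = 0"
      by (rule sum.neutral) (use boundary_relations.last[OF assms(2) i] in simp)
    finally show ?thesis .
  qed
next
  fix l s assume i: "0 < m"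
  show "(\<Sum>k\<in>K. c k * L k (l(0 := int n + s + 1))) - bm * (\<Sum>k\<in>K. c k * L k (l(0 := int n + s))) + am * (\<Sum>k\<in>K. c k * L k (l(0 := int n + s - 1)))
     + ((\<Sum>k\<in>K. c k * L k (l(0 := int n - s + 1))) - bm * (\<Sum>k\<in>K. c k * L k (l(0 := int n - s))) + am * (\<Sum>k\<in>K. c k * L k (l(0 := int n - s - 1)))) = 0"
    (is "?lhs = 0")
  proof -
    have "?lhs = (\<Sum>k\<in>K. c k * (L k (l(0 := int n + s + 1)) - bm * L k (l(0 := int n + s)) + am * L k (l(0 := int n + s - 1))
       + (L k (l(0 := int n - s + 1)) - bm * L k (l(0 := int n - s)) + am * L k (l(0 := int n - s - 1)))))"
      unfolding sum_distrib_left sum.distrib[symmetric] sum_subtractf[symmetric]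
      by (rule sum.cong) (auto simp: algebra_simps)
    also have "\<dots> = 0"
      by (rule sum.neutral) (use boundary_relations.first[OF assms(2) i] in simp)
    finally show ?thesis .
  qed
qed (rule assms(1))

lemma Ham_cong:
  assumes "\<And>\<mu>. \<mu> \<in> Lam n m \<Longrightarrow> \<psi> \<mu> = \<phi> \<mu>" "\<mu> \<in> Lam n m"
  shows "Ham q ap bp am bm n m \<psi> \<mu> = Ham q ap bp am bm n m \<phi> \<mu>"
proof -
  have "(\<Sum>i\<in>{i \<in> {1..n}. shift \<mu> i d \<in> Lam n m}. f i * \<psi> (shift \<mu> i d))
      = (\<Sum>i\<in>{i \<in> {1..n}. shift \<mu> i d \<in> Lam n m}. f i * \<phi> (shift \<mu> i d))" for f d
    by (rule sum.cong) (simp_all add: assms(1))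
  then show ?thesis unfolding Ham_def assms(1)[OF assms(2)] by simp
qed

lemma Ham_sum:
  "Ham q ap bp am bm n m (\<lambda>\<mu>. \<Sum>k\<in>K. c k * \<phi> k \<mu>) \<mu> = (\<Sum>k\<in>K. c k * Ham q ap bp am bm n m (\<phi> k) \<mu>)"
proof -
  have swap: "(\<Sum>i\<in>I. a i * (\<Sum>k\<in>K. c k * f k i)) = (\<Sum>k\<in>K. c k * (\<Sum>i\<in>I. a i * f k i))"
    for I :: "nat set" and a and f :: "_ \<Rightarrow> nat \<Rightarrow> complex"
    unfolding sum_distrib_left by (subst sum.swap) (simp add: mult_ac)
  have swap1: "a * (\<Sum>k\<in>K. c k * f k) = (\<Sum>k\<in>K. c k * (a * f k))" for a and f :: "_ \<Rightarrow> complex"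
    unfolding sum_distrib_left by (simp add: mult_ac)
  show ?thesis
    unfolding Ham_def unfolding swap unfolding swap1 sum.distrib[symmetric]
    by (rule sum.cong) (simp_all only: distrib_left)
qed

section \<open>The Hamiltonian on the wave functions\<close>

context qboson begin

abbreviation "phi \<kappa> \<equiv> wave q (pp * qp) (pp + qp) n m (xi \<kappa>)"

abbreviation "H \<equiv> Ham q (pp * qp) (pp + qp) (pm * qm) (pm + qm) n m"

abbreviation "E \<kappa> \<equiv> Efun q m (xi \<kappa>)"

abbreviation "relations L \<equiv> boundary_relations L m n (of_real q) (of_real (pp * qp)) (of_real (pp + qp))
  (of_real (pm * qm)) (of_real (pm + qm))"

lemma relations_psi:
  assumes "\<kappa> \<in> Lam m n" shows "relations (psi \<kappa>)"
proof
  fix l i a b assume i: "Suc i < m"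
  show "psi \<kappa> (l(i := a, Suc i := b + 1)) - of_real q * psi \<kappa> (l(i := a + 1, Suc i := b))
     + (psi \<kappa> (l(i := b, Suc i := a + 1)) - of_real q * psi \<kappa> (l(i := b + 1, Suc i := a))) = 0"
    unfolding psi_def sum_distrib_left sum.distrib[symmetric] sum_subtractf[symmetric]
    by (rule plane_wave_swap_relation[OF i signed_orbit_swap[OF _ xi_Rm i]])
next
  fix l k s assume m: "m = Suc k"
  have S: "x(k := - x k) \<in> signed_orbit m (xi \<kappa>)" if "x \<in> signed_orbit m (xi \<kappa>)" for x
    by (rule signed_orbit_flip[OF that xi_Rm]) (simp add: m)
  show "psi \<kappa> (l(k := s - 1)) - of_real (pp + qp) * psi \<kappa> (l(k := s)) + of_real (pp * qp) * psi \<kappa> (l(k := s + 1))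
     + (psi \<kappa> (l(k := - s - 1)) - of_real (pp + qp) * psi \<kappa> (l(k := - s)) + of_real (pp * qp) * psi \<kappa> (l(k := - s + 1))) = 0"
    using plane_wave_last_relation[where S = "signed_orbit m (xi \<kappa>)" and m = k and l = l and s = s and q = q
        and ap = "pp * qp" and bp = "pp + qp", OF S]
    unfolding psi_def sum_distrib_left sum.distrib[symmetric] sum_subtractf[symmetric] m[symmetric] .
next
  fix l s assume "0 < m"
  then obtain m' where m: "m = Suc m'" by (cases m) auto
  have S: "x(0 := - x 0) \<in> signed_orbit m (xi \<kappa>)" if "x \<in> signed_orbit m (xi \<kappa>)" for x
    by (rule signed_orbit_flip[OF that xi_Rm]) (simp add: m)
  have B: "cis (theta x 0) = 1" if "x \<in> signed_orbit m (xi \<kappa>)" for x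
    by (rule cis_theta_orb[OF assms that]) (simp add: m)
  show "psi \<kappa> (l(0 := int n + s + 1)) - of_real (pm + qm) * psi \<kappa> (l(0 := int n + s)) + of_real (pm * qm) * psi \<kappa> (l(0 := int n + s - 1))
     + (psi \<kappa> (l(0 := int n - s + 1)) - of_real (pm + qm) * psi \<kappa> (l(0 := int n - s)) + of_real (pm * qm) * psi \<kappa> (l(0 := int n - s - 1))) = 0"
    unfolding psi_def sum_distrib_left sum.distrib[symmetric] sum_subtractf[symmetric]
    by (rule plane_wave_first_relation[OF m S B])
qed (rule n)

text \<open>Needed because indexing a list of length \<open>m\<close> is unspecified from
  \<open>m\<close> on.\<close>

lemma psi_cong: "(\<And>j. j < m \<Longrightarrow> l j = l' j) \<Longrightarrow> psi \<kappa> l = psi \<kappa> l'"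
proof -
  assume "\<And>j. j < m \<Longrightarrow> l j = l' j"
  then have "(\<Sum>j<m. x j * of_int (l j)) = (\<Sum>j<m. x j * of_int (l' j))" for x :: "nat \<Rightarrow> real"
    by (intro sum.cong) auto
  then show "psi \<kappa> l = psi \<kappa> l'" by (simp only: psi_def plane_wave_def)
qed

text \<open>Every plane wave is an eigenfunction of the free Laplacian, and a sum of cosines is
  invariant under signed permutations, so the whole orbit shares one eigenvalue.\<close>

lemma psi_laplacian:
  "(1 - of_real q) * (\<Sum>j<m. psi \<kappa> (l(j := l j + 1)) + psi \<kappa> (l(j := l j - 1))) = of_real (E \<kappa>) * psi \<kappa> l"
proof -
  let ?w = "plane_wave q (pp * qp) (pp + qp) m"
  have step: "?w x (l(j := l j + 1)) + ?w x (l(j := l j - 1)) = of_real (2 * cos (x j)) * ?w x l" if "j < m" for x j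
  proof -
    have l: "l(j := l j) = l" by simp
    have "?w x (l(j := l j + 1)) = cis (x j) * ?w x l" "?w x (l(j := l j - 1)) = cis (- x j) * ?w x l"
      using sum_upd1[OF that, of x l "l j"] unfolding plane_wave_def sum_upd1[OF that] l
      by (simp_all add: cis_mult[symmetric] algebra_simps cis_add cis_diff)
    moreover have "cis (x j) + cis (- x j) = of_real (2 * cos (x j))" by (simp add: complex_eq_iff)
    ultimately show ?thesis by (metis distrib_right)
  qed
  have c: "(\<Sum>j<m. cos (x j)) = (\<Sum>j<m. cos (xi \<kappa> j))" if x: "x \<in> signed_orbit m (xi \<kappa>)" for x
  proof -
    obtain \<sigma> \<epsilon> where *: "\<sigma> permutes {..<m}" "\<And>j. j < m \<Longrightarrow> \<epsilon> j \<in> {-1, 1}" "\<And>j. j < m \<Longrightarrow> x j = \<epsilon> j * xi \<kappa> (\<sigma> j)"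
      using orbE[OF x xi_Rm] by metis
    have "(\<Sum>j<m. cos (x j)) = (\<Sum>j<m. cos (xi \<kappa> (\<sigma> j)))"
    proof (rule sum.cong)
      fix j assume "j \<in> {..<m}"
      then show "cos (x j) = cos (xi \<kappa> (\<sigma> j))" using *(2)[of j] *(3)[of j] by auto
    qed simp
    also have "\<dots> = (\<Sum>j<m. cos (xi \<kappa> j))"
      by (rule sum.reindex_bij_betw[OF permutes_imp_bij[OF *(1)]])
    finally show ?thesis .
  qed
  have "(\<Sum>j<m. psi \<kappa> (l(j := l j + 1)) + psi \<kappa> (l(j := l j - 1)))
     = (\<Sum>x\<in>signed_orbit m (xi \<kappa>). \<Sum>j<m. ?w x (l(j := l j + 1)) + ?w x (l(j := l j - 1)))"
    unfolding psi_def sum.distrib[symmetric] by (rule sum.swap)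
  also have "\<dots> = (\<Sum>x\<in>signed_orbit m (xi \<kappa>). of_real (2 * (\<Sum>j<m. cos (x j))) * ?w x l)"
  proof (rule sum.cong[OF refl])
    fix x
    have "(\<Sum>j<m. ?w x (l(j := l j + 1)) + ?w x (l(j := l j - 1))) = (\<Sum>j<m. of_real (2 * cos (x j)) * ?w x l)"
      by (rule sum.cong) (auto simp: step)
    then show "(\<Sum>j<m. ?w x (l(j := l j + 1)) + ?w x (l(j := l j - 1))) = of_real (2 * (\<Sum>j<m. cos (x j))) * ?w x l"
      by (simp only: sum_distrib_right[symmetric] of_real_sum[symmetric] sum_distrib_left[symmetric])
  qed
  also have "\<dots> = of_real (2 * (\<Sum>j<m. cos (xi \<kappa> j))) * psi \<kappa> l"
  proof -
    have "(\<Sum>x\<in>signed_orbit m (xi \<kappa>). of_real (2 * (\<Sum>j<m. cos (x j))) * ?w x l)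
       = (\<Sum>x\<in>signed_orbit m (xi \<kappa>). of_real (2 * (\<Sum>j<m. cos (xi \<kappa> j))) * ?w x l)"
      by (rule sum.cong) (simp_all only: c)
    then show ?thesis by (simp only: psi_def sum_distrib_left[symmetric])
  qed
  finally show ?thesis by (simp add: Efun_def)
qed

lemma phi_eq: "\<kappa> \<in> Lam m n \<Longrightarrow> \<mu> \<in> Lam n m \<Longrightarrow> phi \<kappa> \<mu> = psi \<kappa> (\<lambda>j. conj_list n m \<mu> ! j)"
  by (simp add: wave_eq conj_part_eq_conj_list)

lemma H_phi:
  assumes \<kappa>: "\<kappa> \<in> Lam m n" and \<mu>: "\<mu> \<in> Lam n m"
  shows "H (phi \<kappa>) \<mu> = of_real (E \<kappa>) * phi \<kappa> \<mu>"
proof -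
  interpret R: boundary_relations "psi \<kappa>" m n "of_real q" "of_real (pp * qp)" "of_real (pp + qp)"
    "of_real (pm * qm)" "of_real (pm + qm)"
    by (rule relations_psi[OF \<kappa>])
  define l where "l = (\<lambda>j. conj_list n m \<mu> ! j)"
  define M where "M = (\<lambda>i. nat (part_at m \<mu> i))"
  have P: "part_at m \<mu> i = int (M i)" for i by (simp add: M_def part_at_bounds[OF \<mu>])
  have M: "M 0 = m" "M (Suc n) = 0" "\<And>i. i \<le> n \<Longrightarrow> M (Suc i) \<le> M i"
    using \<mu> part_at_antimono[OF \<mu>, of i "Suc i" for i]
    by (auto simp: M_def part_at_beyond Lam_def intro!: nat_mono)
  have Mm: "M i \<le> m" for i using part_at_bounds(2)[OF \<mu>, of i] by (simp add: P)
  have l: "l j = int i" if "i \<le> n" "M (Suc i) \<le> j" "j < M i" for i j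
  proof -
    have "j < m" using that(3) Mm[of i] by simp
    then show ?thesis
      using conj_list_ge_iff[OF \<mu>, of j i] conj_list_ge_iff[OF \<mu>, of j "Suc i"] that by (simp add: l_def P)
  qed
  have up: "phi \<kappa> (shift \<mu> i 1) = psi \<kappa> (l(M i := int i))" if "1 \<le> i" "i \<le> n" "shift \<mu> i 1 \<in> Lam n m" for i
    unfolding phi_eq[OF \<kappa> that(3)]
    by (rule psi_cong) (simp add: conj_list_shift_up[OF \<mu> that] l_def M_def)
  have down: "phi \<kappa> (shift \<mu> i (- 1)) = psi \<kappa> (l(M i - 1 := int i - 1))" if "1 \<le> i" "i \<le> n" "shift \<mu> i (- 1) \<in> Lam n m" for i
    unfolding phi_eq[OF \<kappa> that(3)]
    by (rule psi_cong) (simp add: conj_list_shift_down[OF \<mu> that] l_def M_def)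
  have e: "nat (int a - int b) = a - b" "nat (int a - int b - 1) = a - b - 1" "nat (int a - 1) = a - 1" for a b
    by linarith+
  \<comment> \<open>\<open>Ham\<close> sums over admissible moves only. A move is inadmissible
    exactly when the two parts involved coincide, and then its coefficient is zero, so the sum over
    all \<open>i\<close> is the same.\<close>
  have U: "(\<Sum>i\<in>{1..n}. (if i = 1 then 1 - of_real (pp * qp) * of_real q ^ (m - M 1 - 1) else 1)
        * (1 - of_real q ^ (M (i - 1) - M i)) * psi \<kappa> (l(M i := int i)))
     = (\<Sum>i\<in>{i \<in> {1..n}. shift \<mu> i 1 \<in> Lam n m}.
        complex_of_real ((if i = 1 then 1 - pp * qp * q ^ nat (int m - part_at m \<mu> 1 - 1) else 1)
          * (1 - q ^ nat (part_at m \<mu> (i - 1) - part_at m \<mu> i))) * phi \<kappa> (shift \<mu> i 1))"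
  proof (rule sum.mono_neutral_cong_right)
    show "\<forall>i\<in>{1..n} - {i \<in> {1..n}. shift \<mu> i 1 \<in> Lam n m}.
      (if i = 1 then 1 - of_real (pp * qp) * of_real q ^ (m - M 1 - 1) else 1)
        * (1 - of_real q ^ (M (i - 1) - M i)) * psi \<kappa> (l(M i := int i)) = 0"
    proof
      fix i assume "i \<in> {1..n} - {i \<in> {1..n}. shift \<mu> i 1 \<in> Lam n m}"
      then have "M (i - 1) - M i = 0" using shift_up_in_Lam[OF \<mu>, of i] by (auto simp: P)
      then show "(if i = 1 then 1 - of_real (pp * qp) * of_real q ^ (m - M 1 - 1) else 1)
        * (1 - of_real q ^ (M (i - 1) - M i)) * psi \<kappa> (l(M i := int i)) = 0" by simp
    qed
  next
    fix i assume i: "i \<in> {i \<in> {1..n}. shift \<mu> i 1 \<in> Lam n m}"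
    show "(if i = 1 then 1 - of_real (pp * qp) * of_real q ^ (m - M 1 - 1) else 1)
        * (1 - of_real q ^ (M (i - 1) - M i)) * psi \<kappa> (l(M i := int i))
      = complex_of_real ((if i = 1 then 1 - pp * qp * q ^ nat (int m - part_at m \<mu> 1 - 1) else 1)
          * (1 - q ^ nat (part_at m \<mu> (i - 1) - part_at m \<mu> i))) * phi \<kappa> (shift \<mu> i 1)"
      using i unfolding P e by (subst up) auto
  qed auto
  have D: "(\<Sum>i\<in>{1..n}. (if i = n then 1 - of_real (pm * qm) * of_real q ^ (M n - 1) else 1)
        * (1 - of_real q ^ (M i - M (Suc i))) * psi \<kappa> (l(M i - 1 := int i - 1)))
     = (\<Sum>i\<in>{i \<in> {1..n}. shift \<mu> i (- 1) \<in> Lam n m}.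
        complex_of_real ((if i = n then 1 - pm * qm * q ^ nat (part_at m \<mu> n - 1) else 1)
          * (1 - q ^ nat (part_at m \<mu> i - part_at m \<mu> (Suc i)))) * phi \<kappa> (shift \<mu> i (- 1)))"
  proof (rule sum.mono_neutral_cong_right)
    show "\<forall>i\<in>{1..n} - {i \<in> {1..n}. shift \<mu> i (- 1) \<in> Lam n m}.
      (if i = n then 1 - of_real (pm * qm) * of_real q ^ (M n - 1) else 1)
        * (1 - of_real q ^ (M i - M (Suc i))) * psi \<kappa> (l(M i - 1 := int i - 1)) = 0"
    proof
      fix i assume "i \<in> {1..n} - {i \<in> {1..n}. shift \<mu> i (- 1) \<in> Lam n m}"
      then have "M i - M (Suc i) = 0" using shift_down_in_Lam[OF \<mu>, of i] by (auto simp: P)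
      then show "(if i = n then 1 - of_real (pm * qm) * of_real q ^ (M n - 1) else 1)
        * (1 - of_real q ^ (M i - M (Suc i))) * psi \<kappa> (l(M i - 1 := int i - 1)) = 0" by simp
    qed
  next
    fix i assume i: "i \<in> {i \<in> {1..n}. shift \<mu> i (- 1) \<in> Lam n m}"
    show "(if i = n then 1 - of_real (pm * qm) * of_real q ^ (M n - 1) else 1)
        * (1 - of_real q ^ (M i - M (Suc i))) * psi \<kappa> (l(M i - 1 := int i - 1))
      = complex_of_real ((if i = n then 1 - pm * qm * q ^ nat (part_at m \<mu> n - 1) else 1)
          * (1 - q ^ nat (part_at m \<mu> i - part_at m \<mu> (Suc i)))) * phi \<kappa> (shift \<mu> i (- 1))"
      using i unfolding P e by (subst down) auto
  qed auto
  have phi: "phi \<kappa> \<mu> = psi \<kappa> l" by (simp add: phi_eq[OF \<kappa> \<mu>] l_def)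
  have d: "complex_of_real ((pp + qp) * (1 - q ^ nat (int m - part_at m \<mu> 1)) + (pm + qm) * (1 - q ^ nat (part_at m \<mu> n)))
     = of_real (pp + qp) * (1 - of_real q ^ (m - M 1)) + of_real (pm + qm) * (1 - of_real q ^ M n)"
    unfolding P e nat_int by simp
  have "of_real (E \<kappa>) * phi \<kappa> \<mu> = (1 - of_real q) * (\<Sum>j<m. psi \<kappa> (l(j := l j + 1)) + psi \<kappa> (l(j := l j - 1)))"
    unfolding phi psi_laplacian ..
  also have "\<dots> = H (phi \<kappa>) \<mu>"
    unfolding Ham_def d phi by (rule R.laplacian_eq[where M = M and l = l, OF M l, unfolded U D])
  finally show ?thesis by simp
qed

lemma phi_independent:
  assumes "\<forall>\<mu>\<in>Lam n m. (\<Sum>\<kappa>\<in>Lam m n. c \<kappa> * phi \<kappa> \<mu>) = 0"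
  shows "\<forall>\<kappa>\<in>Lam m n. c \<kappa> = 0"
proof -
  interpret R: boundary_relations "\<lambda>l. \<Sum>\<kappa>\<in>Lam m n. c \<kappa> * psi \<kappa> l" m n "of_real q" "of_real (pp * qp)" "of_real (pp + qp)"
    "of_real (pm * qm)" "of_real (pm + qm)"
    by (rule boundary_relations_sum[OF n relations_psi])
  have "(\<Sum>\<kappa>\<in>Lam m n. c \<kappa> * psi \<kappa> l) = 0" for l
  proof (rule R.vanishing)
    fix l assume l: "\<And>j. j < m \<Longrightarrow> 0 \<le> l j \<and> l j \<le> int n" "\<And>j. Suc j < m \<Longrightarrow> l (Suc j) \<le> l j"
    \<comment> \<open>The hypothesis concerns conjugates of partitions only; as conjugation is an
      involution, every decreasing vector in the box is of this kind.\<close>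
    define lam where "lam = map l [0..<m]"
    have anti: "l j \<le> l i" if "i \<le> j" "j < m" for i j
      using that by (induction j rule: dec_induct) (auto intro: order_trans[OF l(2)])
    have lam: "lam \<in> Lam m n"
      using l(1) anti by (auto simp: Lam_def lam_def sorted_wrt_iff_nth_less)
    define \<mu> where "\<mu> = conj_list m n lam"
    have \<mu>: "\<mu> \<in> Lam n m" "conj_list n m \<mu> = lam" unfolding \<mu>_def using conj_list_in_Lam[OF lam] conj_list_involution[OF lam] by auto
    have "psi \<kappa> l = phi \<kappa> \<mu>" if "\<kappa> \<in> Lam m n" for \<kappa>
      unfolding phi_eq[OF that \<mu>(1)] \<mu>(2) by (rule psi_cong) (simp add: lam_def)
    then have "(\<Sum>\<kappa>\<in>Lam m n. c \<kappa> * psi \<kappa> l) = (\<Sum>\<kappa>\<in>Lam m n. c \<kappa> * phi \<kappa> \<mu>)" by simp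
    then show "(\<Sum>\<kappa>\<in>Lam m n. c \<kappa> * psi \<kappa> l) = 0" using assms \<mu>(1) by simp
  qed
  then show ?thesis using psi_independent finite_Lam by blast
qed

lemma phi_spans: "\<exists>c. \<forall>\<mu>\<in>Lam n m. f \<mu> = (\<Sum>\<kappa>\<in>Lam m n. c \<kappa> * phi \<kappa> \<mu>)"
proof (rule independent_imp_spanning[OF finite_Lam finite_Lam])
  show "card (Lam n m) \<le> card (Lam m n)"
    using bij_betw_same_card[OF bij_betw_conj_list[of n m]] by simp
qed (rule phi_independent)

lemma basis_phi: "is_basis_family n m phi"
  unfolding is_basis_family_def by (intro conjI allI impI phi_independent phi_spans)

text \<open>Expanded in the basis, an eigenvector for \<open>e\<close> has
  \<open>c \<kappa> * (E \<kappa> - e) = 0\<close> for each \<open>\<kappa>\<close>, and some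
  coefficient is nonzero.\<close>

lemma H_spectrum_eq:
  "H_spectrum q (pp * qp) (pp + qp) (pm * qm) (pm + qm) n m = (\<lambda>\<kappa>. complex_of_real (E \<kappa>)) ` Lam m n"
proof (intro equalityI subsetI)
  fix e assume "e \<in> H_spectrum q (pp * qp) (pp + qp) (pm * qm) (pm + qm) n m"
  then obtain \<psi> where \<psi>: "\<exists>\<mu>\<in>Lam n m. \<psi> \<mu> \<noteq> 0" "\<forall>\<mu>\<in>Lam n m. H \<psi> \<mu> = e * \<psi> \<mu>"
    by (auto simp: H_spectrum_def)
  obtain c where c: "\<forall>\<mu>\<in>Lam n m. \<psi> \<mu> = (\<Sum>\<kappa>\<in>Lam m n. c \<kappa> * phi \<kappa> \<mu>)"
    using phi_spans by blast
  have "(\<Sum>\<kappa>\<in>Lam m n. c \<kappa> * (of_real (E \<kappa>) - e) * phi \<kappa> \<mu>) = 0" if \<mu>: "\<mu> \<in> Lam n m" for \<mu>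
  proof -
    have "H \<psi> \<mu> = H (\<lambda>\<mu>. \<Sum>\<kappa>\<in>Lam m n. c \<kappa> * phi \<kappa> \<mu>) \<mu>"
      by (rule Ham_cong) (use c \<mu> in auto)
    also have "\<dots> = (\<Sum>\<kappa>\<in>Lam m n. c \<kappa> * (of_real (E \<kappa>) * phi \<kappa> \<mu>))"
      unfolding Ham_sum by (rule sum.cong) (auto simp: H_phi \<mu>)
    finally have "(\<Sum>\<kappa>\<in>Lam m n. c \<kappa> * (of_real (E \<kappa>) * phi \<kappa> \<mu>)) = e * (\<Sum>\<kappa>\<in>Lam m n. c \<kappa> * phi \<kappa> \<mu>)"
      using \<psi>(2) c \<mu> by simp
    moreover have "(\<Sum>\<kappa>\<in>Lam m n. c \<kappa> * (of_real (E \<kappa>) - e) * phi \<kappa> \<mu>)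
       = (\<Sum>\<kappa>\<in>Lam m n. c \<kappa> * (of_real (E \<kappa>) * phi \<kappa> \<mu>)) - e * (\<Sum>\<kappa>\<in>Lam m n. c \<kappa> * phi \<kappa> \<mu>)"
      unfolding sum_distrib_left sum_subtractf[symmetric] by (rule sum.cong) (auto simp: algebra_simps)
    ultimately show ?thesis by simp
  qed
  then have "\<forall>\<kappa>\<in>Lam m n. c \<kappa> * (of_real (E \<kappa>) - e) = 0" by (intro phi_independent) blast
  moreover have "\<exists>\<kappa>\<in>Lam m n. c \<kappa> \<noteq> 0"
  proof (rule ccontr)
    assume "\<not> ?thesis"
    then have "\<forall>\<mu>\<in>Lam n m. \<psi> \<mu> = 0" using c by simp
    then show False using \<psi>(1) by blast
  qed
  ultimately show "e \<in> (\<lambda>\<kappa>. complex_of_real (E \<kappa>)) ` Lam m n" by auto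
next
  fix e assume "e \<in> (\<lambda>\<kappa>. complex_of_real (E \<kappa>)) ` Lam m n"
  then obtain \<kappa> where \<kappa>: "\<kappa> \<in> Lam m n" "e = of_real (E \<kappa>)" by blast
  \<comment> \<open>A wave function that vanishes on the box would be a linear dependence whose
    coefficients are the indicator of \<open>\<kappa>\<close>.\<close>
  have "\<exists>\<mu>\<in>Lam n m. phi \<kappa> \<mu> \<noteq> 0"
  proof (rule ccontr)
    assume h: "\<not> ?thesis"
    have "(\<Sum>\<kappa>'\<in>Lam m n. (if \<kappa>' = \<kappa> then 1 else 0) * phi \<kappa>' \<mu>) = 0" if "\<mu> \<in> Lam n m" for \<mu>
      using h that by (intro sum.neutral) auto
    then have "\<forall>\<kappa>'\<in>Lam m n. (if \<kappa>' = \<kappa> then 1 else 0 :: complex) = 0"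
      by (intro phi_independent) blast
    then show False using \<kappa>(1) by auto
  qed
  moreover have "\<forall>\<mu>\<in>Lam n m. H (phi \<kappa>) \<mu> = e * phi \<kappa> \<mu>" using H_phi[OF \<kappa>(1)] \<kappa>(2) by simp
  ultimately show "e \<in> H_spectrum q (pp * qp) (pp + qp) (pm * qm) (pm + qm) n m"
    unfolding H_spectrum_def mem_Collect_eq by (intro exI[of _ "phi \<kappa>"] conjI)
qed

end

theorem theorem4p2:
  fixes m n :: nat and q pp qp pm qm :: real
  assumes "1 \<le> n"
    and "-1 < q" "q < 1" "q \<noteq> 0"
    and "-1 < pp" "pp < 1" "pp \<noteq> 0"
    and "-1 < qp" "qp < 1" "qp \<noteq> 0"
    and "-1 < pm" "pm < 1" "pm \<noteq> 0"
    and "-1 < qm" "qm < 1" "qm \<noteq> 0"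
  shows "(H_spectrum q (pp * qp) (pp + qp) (pm * qm) (pm + qm) n m
           = (\<lambda>\<kappa>. complex_of_real (Efun q m (xi_min q pp qp pm qm n m \<kappa>))) ` Lam m n)
    \<and> (is_basis_family n m (\<lambda>\<kappa>. wave q (pp * qp) (pp + qp) n m (xi_min q pp qp pm qm n m \<kappa>)))
    \<and> (\<forall>\<kappa>\<in>Lam m n. \<forall>\<mu>\<in>Lam n m.
           Ham q (pp * qp) (pp + qp) (pm * qm) (pm + qm) n m
               (wave q (pp * qp) (pp + qp) n m (xi_min q pp qp pm qm n m \<kappa>)) \<mu>
           = complex_of_real (Efun q m (xi_min q pp qp pm qm n m \<kappa>))
             * wave q (pp * qp) (pp + qp) n m (xi_min q pp qp pm qm n m \<kappa>) \<mu>)"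
proof -
  interpret qboson q pp qp pm qm n m
    by unfold_locales (use assms in auto)
  show ?thesis by (intro conjI ballI H_spectrum_eq basis_phi H_phi)
qed

end
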